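(* Let $k\ge1$ be an integer and let $X_k$ be a random variable with density $x^{-1}v_k(x)$ on $(0,\infty)$. For real $\lambda\ge0$ and $t\in\mathbb{C}$ consider $$F_{\lambda,k}(t)=\mathbb{E}\!\left(\sqrt{X_k}\,e^{\lambda(\log X_k)^2+it\log X_k}\right)=\int_0^\infty e^{\lambda(\log x)^2+it\log x}\sqrt{x}\,v_k(x)\,\frac{dx}{x}.$$ Then: (i) for every $\lambda\ge 1/8$, every zero $t\in\mathbb{C}$ of $F_{\lambda,k}$ is real; (ii) for $\lambda=0$, $F_{0,k}(t)=0$ for infinitely many real $t$.
   Context: Let $\xi(s)=\frac12 s(s-1)\pi^{-s/2}\Gamma(s/2)\zeta(s)$ be the Riemann xi-function. For an integer $k\ge1$ and $x>0$ define $$v_k(x)=\frac{1}{2\pi i}\int_{c-i\infty}^{c+i\infty}2^k\,\xi(s)^k\,x^{s-1}\,ds,\qquad 0<c<1,$$ so that $\int_0^\infty x^{s-1}v_k(x)\,dx=2^k\xi(s)^k$. It is known that $v_k(x)>0$ for $x>0$ and $x^{-1}v_k(x)$ is a probability density on $(0,\infty)$; $X_k$ denotes a random variable with this density. *)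

theory Defs
  imports "HOL-Complex_Analysis.Complex_Analysis"
begin

definition zeta_series :: "complex \<Rightarrow> complex" where
  "zeta_series s = (\<Sum>n. 1 / (of_nat (Suc n)) powr s)"

definition riemann_xi :: "complex \<Rightarrow> complex" where
  "riemann_xi = (THE f. f holomorphic_on UNIV \<and>
     (\<forall>s. 1 < Re s \<longrightarrow>
        f s = 1/2 * s * (s - 1) * (of_real pi) powr (- s / 2) * Gamma (s / 2) * zeta_series s))"

text \<open>v_k(x) = (1/(2 pi i)) int_{c - i oo}^{c + i oo} 2^k xi(s)^k x^(s-1) ds with c = 1/2;
  parametrising s = c + i y gives ds = i dy.\<close>
definition v_fun :: "nat \<Rightarrow> real \<Rightarrow> complex" where
  "v_fun k x = complex_of_real (1 / (2 * pi)) *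
     integral\<^sup>L lborel (\<lambda>y::real. 2 ^ k * riemann_xi (Complex (1/2) y) ^ k
                                   * (complex_of_real x) powr (Complex (1/2) y - 1))"

definition F_fun :: "real \<Rightarrow> nat \<Rightarrow> complex \<Rightarrow> complex" where
  "F_fun lam k t = (LINT x:{0<..}|lborel.
      exp (complex_of_real (lam * (ln x)^2) + \<i> * t * complex_of_real (ln x))
      * complex_of_real (sqrt x) * v_fun k x / complex_of_real x)"

end

theory Submission
  imports
    Defs
    "HOL-Probability.Probability"
    "HOL-Real_Asymp.Real_Asymp"
    "HOL-Computational_Algebra.Fundamental_Theorem_Algebra"
begin

text \<open>
  Put \<open>\<theta>(z) = \<Sum>\<^sub>n exp (- \<pi> n\<^sup>2 z)\<close> and \<open>\<omega>(u) = e\<^bsup>u/2\<^esup> \<theta>(e\<^bsup>2u\<^esup>)\<close>. The inversion formula of \<open>\<theta>\<close> says that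
  \<open>\<omega>\<close> is even, and \<open>2 \<xi>(1/2 + i t)\<close> is the Fourier transform \<open>\<Xi>(t)\<close> of the positive, even, doubly
  exponentially decaying kernel \<open>\<omega>'' - \<omega> / 4\<close>. By Fourier inversion \<open>\<surd>x v\<^sub>k(x)\<close>, as a function of \<open>log x\<close>, is
  the \<open>k\<close>-fold convolution power \<open>\<rho>\<close> of this kernel, so \<open>F\<^bsub>\<lambda>,k\<^esub>\<close> is the Fourier transform of
  \<open>e\<^bsup>\<lambda>u\<^sup>2\<^esup> \<rho>(u)\<close> and \<open>F\<^bsub>0,k\<^esub> = \<Xi>\<^sup>k\<close>.

  (i) The zeros of \<open>\<Xi>\<close> lie in \<open>|Im t| \<le> 1/2\<close>, since \<open>\<zeta>\<close> has no zeros in \<open>Re s > 1\<close>. As \<open>\<Xi>(t) = G(t\<^sup>2)\<close>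
  with \<open>G\<close> of order less than 1, \<open>\<Xi>\<^sup>k\<close> is a locally uniform limit of real polynomials with zeros in
  this strip. Passing from \<open>p(t)\<close> to \<open>(p(t + i \<mu>) + p(t - i \<mu>)) / 2\<close> shrinks a strip of half-width \<open>D\<close> to one
  of half-width \<open>\<surd>(D\<^sup>2 - \<mu>\<^sup>2)\<close>, and on the Fourier side it multiplies by \<open>cosh (\<mu> u)\<close>. Iterating with
  \<open>\<mu> = \<surd>(2\<lambda>/n)\<close> and using \<open>cosh (\<mu> u)\<^sup>n \<rightarrow> e\<^bsup>\<lambda>u\<^sup>2\<^esup>\<close> and Hurwitz's theorem leaves only real zeros as
  soon as \<open>2 \<lambda> \<ge> 1/4\<close> (de Bruijn).

  (ii) The kernel extends to \<open>|Im u| < \<pi>/4\<close>, and \<open>\<integral> \<Xi>(t) e\<^bsup>\<alpha>t\<^esup> dt\<close> is \<open>2\<pi>\<close> times its value at \<open>i \<alpha>\<close>,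
  which is \<open>O(e\<^bsup>-c/\<eta>\<^esup>)\<close> for \<open>\<alpha> = \<pi>/4 - \<eta>\<close>. If \<open>\<Xi>\<close> had constant sign for large \<open>|t|\<close>, then high
  order differences in \<open>\<alpha>\<close> would be bounded below by a power of \<open>\<eta>\<close>, a contradiction (Hardy).
\<close>

section \<open>Fourier inversion\<close>

text \<open>The threshold 1/8 is \<open>(1/2)^2 / 2\<close>, where 1/2 is the half-width of the
  strip of zeros. The strip argument compares finite products over zeros, so the approximating
  polynomials must have no zeros besides those of the function itself; Taylor sections would not do,
  and a factorization of \<open>G\<close> is needed. If zeros are divided out on growing discs, the
  zero-free cofactor could still leave a factor \<open>exp (a * w)\<close> in the limit; order below
  1 excludes it. For this the kernel decay is spent on a cubic
  \<open>exp (\<bar>u\<bar> ^ 3)\<close>, which makes Xi of order at most 3/2 and \<open>G\<close>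
  of order at most 3/4.

  In the argument for infinitely many zeros the obstacle is the middle range, where the sign is
  unknown. One second difference with step \<open>h\<close> in the exponent multiplies the integrand
  by \<open>2 * cosh (h * t) - 2\<close>, which for \<open>t\<close> beyond \<open>2 * T\<close> is
  at least four times its value on \<open>[-T, T]\<close>. So a fixed number of differences,
  independent of the distance to the cusp, lets the part of known sign dominate, and the price is
  only a fixed power of that distance.\<close>

definition fourier_laplace :: "(real \<Rightarrow> complex) \<Rightarrow> complex \<Rightarrow> complex" where
  "fourier_laplace g z = (LINT u|lborel. g u * exp (\<i> * z * complex_of_real u))"

lemma norm_exp_i_le: "norm (exp (\<i> * z * complex_of_real u)) \<le> exp (norm z * \<bar>u\<bar>)"
proof -
  have "- (Im z * u) \<le> norm z * \<bar>u\<bar>"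
    by (metis abs_Im_le_cmod abs_ge_minus_self abs_ge_zero abs_mult mult_right_mono order_trans)
  then show ?thesis by simp
qed

text \<open>The exponential is expanded and integrated term by term. All partial sums of the norms
  are dominated by the single integrable function
  \<open>norm (g u) * exp (norm z * \<bar>u\<bar>)\<close>, so the transform is an everywhere
  convergent power series.\<close>

lemma fourier_laplace_entire:
  fixes g :: "real \<Rightarrow> complex"
  assumes [measurable]: "g \<in> borel_measurable borel"
    and int: "\<And>M. integrable lborel (\<lambda>u. norm (g u) * exp (M * \<bar>u\<bar>))"
  shows "fourier_laplace g holomorphic_on UNIV"
proof -
  define a where "a n = (LINT u|lborel. g u * (\<i> * complex_of_real u) ^ n / fact n)" for n
  have key: "(\<lambda>n. a n * z ^ n) sums fourier_laplace g z" for z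
  proof -
    define h where "h n u = g u * (\<i> * z * complex_of_real u) ^ n / fact n" for n u
    have [measurable]: "h n \<in> borel_measurable lborel" for n unfolding h_def by measurable
    have sm: "(\<lambda>n. norm (h n u)) sums (norm (g u) * exp (norm z * \<bar>u\<bar>))" for u
    proof -
      have "(\<lambda>n. norm (g u) * ((norm z * \<bar>u\<bar>) ^ n /\<^sub>R fact n)) sums (norm (g u) * exp (norm z * \<bar>u\<bar>))"
        by (intro sums_mult exp_converges)
      then show ?thesis
        by (simp add: h_def norm_mult norm_divide norm_power field_simps)
    qed
    have le: "norm (h n u) \<le> norm (g u) * exp (norm z * \<bar>u\<bar>)" for n u
      using sums_unique[OF sm[of u]] sum_le_suminf[OF sums_summable[OF sm[of u]], of "{n}"] by simp
    have ih: "integrable lborel (h n)" for n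
      by (rule Bochner_Integration.integrable_bound[OF int[of "norm z"]]) (use le in \<open>auto intro!: AE_I2\<close>)
    have sumle: "(\<Sum>i<n. LINT u|lborel. norm (h i u)) \<le> (LINT u|lborel. norm (g u) * exp (norm z * \<bar>u\<bar>))" for n
    proof -
      have "(\<Sum>i<n. LINT u|lborel. norm (h i u)) = (LINT u|lborel. (\<Sum>i<n. norm (h i u)))"
        by (subst Bochner_Integration.integral_sum) (use ih in auto)
      also have "\<dots> \<le> (LINT u|lborel. norm (g u) * exp (norm z * \<bar>u\<bar>))"
      proof (rule integral_mono)
        show "(\<Sum>i<n. norm (h i u)) \<le> norm (g u) * exp (norm z * \<bar>u\<bar>)" for u
          using sums_unique[OF sm[of u]] sum_le_suminf[OF sums_summable[OF sm[of u]], of "{..<n}"] by simp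
      qed (use ih int in auto)
      finally show ?thesis .
    qed
    have "(\<lambda>i. integral\<^sup>L lborel (h i)) sums (\<integral>x. (\<Sum>i. h i x) \<partial>lborel)"
    proof (rule sums_integral[OF ih])
      show "AE x in lborel. summable (\<lambda>i. norm (h i x))" using sm sums_summable by blast
      show "summable (\<lambda>i. LINT u|lborel. norm (h i u))"
        by (rule bounded_imp_summable[OF _ sumle[of "Suc _", unfolded lessThan_Suc_atMost]]) simp
    qed
    moreover have "(\<Sum>i. h i x) = g x * exp (\<i> * z * complex_of_real x)" for x
    proof -
      have "(\<lambda>n. g x * ((\<i> * z * complex_of_real x) ^ n /\<^sub>R fact n)) sums (g x * exp (\<i> * z * complex_of_real x))"
        by (intro sums_mult exp_converges)
      then show ?thesis unfolding h_def by (simp add: scaleR_conv_of_real field_simps sums_iff)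
    qed
    moreover have "integral\<^sup>L lborel (h i) = a i * z ^ i" for i
    proof -
      have "h i = (\<lambda>u. z ^ i * (g u * (\<i> * complex_of_real u) ^ i / fact i))"
        by (auto simp: h_def power_mult_distrib)
      then show ?thesis
        unfolding a_def by (simp add: mult.commute)
    qed
    ultimately show ?thesis by (simp add: fourier_laplace_def)
  qed
  have "fourier_laplace g holomorphic_on ball 0 r" for r
    by (rule power_series_holomorphic[where a=a]) (use key in auto)
  then have "fourier_laplace g analytic_on {z}" for z
    by (metis analytic_at_ball centre_in_ball dist_norm analytic_at open_ball UNIV_I gt_ex mem_ball_0)
  then show ?thesis
    by (meson UNIV_I analytic_at holomorphic_on_open[OF open_UNIV] analytic_imp_holomorphic analytic_on_analytic_at)
qed

lemma integrable_exp_minus_half_square: "integrable lborel (\<lambda>t::real. exp (- t\<^sup>2 / 2))"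
proof -
  have "integrable lborel (\<lambda>t::real. sqrt (2 * pi) * normal_density 0 1 t)"
    by (intro integrable_mult_right integrable_normal_density) simp
  then show ?thesis by (simp add: normal_density_def)
qed

text \<open>A rescaling of the characteristic function of the standard normal distribution.\<close>

lemma gaussian_fourier:
  fixes x c :: real
  assumes c: "c > 0"
  shows "integrable lborel (\<lambda>t. complex_of_real (exp (- (c * t)\<^sup>2 / 2)) * exp (\<i> * complex_of_real (t * x)))" (is "integrable _ ?f")
    and "(LINT t|lborel. complex_of_real (exp (- (c * t)\<^sup>2 / 2)) * exp (\<i> * complex_of_real (t * x)))
      = complex_of_real (sqrt (2 * pi) / c * exp (- (x / c)\<^sup>2 / 2))"
proof -
  have i1: "integrable lborel (\<lambda>t::real. exp (- t\<^sup>2 / 2))"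
    by (rule integrable_exp_minus_half_square)
  let ?g = "\<lambda>t. complex_of_real (exp (- t\<^sup>2 / 2)) * exp (\<i> * complex_of_real (t * (x / c)))"
  have ig: "integrable lborel ?g"
    by (rule Bochner_Integration.integrable_bound[OF i1]) (auto simp: norm_mult)
  have "(LINT t|lborel. ?g t) = sqrt (2 * pi) * char std_normal_distribution (x / c)"
    unfolding char_def
    by (subst integral_density)
       (auto simp: std_normal_density_def field_simps scaleR_conv_of_real integral_mult_right_zero[symmetric] simp del: integral_mult_right_zero integral_divide_zero intro!: Bochner_Integration.integral_cong)
  then have eq: "(LINT t|lborel. ?g t) = sqrt (2 * pi) * exp (- (x / c)\<^sup>2 / 2)"
    by (simp add: char_std_normal_distribution)
  have f: "?f = (\<lambda>t. ?g (0 + c * t))" using c by (auto simp: fun_eq_iff)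
  show "integrable lborel ?f"
    unfolding f using c ig by (intro lborel_integrable_real_affine) auto
  show "(LINT t|lborel. ?f t) = complex_of_real (sqrt (2 * pi) / c * exp (- (x / c)\<^sup>2 / 2))"
    using lborel_integral_real_affine[of c ?g 0] c eq unfolding f
    by (simp add: scaleR_conv_of_real field_simps)
qed

text \<open>Gaussian regularization: with an extra factor \<open>exp (- (?e n * t)^2 / 2)\<close>
  Fubini applies, and the inner integral turns the left side into a multiple of the average of
  \<open>g\<close> against a normal density of width \<open>?e n\<close> around \<open>u\<close>.
  Both sides then pass to the limit by dominated convergence.\<close>

theorem fourier_inversion:
  fixes g :: "real \<Rightarrow> complex"
  assumes cont: "continuous_on UNIV g" and bdd: "\<And>u. norm (g u) \<le> B"
    and int: "integrable lborel g"
    and inth: "integrable lborel (\<lambda>t. fourier_laplace g (complex_of_real t))"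
  shows "(LINT t|lborel. fourier_laplace g (complex_of_real t) * exp (- \<i> * complex_of_real (t * u))) = 2 * pi * g u"
proof -
  have [measurable]: "g \<in> borel_measurable borel" using cont by (rule borel_measurable_continuous_onI)
  have [measurable]: "(\<lambda>t. fourier_laplace g (complex_of_real t)) \<in> borel_measurable borel"
    using inth by measurable
  let ?h = "\<lambda>t. fourier_laplace g (complex_of_real t)"
  let ?e = "\<lambda>n. 1 / real (Suc n)"
  let ?L = "\<lambda>n. LINT t|lborel. ?h t * exp (- \<i> * complex_of_real (t * u)) * complex_of_real (exp (- (?e n * t)\<^sup>2 / 2))"
  let ?R = "\<lambda>n. LINT w|lborel. complex_of_real (sqrt (2*pi) * exp (- w\<^sup>2 / 2)) * g (u + ?e n * w)"
  have LR: "?L n = ?R n" for n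
  proof -
    define c where "c = ?e n"
    have c: "c > 0" by (simp add: c_def)
    let ?k = "\<lambda>t v. g v * (complex_of_real (exp (- (c * t)\<^sup>2 / 2)) * exp (\<i> * complex_of_real (t * (v - u))))"
    have ip: "integrable (lborel \<Otimes>\<^sub>M lborel) (case_prod ?k)"
    proof (rule lborel_pair.Fubini_integrable)
      have "integrable lborel (\<lambda>t. exp (- (c * t)\<^sup>2 / 2))"
        using integrable_norm[OF gaussian_fourier(1)[OF c, of 0]] by (simp add: norm_mult)
      then show "integrable lborel (\<lambda>x. LINT y|lborel. norm (case (x, y) of (x, y) \<Rightarrow> ?k x y))"
        by (simp add: norm_mult)
      have "integrable lborel (\<lambda>v. exp (- (c * t)\<^sup>2 / 2) * norm (g v))" for t
        using int by auto
      then have "integrable lborel (\<lambda>v. ?k t v)" for t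
        by (rule Bochner_Integration.integrable_bound[where f="\<lambda>v. exp (- (c * t)\<^sup>2 / 2) * norm (g v)"])
           (auto simp: norm_mult mult.commute)
      then show "AE x in lborel. integrable lborel (\<lambda>y. case (x, y) of (x, y) \<Rightarrow> ?k x y)"
        by auto
    qed measurable
    have "?L n = (LINT t|lborel. (LINT v|lborel. ?k t v))"
    proof (intro Bochner_Integration.integral_cong refl)
      fix t
      have "?k t = (\<lambda>v. (exp (- \<i> * complex_of_real (t * u)) * complex_of_real (exp (- (c * t)\<^sup>2 / 2))) * (g v * exp (\<i> * complex_of_real t * complex_of_real v)))"
        by (auto simp: fun_eq_iff algebra_simps exp_add[symmetric] exp_diff exp_minus field_simps)
      then have "(LINT v|lborel. ?k t v) = (exp (- \<i> * complex_of_real (t * u)) * complex_of_real (exp (- (c * t)\<^sup>2 / 2))) * ?h t"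
        unfolding fourier_laplace_def by (simp only: integral_mult_right_zero)
      then show "?h t * exp (- \<i> * complex_of_real (t * u)) * complex_of_real (exp (- (?e n * t)\<^sup>2 / 2)) = (LINT v|lborel. ?k t v)"
        by (simp add: c_def)
    qed
    also have "\<dots> = (LINT v|lborel. (LINT t|lborel. ?k t v))"
      using lborel_pair.Fubini_integral[OF ip] by simp
    also have "\<dots> = (LINT v|lborel. g v * complex_of_real (sqrt (2 * pi) / c * exp (- ((v-u) / c)\<^sup>2 / 2)))"
      by (simp only: integral_mult_right_zero gaussian_fourier(2)[OF c])
    also have "\<dots> = (LINT w|lborel. \<bar>c\<bar> *\<^sub>R (g (u + c * w) * complex_of_real (sqrt (2 * pi) / c * exp (- ((u + c * w - u) / c)\<^sup>2 / 2))))"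
      using c by (subst lborel_integral_real_affine[of c _ u]) auto
    also have "\<dots> = ?R n"
      unfolding c_def[symmetric] using c
      by (intro Bochner_Integration.integral_cong refl) (simp add: scaleR_conv_of_real)
    finally show ?thesis .
  qed
  have e0: "?e \<longlonglongrightarrow> 0" by real_asymp
  \<comment> \<open>The limits are written with \<open>0\<close> in place of \<open>?e n\<close>, so
    that pointwise convergence follows from continuity in this parameter alone.\<close>
  have "?L \<longlonglongrightarrow> (LINT t|lborel. ?h t * exp (- \<i> * complex_of_real (t * u)) * complex_of_real (exp (- (0 * t)\<^sup>2 / 2)))"
  proof (rule integral_dominated_convergence[where w="\<lambda>t. norm (?h t)"])
    show "AE x in lborel. (\<lambda>i. ?h x * exp (- \<i> * complex_of_real (x * u)) * complex_of_real (exp (- (?e i * x)\<^sup>2 / 2)))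
      \<longlonglongrightarrow> ?h x * exp (- \<i> * complex_of_real (x * u)) * complex_of_real (exp (- (0 * x)\<^sup>2 / 2))"
      by (intro AE_I2 tendsto_intros e0) auto
  qed (use inth in \<open>auto simp: norm_mult intro!: mult_left_le\<close>)
  moreover have "?R \<longlonglongrightarrow> (LINT w|lborel. complex_of_real (sqrt (2*pi) * exp (- w\<^sup>2 / 2)) * g (u + 0 * w))"
  proof (rule integral_dominated_convergence[where w="\<lambda>w. sqrt (2*pi) * exp (- w\<^sup>2 / 2) * B"])
    have "isCont g x" for x using cont by (simp add: continuous_on_eq_continuous_at)
    then show "AE x in lborel. (\<lambda>i. complex_of_real (sqrt (2*pi) * exp (- x\<^sup>2 / 2)) * g (u + ?e i * x))
      \<longlonglongrightarrow> complex_of_real (sqrt (2*pi) * exp (- x\<^sup>2 / 2)) * g (u + 0 * x)"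
      by (intro AE_I2 tendsto_intros isCont_tendsto_compose[of _ g] e0)
    have "integrable lborel (\<lambda>t::real. exp (- t\<^sup>2 / 2))"
      by (rule integrable_exp_minus_half_square)
    then show "integrable lborel (\<lambda>w. sqrt (2*pi) * exp (- w\<^sup>2 / 2) * B)" by auto
    show "AE x in lborel. norm (complex_of_real (sqrt (2*pi) * exp (- x\<^sup>2 / 2)) * g (u + ?e i * x)) \<le> sqrt (2*pi) * exp (- x\<^sup>2 / 2) * B" for i
      using bdd by (intro AE_I2) (simp add: norm_mult)
  qed auto
  moreover have "(LINT w|lborel. complex_of_real (sqrt (2*pi) * exp (- w\<^sup>2 / 2)) * g (u + 0 * w)) = 2 * pi * g u"
  proof -
    have "(LINT w|lborel. complex_of_real (exp (- w\<^sup>2 / 2))) = sqrt (2 * pi)"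
      using gaussian_fourier(2)[of 1 0] by simp
    moreover have "complex_of_real (sqrt (2 * pi)) * complex_of_real (sqrt (2 * pi)) = 2 * pi"
      by (metis of_real_mult real_sqrt_mult_self abs_of_nonneg pi_ge_zero mult_nonneg_nonneg zero_le_numeral)
    ultimately show ?thesis by simp
  qed
  ultimately show ?thesis
    unfolding LR by (auto dest: LIMSEQ_unique)
qed

section \<open>Inversion of the theta function\<close>

text \<open>The powers of \<open>1 + cos (2 pi y)\<close> are trigonometric polynomials that concentrate at 0.\<close>

lemma cos_moments_zero_imp_nonpos:
  fixes D :: "real \<Rightarrow> real"
  assumes cont: "continuous_on {-1/2..1/2} D"
    and mom: "\<And>m::int. integral {-1/2..1/2} (\<lambda>y. D y * cos (2 * pi * m * y)) = 0"
  shows "D 0 \<le> 0"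
proof (rule ccontr)
  assume "\<not> D 0 \<le> 0"
  then have d: "D 0 > 0" by simp
  obtain e where e: "e > 0" "\<And>y. y \<in> {-1/2..1/2} \<Longrightarrow> dist y 0 < e \<Longrightarrow> dist (D y) (D 0) < D 0 / 2"
    using cont[unfolded continuous_on_iff, rule_format, of 0 "D 0 / 2"] d by auto
  define \<delta> where "\<delta> = min (e/2) (1/4)"
  have \<delta>: "0 < \<delta>" "\<delta> \<le> 1/4" "\<delta> < e" using e(1) by (auto simp: \<delta>_def)
  have Dpos: "D y \<ge> D 0 / 2" if "\<bar>y\<bar> \<le> \<delta>" for y
    using e(2)[of y] that \<delta> by (auto simp: dist_real_def abs_if split: if_splits)
  \<comment> \<open>Normalized so that \<open>t\<close> equals 1 at distance \<open>\<delta>\<close>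
    from 0: powers of \<open>t\<close> stay at most 1 outside and are at least \<open>q ^ N\<close>
    with \<open>q > 1\<close> on the inner half, where \<open>D\<close> is bounded below.\<close>
  define c where "c = 1 + cos (2 * pi * \<delta>)"
  have \<delta>pi: "0 < 2 * pi * \<delta>" "2 * pi * \<delta> \<le> pi / 2"
    using \<delta> mult_left_mono[of \<delta> "1/4" "2*pi"] by auto
  then have "cos (2 * pi * \<delta>) \<ge> 0"
    using pi_gt_zero by (intro cos_ge_zero) linarith+
  then have c: "c \<ge> 1" by (simp add: c_def)
  define t where "t y = (1 + cos (2 * pi * y)) / c" for y
  have t0: "t y \<ge> 0" for y
  proof -
    have "0 \<le> 1 + cos (2 * pi * y)" using cos_ge_minus_one[of "2*pi*y"] by linarith
    then show ?thesis using c by (simp add: t_def)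
  qed
  define q where "q = t (\<delta>/2)"
  have cm: "cos (2 * pi * y) \<le> cos (2 * pi * z)" if "\<bar>z\<bar> \<le> \<bar>y\<bar>" "\<bar>y\<bar> \<le> 1/2" for y z :: real
  proof -
    have "cos (2 * pi * \<bar>y\<bar>) \<le> cos (2 * pi * \<bar>z\<bar>)"
      using that mult_left_mono[of "\<bar>y\<bar>" "1/2" "2*pi"] by (intro cos_monotone_0_pi_le mult_left_mono) auto
    moreover have "cos (2 * pi * \<bar>y\<bar>) = cos (2 * pi * y)" for y by (cases "y \<ge> 0") auto
    ultimately show ?thesis by simp
  qed
  have "cos (2 * pi * \<delta>) < cos (2 * pi * (\<delta>/2))"
    using \<delta>pi \<delta>(1) pi_gt_zero by (intro cos_monotone_0_pi) simp_all
  then have q1: "q > 1" using c by (simp add: q_def t_def c_def)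
  have tq: "t y \<ge> q" if "\<bar>y\<bar> \<le> \<delta>/2" for y
    unfolding q_def t_def using c cm[of y "\<delta>/2"] that \<delta> by (auto intro!: divide_right_mono)
  have t1: "t y \<le> 1" if "\<bar>y\<bar> > \<delta>" "\<bar>y\<bar> \<le> 1/2" for y
    unfolding t_def using c cm[of \<delta> y] that \<delta> by (auto simp: c_def)
  have tc: "continuous_on A t" for A unfolding t_def using c by (intro continuous_intros) auto
  have int: "(\<lambda>y. D y * t y ^ N * cos (a * y)) integrable_on {-1/2..1/2}" for N a
    by (intro integrable_continuous_real continuous_intros cont tc)
  \<comment> \<open>Multiplying by \<open>t\<close> keeps all moments zero, since the product of two
    cosines is half the sum of the cosines with frequencies \<open>m + 1\<close> and
    \<open>m - 1\<close>.\<close>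
  have mom': "integral {-1/2..1/2} (\<lambda>y. D y * t y ^ N * cos (2 * pi * m * y)) = 0" for N and m :: int
  proof (induction N arbitrary: m)
    case 0 then show ?case using mom by simp
  next
    case (Suc N)
    have eq: "D y * t y ^ Suc N * cos (2 * pi * m * y) =
       (1/c) * (D y * t y ^ N * cos (2 * pi * m * y)) + ((1/(2*c)) * (D y * t y ^ N * cos (2 * pi * (m+1) * y))
        + (1/(2*c)) * (D y * t y ^ N * cos (2 * pi * (m-1) * y)))" for y
    proof -
      have "cos (2 * pi * y) * cos (2 * pi * m * y) = (cos (2 * pi * (m+1) * y) + cos (2 * pi * (m-1) * y)) / 2"
        by (simp add: cos_add cos_diff algebra_simps)
      then have "t y * cos (2 * pi * m * y) = (1/c) * (cos (2 * pi * m * y) + (cos (2 * pi * (m+1) * y) + cos (2 * pi * (m-1) * y)) / 2)"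
        using c unfolding t_def by (simp add: field_simps)
      moreover have "D y * t y ^ Suc N * cos (2 * pi * m * y) = D y * t y ^ N * (t y * cos (2 * pi * m * y))" by simp
      ultimately show ?thesis by (simp add: algebra_simps)
    qed
    have I: "((\<lambda>y. D y * t y ^ N * cos (2 * pi * j * y)) has_integral 0) {-1/2..1/2}" for j :: int
      unfolding has_integral_iff using int Suc.IH by blast
    have "((\<lambda>y. (1/c) * (D y * t y ^ N * cos (2 * pi * m * y)) + ((1/(2*c)) * (D y * t y ^ N * cos (2 * pi * (m+1) * y))
        + (1/(2*c)) * (D y * t y ^ N * cos (2 * pi * (m-1) * y)))) has_integral (1/c) * 0 + ((1/(2*c))*0 + (1/(2*c))*0)) {-1/2..1/2}"
      by (intro has_integral_add has_integral_mult_right I)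
    from integral_unique[OF this] show ?case unfolding eq by simp
  qed
  obtain S where S: "\<And>y. y \<in> {-1/2..1/2} \<Longrightarrow> \<bar>D y\<bar> \<le> S"
    using compact_imp_bounded[OF compact_continuous_image[OF cont]] unfolding bounded_iff real_norm_def by blast
  have S0: "S \<ge> 0" using S[of 0] by auto
  have lower: "D y * t y ^ N \<ge> - S" if "y \<in> {-1/2..1/2}" for y N
  proof (cases "\<bar>y\<bar> \<le> \<delta>")
    case True
    then have "D y * t y ^ N \<ge> 0" using Dpos[OF True] d t0 by (intro mult_nonneg_nonneg) auto
    then show ?thesis using S0 by simp
  next
    case False
    then have "t y ^ N \<le> 1" using t1[of y] that t0 by (intro power_le_one) auto
    then have "\<bar>D y * t y ^ N\<bar> \<le> S * 1"
      unfolding abs_mult using S[OF that] S0 t0[of y] by (intro mult_mono) auto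
    then show ?thesis by simp
  qed
  \<comment> \<open>The vanishing integral splits into the core, which contributes at least
    \<open>\<delta> * (D 0 / 2) * q ^ N\<close>, and the rest, which is at least
    \<open>- S\<close>.\<close>
  have bound: "\<delta> * (D 0 / 2) * q ^ N \<le> S" for N
  proof -
    let ?f = "\<lambda>y. D y * t y ^ N"
    have int': "?f integrable_on {a..b}" if "{a..b} \<subseteq> {-1/2..1/2}" for a b
      by (intro integrable_continuous_real continuous_intros continuous_on_subset[OF cont that] tc)
    have "integral {-1/2..1/2} ?f = 0" using mom'[of N 0] by simp
    moreover have "integral {-1/2..1/2} ?f = integral {-1/2..-\<delta>/2} ?f + integral {-\<delta>/2..\<delta>/2} ?f + integral {\<delta>/2..1/2} ?f"
    proof -
      have "integral {-1/2..1/2} ?f = integral {-1/2..-\<delta>/2} ?f + integral {-\<delta>/2..1/2} ?f"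
        by (rule Henstock_Kurzweil_Integration.integral_combine[symmetric]) (use \<delta> int' in auto)
      also have "integral {-\<delta>/2..1/2} ?f = integral {-\<delta>/2..\<delta>/2} ?f + integral {\<delta>/2..1/2} ?f"
        by (rule Henstock_Kurzweil_Integration.integral_combine[symmetric]) (use \<delta> int' in auto)
      finally show ?thesis by simp
    qed
    moreover have "integral {-1/2..-\<delta>/2} (\<lambda>_. - S) \<le> integral {-1/2..-\<delta>/2} ?f"
      by (intro integral_le int') (use lower \<delta> in auto)
    moreover have "integral {\<delta>/2..1/2} (\<lambda>_. - S) \<le> integral {\<delta>/2..1/2} ?f"
      by (intro integral_le int') (use lower \<delta> in auto)
    moreover have "integral {-\<delta>/2..\<delta>/2} (\<lambda>_. D 0 / 2 * q ^ N) \<le> integral {-\<delta>/2..\<delta>/2} ?f"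
    proof (intro integral_le int' )
      fix y assume "y \<in> {-\<delta>/2..\<delta>/2}"
      then have y: "\<bar>y\<bar> \<le> \<delta>/2" "\<bar>y\<bar> \<le> \<delta>" using \<delta> by auto
      show "D 0 / 2 * q ^ N \<le> D y * t y ^ N"
        using Dpos[OF y(2)] tq[OF y(1)] q1 d by (intro mult_mono power_mono) auto
    qed (use \<delta> in auto)
    moreover have "(1/2 - \<delta>/2) * S \<le> 1/2 * S" using \<delta> S0 by (intro mult_right_mono) auto
    ultimately show ?thesis using \<delta> by (simp add: algebra_simps)
  qed
  obtain N where "S / (\<delta> * (D 0 / 2)) < q ^ N" using real_arch_pow[OF q1] by blast
  then have "\<delta> * (D 0 / 2) * q ^ N > S" using \<delta> d by (simp add: field_simps)
  then show False using bound[of N] by linarith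
qed

lemma cos_moments_zero_imp_zero:
  fixes D :: "real \<Rightarrow> real"
  assumes cont: "continuous_on {-1/2..1/2} D"
    and mom: "\<And>m::int. integral {-1/2..1/2} (\<lambda>y. D y * cos (2 * pi * m * y)) = 0"
  shows "D 0 = 0"
proof -
  have "- D 0 \<le> 0"
    by (rule cos_moments_zero_imp_nonpos[of "\<lambda>y. - D y"]) (use continuous_on_minus[OF cont] mom in simp_all)
  then show ?thesis using cos_moments_zero_imp_nonpos[OF cont mom] by simp
qed

lemma integral_suminf_mult:
  fixes f :: "nat \<Rightarrow> real \<Rightarrow> real"
  assumes cont: "\<And>n. continuous_on {a..b} (f n)"
    and le: "\<And>n y. y \<in> {a..b} \<Longrightarrow> \<bar>f n y\<bar> \<le> M n" and M: "summable M"
    and h: "continuous_on {a..b} h"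
  shows "continuous_on {a..b} (\<lambda>y. \<Sum>n. f n y)"
    and "(\<lambda>n. integral {a..b} (\<lambda>y. f n y * h y)) sums integral {a..b} (\<lambda>y. (\<Sum>n. f n y) * h y)"
proof -
  have ul: "uniform_limit {a..b} (\<lambda>n y. \<Sum>i<n. f i y) (\<lambda>y. \<Sum>n. f n y) sequentially"
    by (rule Weierstrass_m_test[OF _ M]) (use le in auto)
  show 1: "continuous_on {a..b} (\<lambda>y. \<Sum>n. f n y)"
    by (rule uniform_limit_theorem[OF _ ul]) (auto intro!: continuous_intros cont always_eventually)
  have "bounded (h ` {a..b})" "bounded ((\<lambda>y. \<Sum>n. f n y) ` {a..b})"
    using h 1 by (auto intro!: compact_imp_bounded compact_continuous_image)
  then have ul2: "uniform_limit {a..b} (\<lambda>n y. (\<Sum>i<n. f i y) * h y) (\<lambda>y. (\<Sum>n. f n y) * h y) sequentially"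
    by (intro uniform_lim_mult ul uniform_limit_const) auto
  obtain I J where IJ: "\<And>n. ((\<lambda>y. (\<Sum>i<n. f i y) * h y) has_integral I n) {a..b}"
     "((\<lambda>y. (\<Sum>n. f n y) * h y) has_integral J) {a..b}" "I \<longlonglongrightarrow> J"
    by (rule uniform_limit_integral[OF ul2]) (auto intro!: continuous_intros cont h)
  have int: "(\<lambda>y. f n y * h y) integrable_on {a..b}" for n
    by (intro integrable_continuous_real continuous_intros cont h)
  have Ieq: "I n = (\<Sum>i<n. integral {a..b} (\<lambda>y. f i y * h y))" for n
  proof -
    have "((\<lambda>y. \<Sum>i<n. f i y * h y) has_integral (\<Sum>i<n. integral {a..b} (\<lambda>y. f i y * h y))) {a..b}"
      by (intro has_integral_sum) (use int in \<open>auto simp: has_integral_integral\<close>)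
    then show ?thesis using IJ(1)[of n] by (simp add: sum_distrib_right has_integral_unique)
  qed
  then show "(\<lambda>n. integral {a..b} (\<lambda>y. f n y * h y)) sums integral {a..b} (\<lambda>y. (\<Sum>n. f n y) * h y)"
    using IJ(3) integral_unique[OF IJ(2)] unfolding sums_def Ieq[abs_def] by simp
qed

text \<open>Half-integer endpoints match the tiling of the line by unit intervals centred at
  integers, which the periodization argument produces.\<close>

lemma integral_symmetric_interval_tendsto:
  fixes g :: "real \<Rightarrow> 'a :: euclidean_space"
  assumes "integrable lborel g"
  shows "(\<lambda>N. integral {-(real N + 1/2)..real N + 1/2} g) \<longlonglongrightarrow> integral\<^sup>L lborel g"
proof -
  have [measurable]: "g \<in> borel_measurable borel" using assms by auto
  have "(\<lambda>N. LINT y|lborel. indicator {-(real N + 1/2)..real N + 1/2} y *\<^sub>R g y) \<longlonglongrightarrow> integral\<^sup>L lborel g"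
  proof (rule integral_dominated_convergence[where w="\<lambda>y. norm (g y)"])
    show "AE y in lborel. (\<lambda>N. indicator {-(real N + 1/2)..real N + 1/2} y *\<^sub>R g y) \<longlonglongrightarrow> g y"
    proof (intro AE_I2 tendsto_eventually)
      fix y
      have "eventually (\<lambda>N. real N \<ge> \<bar>y\<bar>) sequentially" by real_asymp
      then show "\<forall>\<^sub>F N in sequentially. indicator {-(real N + 1/2)..real N + 1/2} y *\<^sub>R g y = g y"
        by eventually_elim (auto simp: indicator_def)
    qed
  qed (use assms in \<open>auto simp: indicator_def\<close>)
  moreover have "(LINT y|lborel. indicator {a..b} y *\<^sub>R g y) = integral {a..b} g" for a b
  proof -
    have "set_integrable lborel {a..b} g"
      using assms unfolding set_integrable_def by (intro integrable_mult_indicator) auto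
    then show ?thesis using set_borel_integral_eq_integral(2) by (fastforce simp: set_lebesgue_integral_def)
  qed
  ultimately show ?thesis by simp
qed

text \<open>The theta series over all integers, with the terms of \<open>n\<close> and
  \<open>- n\<close> combined.\<close>

definition jacobi_theta :: "complex \<Rightarrow> complex" where
  "jacobi_theta z = 1 + 2 * (\<Sum>n. exp (- of_real pi * of_nat (Suc n) ^ 2 * z))"

lemma norm_theta_term_le:
  assumes "0 \<le> Re z"
  shows "norm (exp (- of_real pi * of_nat (Suc n) ^ 2 * z)) \<le> exp (- pi * Re z) ^ Suc n"
proof -
  have "pi * real (Suc n) * Re z \<le> pi * real (Suc n) ^ 2 * Re z"
    using assms by (intro mult_right_mono mult_left_mono self_le_power) auto
  moreover have "Re (- of_real pi * of_nat (Suc n) ^ 2 * z) = - (pi * real (Suc n) ^ 2 * Re z)"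
    by (simp flip: of_nat_Suc of_nat_power)
  ultimately show ?thesis
    unfolding exp_of_nat_mult[symmetric] norm_exp_eq_Re by (simp add: mult_ac)
qed

lemma summable_theta:
  assumes "0 < Re z"
  shows "summable (\<lambda>n. norm (exp (- of_real pi * of_nat (Suc n) ^ 2 * z)))"
proof (rule summable_comparison_test')
  show "summable (\<lambda>n. exp (- pi * Re z) ^ Suc n)"
    using assms by (subst summable_Suc_iff) (auto intro!: summable_geometric)
  show "norm (norm (exp (- of_real pi * of_nat (Suc n) ^ 2 * z))) \<le> exp (- pi * Re z) ^ Suc n" if "n \<ge> 0" for n
    using norm_theta_term_le[of z n] assms by simp
qed

lemma cos_integral_half:
  fixes m n :: int
  shows "integral {-1/2..1/2} (\<lambda>y. cos (2 * pi * m * y)) = (if m = 0 then 1 else 0)"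
proof (cases "m = 0")
  case False
  have "((\<lambda>y. cos (2 * pi * m * y)) has_integral (sin (2 * pi * m * (1/2)) / (2*pi*m) - sin (2 * pi * m * (-1/2)) / (2*pi*m))) {-1/2..1/2}"
    by (rule fundamental_theorem_of_calculus)
       (use False in \<open>auto intro!: derivative_eq_intros simp flip: has_real_derivative_iff_has_vector_derivative\<close>)
  moreover have "sin (pi * of_int m) = 0" using sin_integer_2pi sin_int_times_real sin_zero_iff_int2 by (simp add: mult.commute sin_times_pi_eq_0)
  ultimately show ?thesis using False by (simp add: integral_unique)
qed simp

text \<open>Poisson summation at one point: \<open>B\<close> is the periodized Gaussian and
  \<open>C\<close> the cosine series with its expected coefficients. Both are continuous with the
  same cosine moments, so they agree at 0, which is the claimed identity.\<close>

theorem jacobi_theta_inversion_real: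
  fixes x :: real
  assumes x: "x > 0"
  shows "jacobi_theta (complex_of_real (1/x)) = complex_of_real (sqrt x) * jacobi_theta (complex_of_real x)"
proof -
  define g where "g y = exp (- pi * x * y\<^sup>2)" for y
  define b where "b n y = (if n = 0 then g y else g (y + real n) + g (y - real n))" for n :: nat and y
  define c where "c n y = (if n = 0 then 1 else 2 * exp (- pi * real n ^ 2 / x) * cos (2 * pi * real n * y)) / sqrt x" for n :: nat and y
  have contg: "continuous_on A (\<lambda>y. g (y + a))" for A a unfolding g_def by (intro continuous_intros)
  have contg': "continuous_on A g" for A unfolding g_def by (intro continuous_intros)
  have contb: "continuous_on A (b n)" for A n
    unfolding b_def using contg[of A "real n"] contg[of A "-real n"] contg'[of A]
    by (cases "n = 0") (simp_all add: continuous_on_add)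
  have contc: "continuous_on A (c n)" for A n
    unfolding c_def by (cases "n = 0") (auto intro!: continuous_intros simp: divide_inverse)
  \<comment> \<open>If \<open>\<bar>w\<bar> \<ge> n - 1/2\<close> then
    \<open>w^2 \<ge> n - 1\<close>, which turns the Gaussian decay into a geometric majorant; the
    factor \<open>exp (pi * x)\<close> accounts for the \<open>- 1\<close>.\<close>
  have bM: "\<bar>b n y\<bar> \<le> 2 * exp (pi * x) * exp (- pi * x) ^ n" if "y \<in> {-1/2..1/2}" for n y
  proof -
    have e: "exp (pi * x) * exp (- pi * x) ^ n = exp (- (pi * x * (real n - 1)))"
      by (simp flip: exp_of_nat_mult exp_add add: algebra_simps)
    have gle: "g w \<le> exp (- (pi * x * (real n - 1)))" if "\<bar>w\<bar> \<ge> real n - 1/2" for w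
    proof -
      have "real n - 1 \<le> w\<^sup>2"
      proof (cases "n = 0")
        case False
        then have "(real n - 1/2)\<^sup>2 \<le> \<bar>w\<bar>\<^sup>2" using that by (intro power_mono) auto
        moreover have "0 \<le> (real n - 1)\<^sup>2" by simp
        ultimately show ?thesis by (simp add: power2_eq_square algebra_simps)
      qed (simp add: order_trans[of _ 0])
      then have "pi * x * (real n - 1) \<le> pi * x * w\<^sup>2" using x by (intro mult_left_mono) auto
      then show ?thesis by (simp add: g_def)
    qed
    have "g y \<le> exp (- (pi * x * (real n - 1)))" if "n = 0" using gle[of y] that by simp
    moreover have "g (y + real n) \<le> exp (- (pi * x * (real n - 1)))" "g (y - real n) \<le> exp (- (pi * x * (real n - 1)))"
      using that by (auto intro!: gle)
    ultimately have "b n y \<le> 2 * exp (- (pi * x * (real n - 1)))"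
      unfolding b_def by (auto intro: order_trans[OF _ mult_right_mono[of 1 2]])
    moreover have "b n y \<ge> 0" by (auto simp: b_def g_def)
    ultimately show ?thesis using e by simp
  qed
  have cM: "\<bar>c n y\<bar> \<le> (2 / sqrt x) * exp (- pi / x) ^ n" for n y
  proof -
    have "exp (- pi * real n ^ 2 / x) \<le> exp (- pi / x) ^ n"
    proof -
      have "pi * real n \<le> pi * real n ^ 2" by (cases "n = 0") (auto simp: self_le_power)
      then have "pi * real n / x \<le> pi * real n ^ 2 / x" using x by (intro divide_right_mono) auto
      then show ?thesis by (simp flip: exp_of_nat_mult add: mult.commute)
    qed
    moreover have "\<bar>cos (2 * pi * real n * y)\<bar> \<le> 1" by simp
    ultimately have "2 * exp (- pi * real n ^ 2 / x) * \<bar>cos (2 * pi * real n * y)\<bar> \<le> 2 * exp (- pi / x) ^ n * 1"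
      by (intro mult_mono) auto
    then show ?thesis using x by (auto simp: c_def abs_mult field_simps)
  qed
  have sb: "summable (\<lambda>n. 2 * exp (pi * x) * exp (- pi * x) ^ n)"
    using x by (intro summable_mult summable_geometric) auto
  have sc: "summable (\<lambda>n. (2 / sqrt x) * exp (- pi / x) ^ n)"
    using x by (intro summable_mult summable_geometric) auto
  define B where "B y = (\<Sum>n. b n y)" for y
  define C where "C y = (\<Sum>n. c n y)" for y
  have cosc: "continuous_on A (\<lambda>y. cos (2 * pi * m * y))" for A and m :: real by (intro continuous_intros)
  have contB: "continuous_on {-1/2..1/2} B"
    unfolding B_def by (rule integral_suminf_mult(1)[OF contb bM sb cosc])
  have contC: "continuous_on {-1/2..1/2} C"
    unfolding C_def by (rule integral_suminf_mult(1)[OF contc cM sc cosc])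
  have momC: "integral {-1/2..1/2} (\<lambda>y. C y * cos (2 * pi * m * y)) = exp (- pi * m\<^sup>2 / x) / sqrt x" for m :: int
  proof -
    have "(\<lambda>n. integral {-1/2..1/2} (\<lambda>y. c n y * cos (2 * pi * m * y))) sums integral {-1/2..1/2} (\<lambda>y. C y * cos (2 * pi * m * y))"
      unfolding C_def by (rule integral_suminf_mult(2)[OF contc cM sc cosc])
    moreover have "integral {-1/2..1/2} (\<lambda>y. c n y * cos (2 * pi * m * y)) = (if n = nat \<bar>m\<bar> then exp (- pi * m\<^sup>2 / x) / sqrt x else 0)" for n
    proof (cases "n = 0")
      case True
      then show ?thesis using cos_integral_half[of m] by (auto simp: c_def)
    next
      case False
      have "c n y * cos (2 * pi * m * y) = exp (- pi * real n ^ 2 / x) / sqrt x * (cos (2 * pi * of_int (int n + m) * y) + cos (2 * pi * of_int (int n - m) * y))" for y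
        using False by (simp add: c_def cos_add cos_diff algebra_simps)
      then have "integral {-1/2..1/2} (\<lambda>y. c n y * cos (2 * pi * m * y)) = exp (- pi * real n ^ 2 / x) / sqrt x *
          (integral {-1/2..1/2} (\<lambda>y. cos (2 * pi * of_int (int n + m) * y)) + integral {-1/2..1/2} (\<lambda>y. cos (2 * pi * of_int (int n - m) * y)))"
        by (simp add: Henstock_Kurzweil_Integration.integral_add integrable_continuous_real cosc)
      also have "\<dots> = exp (- pi * real n ^ 2 / x) / sqrt x * ((if int n + m = 0 then 1 else 0) + (if int n - m = 0 then 1 else 0))"
        by (simp only: cos_integral_half)
      also have "\<dots> = (if n = nat \<bar>m\<bar> then exp (- pi * m\<^sup>2 / x) / sqrt x else 0)"
      proof (cases "n = nat \<bar>m\<bar>")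
        case True
        then have "real n ^ 2 = of_int m ^ 2" by (metis of_int_abs of_nat_nat abs_ge_zero power2_abs of_int_of_nat_eq)
        then show ?thesis using True False by auto
      qed auto
      finally show ?thesis .
    qed
    moreover have "(\<lambda>n. if n = nat \<bar>m\<bar> then exp (- pi * m\<^sup>2 / x) / sqrt x else 0) sums (exp (- pi * m\<^sup>2 / x) / sqrt x)"
      using sums_single[of "nat \<bar>m\<bar>" "\<lambda>_. exp (- pi * m\<^sup>2 / x) / sqrt x"] by simp
    ultimately show ?thesis by (simp add: sums_unique2)
  qed
  have momB: "integral {-1/2..1/2} (\<lambda>y. B y * cos (2 * pi * m * y)) = exp (- pi * m\<^sup>2 / x) / sqrt x" for m :: int
  proof -
    define k where "k y = g y * cos (2 * pi * m * y)" for y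
    have contk: "continuous_on A k" for A unfolding k_def by (intro continuous_intros contg')
    have ik: "k integrable_on {a..b}" for a b by (intro integrable_continuous_real contk)
    have ig: "(\<lambda>y. g (y + a) * cos (2 * pi * m * y)) integrable_on {-1/2..1/2}" for a
      by (intro integrable_continuous_real continuous_intros contg)
    have cosp: "cos (2 * pi * m * (y + of_int j)) = cos (2 * pi * m * y)" for y and j :: int
    proof -
      have "2 * pi * m * (y + of_int j) = 2 * pi * m * y + 2 * pi * of_int (m * j)" by (simp add: algebra_simps)
      then show ?thesis using cos_int_2pin[of "m*j"] sin_int_2pin[of "m*j"] by (simp add: cos_add mult.commute)
    qed
    have shift: "integral {-1/2..1/2} (\<lambda>y. g (y + of_int j) * cos (2 * pi * m * y)) = integral {of_int j - 1/2..of_int j + 1/2} k" for j :: int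
    proof -
      have "integral {(of_int j - 1/2) - of_int j..(of_int j + 1/2) - of_int j} (\<lambda>y. k (y + of_int j)) = integral {of_int j - 1/2..of_int j + 1/2} k"
        by (rule integral_shift_real_ivl)
      then show ?thesis unfolding k_def cosp by simp
    qed
    \<comment> \<open>Each new term adds one unit interval on either side, since the cosine has
      period 1; the partial sums become integrals over intervals that exhaust the line.\<close>
    have part: "(\<Sum>n<Suc N. integral {-1/2..1/2} (\<lambda>y. b n y * cos (2 * pi * m * y))) = integral {-(real N + 1/2)..real N + 1/2} k" for N
    proof (induction N)
      case 0 show ?case by (simp add: b_def k_def)
    next
      case (Suc N)
      have "integral {-1/2..1/2} (\<lambda>y. b (Suc N) y * cos (2 * pi * m * y)) =
         integral {-1/2..1/2} (\<lambda>y. g (y + of_int (int (Suc N))) * cos (2 * pi * m * y)) + integral {-1/2..1/2} (\<lambda>y. g (y + of_int (- int (Suc N))) * cos (2 * pi * m * y))"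
        by (subst Henstock_Kurzweil_Integration.integral_add[OF ig ig, symmetric])
           (auto intro!: Henstock_Kurzweil_Integration.integral_cong simp: b_def algebra_simps)
      also have "\<dots> = integral {real N + 1/2..real (Suc N) + 1/2} k + integral {-(real (Suc N) + 1/2)..-(real N + 1/2)} k"
        unfolding shift by (intro arg_cong2[where f="(+)"] arg_cong2[where f="\<lambda>a b. integral {a..b} k"]) auto
      finally have 1: "integral {-1/2..1/2} (\<lambda>y. b (Suc N) y * cos (2 * pi * m * y)) = \<dots>" .
      have "integral {-(real (Suc N) + 1/2)..real (Suc N) + 1/2} k = integral {-(real (Suc N) + 1/2)..-(real N + 1/2)} k + integral {-(real N + 1/2)..real (Suc N) + 1/2} k"
        by (rule Henstock_Kurzweil_Integration.integral_combine[symmetric]) (auto intro: ik)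
      also have "integral {-(real N + 1/2)..real (Suc N) + 1/2} k = integral {-(real N + 1/2)..real N + 1/2} k + integral {real N + 1/2..real (Suc N) + 1/2} k"
        by (rule Henstock_Kurzweil_Integration.integral_combine[symmetric]) (auto intro: ik)
      finally show ?case using Suc.IH 1 by simp
    qed
    have "(\<lambda>n. integral {-1/2..1/2} (\<lambda>y. b n y * cos (2 * pi * m * y))) sums integral {-1/2..1/2} (\<lambda>y. B y * cos (2 * pi * m * y))"
      unfolding B_def by (rule integral_suminf_mult(2)[OF contb bM sb cosc])
    then have L: "(\<lambda>N. integral {-(real N + 1/2)..real N + 1/2} k) \<longlonglongrightarrow> integral {-1/2..1/2} (\<lambda>y. B y * cos (2 * pi * m * y))"
      unfolding sums_def part[symmetric] by (rule LIMSEQ_Suc)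
    \<comment> \<open>Chosen so that \<open>exp (- (r * t)^2 / 2)\<close> is the Gaussian
      \<open>g t\<close>.\<close>
    define r where "r = sqrt (2 * pi * x)"
    have r: "r > 0" "r\<^sup>2 = 2 * pi * x" using x by (auto simp: r_def)
    have kRe: "k = (\<lambda>t. Re (complex_of_real (exp (- (r * t)\<^sup>2 / 2)) * exp (\<i> * complex_of_real (t * (2 * pi * m)))))"
      by (auto simp: fun_eq_iff k_def g_def power_mult_distrib r mult_ac Re_exp)
    note gf = gaussian_fourier[OF r(1), of "2 * pi * m"]
    have ik': "integrable lborel k"
      unfolding kRe by (rule integrable_Re[OF gf(1)])
    have "integral\<^sup>L lborel k = sqrt (2 * pi) / r * exp (- ((2 * pi * m) / r)\<^sup>2 / 2)"
      unfolding kRe by (subst integral_Re[OF gf(1)], subst gf(2), rule Re_complex_of_real)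
    also have "sqrt (2 * pi) / r * exp (- ((2 * pi * m) / r)\<^sup>2 / 2) = exp (- pi * m\<^sup>2 / x) / sqrt x"
    proof -
      have "((2 * pi * m) / r)\<^sup>2 / 2 = pi * m\<^sup>2 / x" unfolding power_divide r using x by (simp add: field_simps power2_eq_square)
      moreover have "sqrt (2 * pi) / r = 1 / sqrt x" using x by (simp add: r_def real_sqrt_mult)
      ultimately show ?thesis by (simp add: minus_divide_left[symmetric])
    qed
    finally show ?thesis
      using LIMSEQ_unique[OF L integral_symmetric_interval_tendsto[OF ik']] by (rule trans[rotated])
  qed
  have "B 0 - C 0 = 0"
  proof (rule cos_moments_zero_imp_zero[of "\<lambda>y. B y - C y"])
    show "continuous_on {-1/2..1/2} (\<lambda>y. B y - C y)" by (intro continuous_intros contB contC)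
    fix m :: int
    have "integral {-1/2..1/2} (\<lambda>y. (B y - C y) * cos (2 * pi * m * y)) = integral {-1/2..1/2} (\<lambda>y. B y * cos (2 * pi * m * y)) - integral {-1/2..1/2} (\<lambda>y. C y * cos (2 * pi * m * y))"
      unfolding left_diff_distrib
      by (intro Henstock_Kurzweil_Integration.integral_diff integrable_continuous_real continuous_intros contB contC)
    then show "integral {-1/2..1/2} (\<lambda>y. (B y - C y) * cos (2 * pi * m * y)) = 0" by (simp only: momB momC diff_self)
  qed
  have th: "jacobi_theta (complex_of_real a) = complex_of_real (1 + 2 * (\<Sum>n. exp (- pi * real (Suc n) ^ 2 * a)))" if "a > 0" for a
  proof -
    have "summable (\<lambda>n. norm (exp (- pi * real (Suc n) ^ 2 * a)))"
      using summable_theta[of "complex_of_real a"] that by (simp del: of_nat_Suc flip: of_nat_power)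
    from suminf_of_real[OF summable_norm_cancel[OF this], where 'a=complex] show ?thesis
      unfolding jacobi_theta_def by (simp del: of_nat_Suc flip: exp_of_real)
  qed
  have sB: "summable (\<lambda>n. b n 0)" by (rule summable_comparison_test'[OF sb]) (use bM[of 0] in auto)
  have sC: "summable (\<lambda>n. c n 0)" by (rule summable_comparison_test'[OF sc]) (use cM[of _ 0] in auto)
  have bSuc: "b (Suc n) 0 = 2 * exp (- pi * real (Suc n) ^ 2 * x)" for n
    unfolding b_def g_def power2_eq_square by (simp add: mult_ac del: of_nat_Suc)
  have "B 0 = 1 + 2 * (\<Sum>n. exp (- pi * real (Suc n) ^ 2 * x))"
  proof -
    have "summable (\<lambda>n. b (Suc n) 0)" using sB by (subst summable_Suc_iff)
    then have sB': "summable (\<lambda>n. exp (- pi * real (Suc n) ^ 2 * x))"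
      unfolding bSuc by (subst (asm) summable_cmult_iff) auto
    have "B 0 = b 0 0 + (\<Sum>n. b (Suc n) 0)" unfolding B_def using suminf_split_head[OF sB] by simp
    also have "(\<Sum>n. b (Suc n) 0) = (\<Sum>n. 2 * exp (- pi * real (Suc n) ^ 2 * x))" by (simp only: bSuc)
    also have "\<dots> = 2 * (\<Sum>n. exp (- pi * real (Suc n) ^ 2 * x))"
      by (intro suminf_mult sB')
    finally show ?thesis by (simp add: b_def g_def)
  qed
  moreover have "C 0 = (1 + 2 * (\<Sum>n. exp (- pi * real (Suc n) ^ 2 * (1/x)))) / sqrt x"
  proof -
    have cSuc: "c (Suc n) 0 = (2 / sqrt x) * exp (- pi * real (Suc n) ^ 2 * (1/x))" for n
      by (simp add: c_def del: of_nat_Suc)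
    have "summable (\<lambda>n. c (Suc n) 0)" using sC by (subst summable_Suc_iff)
    then have sC': "summable (\<lambda>n. exp (- pi * real (Suc n) ^ 2 * (1/x)))"
      unfolding cSuc using x by (subst (asm) summable_cmult_iff) auto
    have "C 0 = c 0 0 + (\<Sum>n. c (Suc n) 0)" unfolding C_def using suminf_split_head[OF sC] by simp
    also have "(\<Sum>n. c (Suc n) 0) = (\<Sum>n. (2 / sqrt x) * exp (- pi * real (Suc n) ^ 2 * (1/x)))" by (simp only: cSuc)
    also have "\<dots> = (2 / sqrt x) * (\<Sum>n. exp (- pi * real (Suc n) ^ 2 * (1/x)))"
      by (intro suminf_mult sC')
    finally show ?thesis by (simp add: c_def add_divide_distrib)
  qed
  ultimately have "1 + 2 * (\<Sum>n. exp (- pi * real (Suc n) ^ 2 * (1/x))) = sqrt x * (1 + 2 * (\<Sum>n. exp (- pi * real (Suc n) ^ 2 * x)))"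
    using x \<open>B 0 - C 0 = 0\<close> by (simp add: field_simps)
  then show ?thesis using th[of x] th[of "1/x"] x by (metis of_real_mult zero_less_divide_1_iff)
qed

section \<open>The kernel of the xi function\<close>

text \<open>A single term of the exponential series bounds \<open>(t * c / 2) ^ j / fact j\<close>
  by \<open>exp (t * c / 2)\<close>, so half of the decay absorbs the power.\<close>

lemma power_mult_exp_le:
  fixes t c :: real
  assumes "t \<ge> 0" "c > 0"
  shows "t ^ j * exp (- (t * c)) \<le> fact j * (2 / c) ^ j * exp (- (t * c / 2))"
proof -
  have "(t * c / 2) ^ j / fact j \<le> exp (t * c / 2)"
  proof -
    have s: "(\<lambda>n. (t * c / 2) ^ n /\<^sub>R fact n) sums exp (t * c / 2)" by (rule exp_converges)
    have "(\<Sum>n\<in>{j}. (t * c / 2) ^ n /\<^sub>R fact n) \<le> exp (t * c / 2)"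
      unfolding sums_unique[OF s] using assms by (intro sum_le_suminf sums_summable[OF s]) auto
    then show ?thesis unfolding real_scaleR_def by (simp add: inverse_eq_divide)
  qed
  then have "t ^ j \<le> fact j * (2 / c) ^ j * exp (t * c / 2)"
  proof -
    have "t ^ j = (t * c / 2) ^ j * (2 / c) ^ j" unfolding power_mult_distrib[symmetric] using assms by simp
    also have "\<dots> \<le> (fact j * exp (t * c / 2)) * (2 / c) ^ j"
      using \<open>(t * c / 2) ^ j / fact j \<le> exp (t * c / 2)\<close> assms by (intro mult_right_mono) (auto simp: pos_divide_le_eq mult.commute)
    finally show ?thesis by (simp only: mult_ac)
  qed
  then have "t ^ j * exp (- (t * c)) \<le> fact j * (2 / c) ^ j * exp (t * c / 2) * exp (- (t * c))"
    by (intro mult_right_mono) auto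
  also have "\<dots> = fact j * (2 / c) ^ j * exp (- (t * c / 2))"
    by (simp add: mult.assoc flip: exp_add)
  finally show ?thesis .
qed

section \<open>Termwise differentiation and decay of the theta series\<close>

definition theta_term :: "nat \<Rightarrow> nat \<Rightarrow> complex \<Rightarrow> complex" where
  "theta_term j n z = (- of_real (pi * real (Suc n) ^ 2)) ^ j * exp (- of_real (pi * real (Suc n) ^ 2) * z)"

text \<open>The \<open>j\<close>-th derivative of \<open>(jacobi_theta - 1) / 2\<close>.\<close>

definition theta_deriv :: "nat \<Rightarrow> complex \<Rightarrow> complex" where
  "theta_deriv j z = (\<Sum>n. theta_term j n z)"

lemma norm_theta_term_bound:
  assumes c: "0 < c" "c \<le> Re z"
  shows "norm (theta_term j n z) \<le> fact j * (2 / c) ^ j * exp (- pi * c / 2) ^ Suc n"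
proof -
  define a where "a = pi * real (Suc n) ^ 2"
  have a0: "a \<ge> 0" by (simp add: a_def)
  have "norm (theta_term j n z) = a ^ j * exp (- (a * Re z))"
    unfolding theta_term_def a_def[symmetric] using a0 by (simp add: norm_mult norm_power)
  also have "\<dots> \<le> a ^ j * exp (- (a * c))" using a0 c by (intro mult_left_mono) (auto intro!: mult_left_mono)
  also have "\<dots> \<le> fact j * (2 / c) ^ j * exp (- (a * c / 2))" by (rule power_mult_exp_le[OF a0 c(1)])
  also have "\<dots> \<le> fact j * (2 / c) ^ j * exp (- pi * c / 2) ^ Suc n"
  proof (intro mult_left_mono)
    have "pi * real (Suc n) \<le> a" unfolding a_def by (intro mult_left_mono self_le_power) auto
    then have "pi * real (Suc n) * c \<le> a * c" using c by (intro mult_right_mono) auto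
    then show "exp (- (a * c / 2)) \<le> exp (- pi * c / 2) ^ Suc n"
      unfolding exp_of_nat_mult[symmetric] by (simp add: mult_ac del: of_nat_Suc)
  qed (use c in auto)
  finally show ?thesis .
qed

lemma summable_theta_bound:
  assumes "c > 0"
  shows "summable (\<lambda>n. K * exp (- pi * c / 2) ^ Suc n)"
proof -
  have "summable (\<lambda>n. exp (- pi * c / 2) ^ n)" using assms by (intro summable_geometric) auto
  then have "summable (\<lambda>n. exp (- pi * c / 2) ^ Suc n)" by (subst summable_Suc_iff)
  then show ?thesis by (rule summable_mult)
qed

lemma summable_norm_theta_term:
  assumes "0 < Re z"
  shows "summable (\<lambda>n. norm (theta_term j n z))"
proof (rule summable_comparison_test'[OF summable_theta_bound[OF assms, of "fact j * (2 / Re z) ^ j"]])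
  show "norm (norm (theta_term j n z)) \<le> fact j * (2 / Re z) ^ j * exp (- pi * Re z / 2) ^ Suc n" if "n \<ge> 0" for n
    unfolding real_norm_def abs_norm_cancel by (rule norm_theta_term_bound[OF assms order_refl])
qed

lemma theta_term_sums: "0 < Re z \<Longrightarrow> (\<lambda>n. theta_term j n z) sums theta_deriv j z"
  unfolding theta_deriv_def by (rule summable_sums[OF summable_norm_cancel[OF summable_norm_theta_term]])

text \<open>A geometric majorant. The decaying factors keep the actual \<open>Re z\<close>, while
  \<open>c\<close> serves only to hold the denominator away from 0 uniformly.\<close>

lemma norm_theta_deriv_le:
  assumes c: "0 < c" "c \<le> Re z"
  shows "norm (theta_deriv j z) \<le> fact j * (2 / Re z) ^ j * exp (- pi * Re z / 2) / (1 - exp (- pi * c / 2))"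
proof -
  have z: "Re z > 0" using c by simp
  let ?q = "exp (- pi * Re z / 2)" and ?K = "fact j * (2 / Re z) ^ j"
  have q: "?q < 1" using z by simp
  have "norm (theta_deriv j z) \<le> (\<Sum>n. norm (theta_term j n z))"
    unfolding theta_deriv_def by (rule summable_norm[OF summable_norm_theta_term[OF z]])
  also have "\<dots> \<le> (\<Sum>n. ?K * ?q ^ Suc n)"
    by (rule suminf_le[OF norm_theta_term_bound[OF z order_refl] summable_norm_theta_term[OF z] summable_theta_bound[OF z]])
  also have "\<dots> = ?K * (?q * (\<Sum>n. ?q ^ n))"
  proof -
    have "summable (\<lambda>n. ?q ^ n)" using q by (intro summable_geometric) auto
    then show ?thesis by (simp only: power_Suc suminf_mult summable_mult)
  qed
  also have "\<dots> = ?K * ?q / (1 - ?q)" using q by (simp add: suminf_geometric)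
  also have "\<dots> \<le> ?K * ?q / (1 - exp (- pi * c / 2))"
    using c q by (intro divide_left_mono mult_pos_pos) auto
  finally show ?thesis .
qed

lemma theta_deriv_has_derivative:
  assumes "0 < Re z"
  shows "(theta_deriv j has_field_derivative theta_deriv (Suc j) z) (at z)"
proof -
  let ?S = "{z. 0 < Re z}"
  have S: "open ?S" by (rule open_halfspace_Re_gt)
  have d: "(theta_term j n has_field_derivative theta_term (Suc j) n x) (at x)" for n x
    unfolding theta_term_def[abs_def] by (auto intro!: derivative_eq_intros)
  have "\<exists>d h. 0 < d \<and> summable h \<and> range h \<subseteq> \<real>\<^sub>\<ge>\<^sub>0 \<and> (\<forall>\<^sub>F n in sequentially. \<forall>y\<in>ball x d \<inter> ?S. cmod (theta_term j n y) \<le> cmod (h n))" if "x \<in> ?S" for x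
  proof (intro exI conjI)
    \<comment> \<open>On the ball of this radius around \<open>x\<close> the real part stays at
      least \<open>Re x / 2\<close>, so one majorant serves the whole ball.\<close>
    define c where "c = Re x / 2"
    have c: "c > 0" using that by (simp add: c_def)
    show "0 < c" by (rule c)
    define h where "h n = complex_of_real (fact j * (2 / c) ^ j * exp (- pi * c / 2) ^ Suc n)" for n
    show "summable h" unfolding h_def using summable_theta_bound[OF c] by (subst summable_of_real_iff)
    show "range h \<subseteq> \<real>\<^sub>\<ge>\<^sub>0" using c unfolding h_def by (auto simp: nonneg_Reals_of_real_iff simp del: of_real_mult of_real_power)
    show "\<forall>\<^sub>F n in sequentially. \<forall>y\<in>ball x c \<inter> ?S. cmod (theta_term j n y) \<le> cmod (h n)"
    proof (intro always_eventually allI ballI)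
      fix n y assume "y \<in> ball x c \<inter> ?S"
      then have "\<bar>Re (x - y)\<bar> < c" using abs_Re_le_cmod[of "x - y"] by (auto simp: dist_norm intro: le_less_trans)
      then have "c \<le> Re y" by (simp add: c_def abs_if split: if_splits)
      from norm_theta_term_bound[OF c this, of j n] show "cmod (theta_term j n y) \<le> cmod (h n)"
        unfolding h_def using c by (simp only: norm_of_real)
    qed
  qed
  from series_and_derivative_comparison_complex[OF S d this]
  obtain g g' where g: "\<And>x. x \<in> ?S \<Longrightarrow> (\<lambda>n. theta_term j n x) sums g x \<and> (\<lambda>n. theta_term (Suc j) n x) sums g' x \<and> (g has_field_derivative g' x) (at x)"
    by blast
  have eq: "g x = theta_deriv j x" "g' x = theta_deriv (Suc j) x" if "x \<in> ?S" for x
    using g[OF that] theta_term_sums that by (auto simp: sums_unique2)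
  have "(theta_deriv j has_field_derivative g' z) (at z)"
    by (rule has_field_derivative_transform_within_open[OF _ S, of g]) (use g[of z] eq assms in auto)
  then show ?thesis using eq assms by simp
qed

lemma jacobi_theta_eq: "jacobi_theta z = 1 + 2 * theta_deriv 0 z"
  unfolding jacobi_theta_def theta_deriv_def theta_term_def by simp

lemma jacobi_theta_holomorphic: "jacobi_theta holomorphic_on {z. 0 < Re z}"
proof -
  have "theta_deriv 0 holomorphic_on {z. 0 < Re z}"
    unfolding holomorphic_on_open[OF open_halfspace_Re_gt] using theta_deriv_has_derivative by blast
  then show ?thesis unfolding jacobi_theta_eq[abs_def] by (intro holomorphic_intros)
qed

text \<open>Both sides are holomorphic in the right half-plane and agree on the positive reals,
  which accumulate at 1.\<close>

theorem jacobi_theta_inversion: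
  assumes "0 < Re z"
  shows "jacobi_theta (1 / z) = csqrt z * jacobi_theta z"
proof -
  let ?S = "{z::complex. 0 < Re z}"
  have inv: "1 / z \<in> ?S" if "z \<in> ?S" for z
    using that by (auto simp: Re_divide intro!: divide_pos_pos) (metis less_irrefl sum_power2_gt_zero_iff)
  have h1: "(\<lambda>z. jacobi_theta (1 / z)) holomorphic_on ?S"
  proof (rule holomorphic_on_compose_gen[of "\<lambda>z. 1 / z" ?S jacobi_theta ?S, unfolded o_def])
    show "(\<lambda>z. 1 / z) holomorphic_on ?S" by (intro holomorphic_intros) auto
    show "(\<lambda>z. 1 / z) ` ?S \<subseteq> ?S" using inv by blast
  qed (rule jacobi_theta_holomorphic)
  have h2: "(\<lambda>z. csqrt z * jacobi_theta z) holomorphic_on ?S"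
    by (intro holomorphic_intros jacobi_theta_holomorphic) (auto simp: complex_nonpos_Reals_iff)
  have "jacobi_theta (1 / z) - csqrt z * jacobi_theta z = 0"
  proof (rule analytic_continuation[of "\<lambda>z. jacobi_theta (1 / z) - csqrt z * jacobi_theta z" ?S "of_real ` {0<..}" 1 z])
    show "(\<lambda>z. jacobi_theta (1 / z) - csqrt z * jacobi_theta z) holomorphic_on ?S" by (intro holomorphic_intros h1 h2)
    show "1 islimpt complex_of_real ` {0<..}"
    proof -
      have "\<exists>x'\<in>complex_of_real ` {0<..}. x' \<noteq> 1 \<and> dist x' 1 < e" if e: "e > 0" for e
      proof (intro bexI[of _ "complex_of_real (1 + e/2)"] conjI)
        have "complex_of_real (1 + e/2) - 1 = complex_of_real (e/2)" by simp
        then show "dist (complex_of_real (1 + e/2)) 1 < e" using e by (simp add: dist_norm)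
        show "complex_of_real (1 + e/2) \<noteq> 1" using e by (metis of_real_eq_1_iff add_cancel_left_right half_gt_zero less_irrefl)
        have "1 + e/2 \<in> {0<..}" using e by simp
        then show "complex_of_real (1 + e/2) \<in> complex_of_real ` {0<..}" by (rule imageI)
      qed
      then show ?thesis unfolding islimpt_approachable by blast
    qed
    fix w assume "w \<in> complex_of_real ` {0<..}"
    then obtain x where x: "w = of_real x" "x > 0" by auto
    then show "jacobi_theta (1 / w) - csqrt w * jacobi_theta w = 0"
      using jacobi_theta_inversion_real[OF x(2)] by (simp add: csqrt_of_real)
  qed (use assms in \<open>auto intro!: convex_connected convex_halfspace_Re_gt open_halfspace_Re_gt\<close>)
  then show ?thesis by simp
qed

text \<open>The strip around the real axis that \<open>exp (2 * z)\<close> maps into the right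
  half-plane, where the theta series converges.\<close>

definition theta_strip :: "complex set" where
  "theta_strip = {z. \<bar>Im z\<bar> < pi / 4}"

lemma open_theta_strip: "open theta_strip" and convex_theta_strip: "convex theta_strip"
proof -
  have eq: "theta_strip = {z. Im z < pi / 4} \<inter> {z. Im z > - (pi / 4)}" by (auto simp: theta_strip_def)
  show "open theta_strip" unfolding eq by (intro open_Int open_halfspace_Im_lt open_halfspace_Im_gt)
  show "convex theta_strip" unfolding eq by (intro convex_Int convex_halfspace_Im_lt convex_halfspace_Im_gt)
qed

lemma uminus_theta_strip [simp]: "- z \<in> theta_strip \<longleftrightarrow> z \<in> theta_strip"
  by (auto simp: theta_strip_def)

lemma Re_exp_double: "Re (exp (2 * z)) = exp (2 * Re z) * cos (2 * Im z)"
  by (simp add: Re_exp)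

lemma Re_exp_double_pos: "z \<in> theta_strip \<Longrightarrow> 0 < Re (exp (2 * z))"
  unfolding Re_exp_double theta_strip_def by (intro mult_pos_pos cos_gt_zero_pi) (auto simp: abs_if split: if_splits)

section \<open>Theta in the logarithmic variable: parity, derivatives, decay\<close>

definition theta_log :: "complex \<Rightarrow> complex" where
  "theta_log z = exp (z / 2) * jacobi_theta (exp (2 * z))"

definition theta_log' :: "complex \<Rightarrow> complex" where
  "theta_log' z = exp (z / 2) * (jacobi_theta (exp (2 * z)) / 2 + 4 * exp (2 * z) * theta_deriv 1 (exp (2 * z)))"

text \<open>This is \<open>\<omega>'' - \<omega> / 4\<close> for \<open>\<omega> = theta_log\<close>.\<close>

definition xi_kernel :: "complex \<Rightarrow> complex" where
  "xi_kernel z = exp (z / 2) * (8 * exp (2 * z) ^ 2 * theta_deriv 2 (exp (2 * z)) + 12 * exp (2 * z) * theta_deriv 1 (exp (2 * z)))"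

text \<open>In the strip \<open>exp z\<close> has positive real part, so it is the principal root of
  \<open>exp (2 * z)\<close>; the prefactor \<open>exp (z / 2)\<close> splits the factor of the
  inversion formula evenly between \<open>z\<close> and \<open>- z\<close>.\<close>

lemma theta_log_even:
  assumes "z \<in> theta_strip"
  shows "theta_log (- z) = theta_log z"
proof -
  have "csqrt (exp (2 * z)) = exp z"
  proof (rule csqrt_unique)
    show "exp z ^ 2 = exp (2 * z)" by (simp add: exp_double)
    have "0 < Re (exp z)" unfolding Re_exp using assms pi_gt_zero
      by (intro mult_pos_pos cos_gt_zero_pi) (auto simp: theta_strip_def abs_if split: if_splits)
    then show "0 < Re (exp z) \<or> Re (exp z) = 0 \<and> 0 \<le> Im (exp z)" by simp
  qed
  then have "jacobi_theta (exp (2 * (- z))) = exp z * jacobi_theta (exp (2 * z))"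
    using jacobi_theta_inversion[OF Re_exp_double_pos[OF assms]] by (simp add: exp_minus inverse_eq_divide)
  then show ?thesis unfolding theta_log_def by (simp flip: exp_add mult.assoc)
qed

lemma theta_deriv_exp_derivative:
  assumes "z \<in> theta_strip"
  shows "((\<lambda>z. theta_deriv j (exp (2 * z))) has_field_derivative (theta_deriv (Suc j) (exp (2 * z)) * (2 * exp (2 * z)))) (at z)"
  by (rule DERIV_chain2[where f="theta_deriv j" and g="\<lambda>z. exp (2 * z)", OF theta_deriv_has_derivative[OF Re_exp_double_pos[OF assms]]])
     (auto intro!: derivative_eq_intros)

lemma exp_scaled_derivative: "((\<lambda>z::complex. exp (c * z)) has_field_derivative c * exp (c * z)) (at z)"
  by (auto intro!: derivative_eq_intros)

lemma theta_log_derivative: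
  assumes "z \<in> theta_strip"
  shows "(theta_log has_field_derivative theta_log' z) (at z)"
proof -
  have e: "((\<lambda>z. exp (z / 2)) has_field_derivative exp (z / 2) / 2) (at z)"
    using exp_scaled_derivative[of "1/2"] by simp
  note T0 = theta_deriv_exp_derivative[OF assms, of 0]
  show ?thesis
    unfolding theta_log_def[abs_def] theta_log'_def jacobi_theta_eq
    by (rule DERIV_cong[OF DERIV_mult[OF e DERIV_add[OF DERIV_const DERIV_cmult[OF T0]]]]) (simp add: field_simps)
qed

lemma theta_log'_derivative:
  assumes "z \<in> theta_strip"
  shows "(theta_log' has_field_derivative (xi_kernel z + theta_log z / 4)) (at z)"
proof -
  have e: "((\<lambda>z. exp (z / 2)) has_field_derivative exp (z / 2) / 2) (at z)"
    using exp_scaled_derivative[of "1/2"] by simp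
  note T0 = theta_deriv_exp_derivative[OF assms, of 0] and T1 = theta_deriv_exp_derivative[OF assms, of 1]
    and W = exp_scaled_derivative[of 2 z]
  show ?thesis
    unfolding theta_log_def theta_log'_def[abs_def] xi_kernel_def jacobi_theta_eq
    by (rule DERIV_cong[OF DERIV_mult[OF e DERIV_add[OF DERIV_cdivide[OF DERIV_add[OF DERIV_const DERIV_cmult[OF T0]]] DERIV_mult[OF DERIV_cmult[OF W] T1]]]])
       (simp add: field_simps power2_eq_square numeral_2_eq_2)
qed

lemma xi_kernel_holomorphic: "xi_kernel holomorphic_on theta_strip"
proof -
  have "(\<lambda>z. theta_deriv j (exp (2 * z))) holomorphic_on theta_strip" for j
    unfolding holomorphic_on_open[OF open_theta_strip] using theta_deriv_exp_derivative by blast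
  then show ?thesis unfolding xi_kernel_def by (intro holomorphic_intros) simp_all
qed

text \<open>Differentiation reverses parity. The sign \<open>e\<close> covers the even and the odd
  case, so that two applications lead from \<open>theta_log\<close> to its second
  derivative.\<close>

lemma deriv_even_odd:
  fixes f :: "complex \<Rightarrow> complex"
  assumes S: "open S" "z \<in> S" "- z \<in> S" and sym: "\<And>z. z \<in> S \<Longrightarrow> f (- z) = e * f z"
    and d: "\<And>z. z \<in> S \<Longrightarrow> (f has_field_derivative f' z) (at z)"
  shows "f' (- z) = - e * f' z"
proof -
  have "((\<lambda>z. f (- z)) has_field_derivative f' (- z) * (-1)) (at z)"
    by (rule DERIV_chain2[where f=f and g=uminus, OF d[OF S(3)]]) (auto intro!: derivative_eq_intros)
  then have "((\<lambda>z. e * f z) has_field_derivative f' (- z) * (-1)) (at z)"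
    by (rule has_field_derivative_transform_within_open[OF _ S(1,2)]) (use sym in auto)
  moreover have "((\<lambda>z. e * f z) has_field_derivative e * f' z) (at z)" by (intro DERIV_cmult d S)
  ultimately have "f' (- z) * (-1) = e * f' z" by (rule DERIV_unique)
  from arg_cong[OF this, of uminus] show ?thesis by simp
qed

lemma xi_kernel_even:
  assumes "z \<in> theta_strip"
  shows "xi_kernel (- z) = xi_kernel z"
proof -
  have odd: "theta_log' (- z) = - 1 * theta_log' z" if "z \<in> theta_strip" for z
    by (rule deriv_even_odd[OF open_theta_strip, of z theta_log 1]) (use that theta_log_even theta_log_derivative in auto)
  have "xi_kernel (- z) + theta_log (- z) / 4 = - (- 1) * (xi_kernel z + theta_log z / 4)"
    by (rule deriv_even_odd[OF open_theta_strip, of z theta_log' "-1"]) (use assms odd theta_log'_derivative in auto)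
  then show ?thesis using theta_log_even[OF assms] by simp
qed

text \<open>For \<open>Re z \<ge> 0\<close> the point \<open>w = exp (2 * z)\<close> satisfies
  \<open>Re w \<ge> cos (2 * \<alpha>) * norm w\<close>, so the theta derivatives decay
  exponentially in \<open>norm w\<close>. Negative real parts, where the series gives no decay
  directly, follow from evenness.\<close>

lemma xi_kernel_bound:
  assumes "0 \<le> \<alpha>" "\<alpha> < pi / 4"
  obtains C \<kappa> where "\<kappa> > 0" "C > 0" "\<And>z. \<bar>Im z\<bar> \<le> \<alpha> \<Longrightarrow> norm (xi_kernel z) \<le> C * exp (- \<kappa> * exp \<bar>Re z\<bar>)"
proof -
  define c where "c = cos (2 * \<alpha>)"
  have c: "c > 0" unfolding c_def using assms by (intro cos_gt_zero_pi) auto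
  define \<kappa> where "\<kappa> = pi * c / 2"
  have \<kappa>: "\<kappa> > 0" using c by (simp add: \<kappa>_def)
  define K where "K j = fact j * (2 / c) ^ j / (1 - exp (- pi * c / 2))" for j :: nat
  have K: "K j > 0" for j unfolding K_def using c by (intro divide_pos_pos mult_pos_pos) auto
  define C where "C = (8 * K 2 + 12 * K 1) * (2 / \<kappa>)"
  have pos: "norm (xi_kernel z) \<le> C * exp (- (\<kappa> / 2) * exp (Re z))" if z: "\<bar>Im z\<bar> \<le> \<alpha>" "Re z \<ge> 0" for z
  proof -
    define w where "w = exp (2 * z)"
    define u where "u = Re z"
    have nw: "norm w = exp (2 * u)" by (simp add: w_def u_def)
    have w1: "norm w \<ge> 1" using z by (simp add: nw u_def)
    have "cos (2 * \<alpha>) \<le> cos (2 * \<bar>Im z\<bar>)" using z assms by (intro cos_monotone_0_pi_le) auto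
    moreover have "cos (2 * \<bar>Im z\<bar>) = cos (2 * Im z)" by (auto simp: abs_if)
    ultimately have Rw: "Re w \<ge> c * norm w" unfolding w_def Re_exp_double c_def using nw w_def u_def by (simp add: mult.commute)
    have "c * 1 \<le> c * norm w" using w1 c by (intro mult_left_mono) auto
    then have Rc: "Re w \<ge> c" using Rw by linarith
    \<comment> \<open>The growth \<open>norm w ^ j\<close> is cancelled by
      \<open>(2 / Re w) ^ j\<close>, as \<open>norm w / Re w\<close> is at most
      \<open>1 / c\<close>.\<close>
    have T: "norm w ^ j * norm (theta_deriv j w) \<le> K j * exp (- \<kappa> * exp (2 * u))" for j
    proof -
      have "norm w ^ j * norm (theta_deriv j w) \<le> norm w ^ j * (fact j * (2 / Re w) ^ j * exp (- pi * Re w / 2) / (1 - exp (- pi * c / 2)))"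
        by (intro mult_left_mono norm_theta_deriv_le c Rc) auto
      also have "\<dots> = fact j * (norm w * (2 / Re w)) ^ j * exp (- pi * Re w / 2) / (1 - exp (- pi * c / 2))"
        unfolding power_mult_distrib by (simp add: mult_ac)
      also have "\<dots> \<le> fact j * (2 / c) ^ j * exp (- \<kappa> * exp (2 * u)) / (1 - exp (- pi * c / 2))"
      proof (intro divide_right_mono mult_mono power_mono)
        show "norm w * (2 / Re w) \<le> 2 / c" using Rw Rc c by (simp add: field_simps)
        have "pi * (c * norm w) \<le> pi * Re w" using Rw by (intro mult_left_mono) auto
        then show "exp (- pi * Re w / 2) \<le> exp (- \<kappa> * exp (2 * u))" by (simp add: \<kappa>_def nw mult_ac)
        show "0 \<le> 1 - exp (- pi * c / 2)" using c by simp
        show "0 \<le> norm w * (2 / Re w)" using Rc c by simp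
      qed (use c Rc in \<open>auto intro!: zero_le_power divide_nonneg_nonneg\<close>)
      finally show ?thesis by (simp add: K_def)
    qed
    have "norm (xi_kernel z) \<le> exp (u / 2) * (8 * (norm w ^ 2 * norm (theta_deriv 2 w)) + 12 * (norm w ^ 1 * norm (theta_deriv 1 w)))"
    proof -
      have "norm (8 * w ^ 2 * theta_deriv 2 w + 12 * w * theta_deriv 1 w) \<le> norm (8 * w ^ 2 * theta_deriv 2 w) + norm (12 * w * theta_deriv 1 w)"
        by (rule norm_triangle_ineq)
      then show ?thesis unfolding xi_kernel_def w_def[symmetric] by (simp add: norm_mult norm_power u_def)
    qed
    also have "\<dots> \<le> exp (u / 2) * (8 * (K 2 * exp (- \<kappa> * exp (2 * u))) + 12 * (K 1 * exp (- \<kappa> * exp (2 * u))))"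
      by (intro mult_left_mono add_mono T) auto
    also have "\<dots> = (8 * K 2 + 12 * K 1) * (exp (u / 2) * exp (- \<kappa> * exp (2 * u)))" by (simp add: algebra_simps)
    \<comment> \<open>Half of the decay is given up to absorb \<open>exp (u / 2)\<close>.\<close>
    also have "\<dots> \<le> (8 * K 2 + 12 * K 1) * ((2 / \<kappa>) * exp (- (\<kappa> / 2) * exp u))"
    proof (intro mult_left_mono)
      have u0: "u \<ge> 0" using z by (simp add: u_def)
      have "\<kappa> / 2 * exp u \<le> exp (\<kappa> / 2 * exp u)" using exp_ge_add_one_self[of "\<kappa> / 2 * exp u"] by linarith
      then have "exp u \<le> (2 / \<kappa>) * exp (\<kappa> / 2 * exp u)" using \<kappa> by (simp add: field_simps)
      then have 1: "exp (u / 2) \<le> (2 / \<kappa>) * exp (\<kappa> / 2 * exp u)" using u0 by (elim order_trans[rotated]) simp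
      have "\<kappa> * exp u \<le> \<kappa> * exp (2 * u)" using \<kappa> u0 by (intro mult_left_mono) auto
      then have 2: "exp (- \<kappa> * exp (2 * u)) \<le> exp (- \<kappa> * exp u)" by simp
      have "exp (u / 2) * exp (- \<kappa> * exp (2 * u)) \<le> ((2 / \<kappa>) * exp (\<kappa> / 2 * exp u)) * exp (- \<kappa> * exp u)"
        using \<kappa> by (intro mult_mono 1 2) auto
      also have "\<dots> = (2 / \<kappa>) * exp (\<kappa> / 2 * exp u + - \<kappa> * exp u)" by (simp only: exp_add mult.assoc)
      also have "\<kappa> / 2 * exp u + - \<kappa> * exp u = - (\<kappa> / 2) * exp u" by (simp add: field_simps)
      finally show "exp (u / 2) * exp (- \<kappa> * exp (2 * u)) \<le> (2 / \<kappa>) * exp (- (\<kappa> / 2) * exp u)" .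
    qed (use K[of 1] K[of 2] in auto)
    finally show ?thesis unfolding C_def u_def by (simp only: mult.assoc)
  qed
  show ?thesis
  proof (rule that[of "\<kappa> / 2" C])
    show "C > 0" unfolding C_def using K[of 1] K[of 2] \<kappa> by (intro mult_pos_pos add_pos_pos) auto
    fix z :: complex assume z: "\<bar>Im z\<bar> \<le> \<alpha>"
    show "norm (xi_kernel z) \<le> C * exp (- (\<kappa> / 2) * exp \<bar>Re z\<bar>)"
    proof (cases "Re z \<ge> 0")
      case False
      have "z \<in> theta_strip" using z assms by (simp add: theta_strip_def)
      then show ?thesis using pos[of "- z"] z False xi_kernel_even by simp
    qed (use pos[OF z] in auto)
  qed (use \<kappa> in auto)
qed

section \<open>The kernel on the real line\<close>

lemma real_in_theta_strip [simp]: "complex_of_real u \<in> theta_strip"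
  by (simp add: theta_strip_def)

definition xi_density :: "real \<Rightarrow> real" where
  "xi_density u = Re (xi_kernel (complex_of_real u))"

lemma xi_kernel_term:
  fixes u :: real and n :: nat
  defines "a \<equiv> pi * real (Suc n) ^ 2 * exp (2 * u)" and "w \<equiv> complex_of_real (exp (2 * u))"
  shows "complex_of_real (exp (u / 2) * ((8 * a ^ 2 - 12 * a) * exp (- a))) = complex_of_real (exp (u / 2)) * (8 * w ^ 2 * theta_term 2 n w + 12 * w * theta_term 1 n w)"
proof -
  have "exp (- of_real (pi * real (Suc n) ^ 2) * w) = complex_of_real (exp (- a))"
    using exp_of_real[of "- a", where 'a=complex] unfolding w_def a_def by (simp del: of_nat_Suc)
  then have th: "theta_term j n w = complex_of_real ((- (pi * real (Suc n) ^ 2)) ^ j * exp (- a))" for j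
    unfolding theta_term_def by (simp del: of_nat_Suc)
  have "complex_of_real (exp (u / 2)) * (8 * w ^ 2 * theta_term 2 n w + 12 * w * theta_term 1 n w) =
    complex_of_real (exp (u / 2) * (8 * exp (2 * u) ^ 2 * ((- (pi * real (Suc n) ^ 2)) ^ 2 * exp (- a)) + 12 * exp (2 * u) * ((- (pi * real (Suc n) ^ 2)) ^ 1 * exp (- a))))"
    unfolding th unfolding w_def by (simp del: of_nat_Suc)
  also have "exp (u / 2) * (8 * exp (2 * u) ^ 2 * ((- (pi * real (Suc n) ^ 2)) ^ 2 * exp (- a)) + 12 * exp (2 * u) * ((- (pi * real (Suc n) ^ 2)) ^ 1 * exp (- a)))
     = exp (u / 2) * ((8 * a ^ 2 - 12 * a) * exp (- a))"
    unfolding a_def by (simp add: power2_eq_square algebra_simps del: of_nat_Suc)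
  finally show ?thesis ..
qed

lemma xi_kernel_real_sums:
  fixes u :: real
  defines "a \<equiv> \<lambda>n. pi * real (Suc n) ^ 2 * exp (2 * u)"
  shows "(\<lambda>n. complex_of_real (exp (u / 2) * ((8 * a n ^ 2 - 12 * a n) * exp (- a n)))) sums xi_kernel (complex_of_real u)"
proof -
  have w: "exp (2 * complex_of_real u) = complex_of_real (exp (2 * u))"
    using exp_of_real[of "2 * u", where 'a=complex] by simp
  have e: "exp (complex_of_real u / 2) = complex_of_real (exp (u / 2))"
    using exp_of_real[of "u / 2", where 'a=complex] by simp
  show ?thesis
    unfolding xi_kernel_term a_def xi_kernel_def w e by (intro sums_mult sums_add theta_term_sums) simp_all
qed

lemma summable_xi_kernel_terms:
  fixes u :: real
  defines "a \<equiv> \<lambda>n. pi * real (Suc n) ^ 2 * exp (2 * u)"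
  shows "summable (\<lambda>n. \<bar>exp (u / 2) * ((8 * a n ^ 2 - 12 * a n) * exp (- a n))\<bar>)"
proof (rule summable_comparison_test')
  let ?w = "complex_of_real (exp (2 * u))"
  show "summable (\<lambda>n. exp (u / 2) * (8 * exp (2 * u) ^ 2 * norm (theta_term 2 n ?w) + 12 * exp (2 * u) * norm (theta_term 1 n ?w)))"
    by (intro summable_mult summable_add summable_norm_theta_term) simp_all
  fix n :: nat assume "0 \<le> n"
  have "\<bar>exp (u / 2) * ((8 * a n ^ 2 - 12 * a n) * exp (- a n))\<bar> = norm (complex_of_real (exp (u / 2)) * (8 * ?w ^ 2 * theta_term 2 n ?w + 12 * ?w * theta_term 1 n ?w))"
    unfolding xi_kernel_term[symmetric] norm_of_real a_def ..
  also have "\<dots> \<le> exp (u / 2) * (8 * exp (2 * u) ^ 2 * norm (theta_term 2 n ?w) + 12 * exp (2 * u) * norm (theta_term 1 n ?w))"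
    unfolding norm_mult[of "complex_of_real (exp (u / 2))"]
    by (intro mult_mono order_trans[OF norm_triangle_ineq]) (auto simp: norm_mult norm_power simp del: of_real_exp)
  finally show "norm \<bar>exp (u / 2) * ((8 * a n ^ 2 - 12 * a n) * exp (- a n))\<bar> \<le> exp (u / 2) * (8 * exp (2 * u) ^ 2 * norm (theta_term 2 n ?w) + 12 * exp (2 * u) * norm (theta_term 1 n ?w))"
    by simp
qed

lemma xi_kernel_of_real: "xi_kernel (complex_of_real u) = complex_of_real (xi_density u)"
proof -
  have "(\<lambda>n. 0) sums Im (xi_kernel (complex_of_real u))"
    using sums_Im[OF xi_kernel_real_sums[of u]] by simp
  then have "Im (xi_kernel (complex_of_real u)) = 0" using sums_unique2 sums_zero by blast
  then show ?thesis by (simp add: xi_density_def complex_eq_iff)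
qed

lemma xi_density_sums:
  fixes u :: real
  defines "a \<equiv> \<lambda>n. pi * real (Suc n) ^ 2 * exp (2 * u)"
  shows "(\<lambda>n. exp (u / 2) * ((8 * a n ^ 2 - 12 * a n) * exp (- a n))) sums xi_density u"
  using xi_kernel_real_sums[of u] unfolding xi_kernel_of_real sums_of_real_iff a_def .

lemma xi_density_even: "xi_density (- u) = xi_density u"
  using xi_kernel_even[of "complex_of_real u"] by (simp add: xi_density_def)

text \<open>For \<open>u \<ge> 0\<close> all terms are positive:
  \<open>8 * a^2 - 12 * a = 4 * a * (2 * a - 3)\<close>, and \<open>a\<close> is at least
  \<open>pi\<close>, which exceeds 3/2. For \<open>u < 0\<close> single terms can be negative, and
  evenness is used instead.\<close>

lemma xi_density_pos: "xi_density u > 0"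
proof -
  have pos: "xi_density u > 0" if "u \<ge> 0" for u
  proof -
    define a where "a n = pi * real (Suc n) ^ 2 * exp (2 * u)" for n
    have a: "a n > 3 / 2" for n
    proof -
      have "pi * 1 * 1 \<le> a n" unfolding a_def using that by (intro mult_mono) auto
      then show ?thesis using pi_gt3 by simp
    qed
    have t: "exp (u / 2) * ((8 * a n ^ 2 - 12 * a n) * exp (- a n)) > 0" for n
    proof -
      have "8 * a n ^ 2 - 12 * a n = 4 * a n * (2 * a n - 3)" by (simp add: power2_eq_square algebra_simps)
      then show ?thesis using a[of n] by simp
    qed
    show ?thesis
      using suminf_pos[OF sums_summable[OF xi_density_sums[of u]]] t
      unfolding sums_unique[OF xi_density_sums[of u]] a_def by blast
  qed
  show ?thesis using pos[of u] pos[of "- u"] xi_density_even[of u] by linarith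
qed

section \<open>Entire functions of order less than one\<close>

text \<open>The map \<open>x / (2 * A - x)\<close> fixes 0 and sends the half-plane
  \<open>Re x < A\<close> into the unit disc, so the Schwarz lemma applies to its composition with
  the rescaled \<open>h\<close>.\<close>

lemma borel_caratheodory:
  assumes holh: "h holomorphic_on ball 0 R" and h0: "h 0 = 0" and R: "R > 0"
    and le: "\<And>z. norm z < R \<Longrightarrow> Re (h z) < A" and z: "norm z \<le> R / 2"
  shows "norm (h z) \<le> 4 * A * norm z / R"
proof -
  have A: "A > 0" using le[of 0] h0 R by simp
  define w where "w \<zeta> = h (of_real R * \<zeta>) / (2 * of_real A - h (of_real R * \<zeta>))" for \<zeta>
  have inb: "norm (of_real R * \<zeta>) < R" if "norm \<zeta> < 1" for \<zeta> :: complex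
    using that R by (simp add: norm_mult)
  have nz: "2 * of_real A - h (of_real R * \<zeta>) \<noteq> 0" if "norm \<zeta> < 1" for \<zeta>
  proof
    assume "2 * of_real A - h (of_real R * \<zeta>) = 0"
    then have "Re (h (of_real R * \<zeta>)) = 2 * A" by (simp add: complex_eq_iff)
    then show False using le[OF inb[OF that]] A by simp
  qed
  have lt1: "norm (w \<zeta>) < 1" if "norm \<zeta> < 1" for \<zeta>
  proof -
    let ?x = "h (of_real R * \<zeta>)"
    have "A * Re ?x < A * A" using le[OF inb[OF that]] A by simp
    moreover have "(norm (2 * of_real A - ?x))\<^sup>2 = (norm ?x)\<^sup>2 + 4 * (A * A - A * Re ?x)"
      unfolding cmod_power2 by (simp add: power2_eq_square algebra_simps)
    ultimately have "(norm ?x)\<^sup>2 < (norm (2 * of_real A - ?x))\<^sup>2" by simp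
    then have "norm ?x < norm (2 * of_real A - ?x)" by (simp add: power2_less_imp_less)
    then show ?thesis unfolding w_def norm_divide by (subst divide_less_eq_1_pos) (auto intro: le_less_trans[OF norm_ge_zero])
  qed
  have "(\<lambda>\<zeta>. h (of_real R * \<zeta>)) holomorphic_on ball 0 1"
    by (rule holomorphic_on_compose_gen[OF _ holh, unfolded o_def])
       (use inb in \<open>auto intro!: holomorphic_intros\<close>)
  then have "w holomorphic_on ball 0 1"
    unfolding w_def by (intro holomorphic_intros) (use nz in auto)
  define \<zeta> where "\<zeta> = z / of_real R"
  have \<zeta>: "norm \<zeta> \<le> 1/2" "of_real R * \<zeta> = z" using z R by (auto simp: \<zeta>_def norm_divide field_simps)
  have ws: "norm (w \<zeta>) \<le> norm \<zeta>"
    using \<zeta> by (intro Schwarz_Lemma(1)[OF \<open>w holomorphic_on ball 0 1\<close>] lt1) (auto simp: w_def h0)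
  \<comment> \<open>Solving for \<open>h\<close> gives \<open>2 * A * w / (1 + w)\<close>, and
    \<open>norm w \<le> 1/2\<close> keeps the denominator at least 1/2 in norm.\<close>
  have "h z * (1 + w \<zeta>) = 2 * A * w \<zeta>"
    using nz[of \<zeta>] \<zeta> by (simp add: w_def field_simps)
  from arg_cong[OF this, of norm] have eq: "norm (h z) * norm (1 + w \<zeta>) = 2 * A * norm (w \<zeta>)"
    using A by (simp add: norm_mult)
  have "norm (1 + w \<zeta>) \<ge> 1/2"
    using norm_diff_ineq[of 1 "w \<zeta>"] ws \<zeta> by simp
  then have "norm (h z) * (1/2) \<le> norm (h z) * norm (1 + w \<zeta>)" by (rule mult_left_mono) simp
  also have "\<dots> \<le> 2 * A * norm \<zeta>" unfolding eq using ws A by (intro mult_left_mono) auto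
  finally have "norm (h z) * (1/2) \<le> 2 * A * norm \<zeta>" .
  then show ?thesis using R by (simp add: \<zeta>_def norm_divide field_simps)
qed

text \<open>A list keeps multiplicities, and each factor is normalized to the value 1 at 0.\<close>

definition root_prod :: "complex list \<Rightarrow> complex \<Rightarrow> complex" where
  "root_prod bs w = (\<Prod>b\<leftarrow>bs. 1 - w / b)"

lemma root_prod_simps [simp]:
  "root_prod [] w = 1" "root_prod (b # bs) w = (1 - w / b) * root_prod bs w"
  by (simp_all add: root_prod_def)

lemma root_prod_0 [simp]: "root_prod bs 0 = 1"
  by (induction bs) auto

lemma root_prod_eq_0_iff:
  assumes "0 \<notin> set bs"
  shows "root_prod bs w = 0 \<longleftrightarrow> w \<in> set bs"
  using assms by (induction bs) auto

text \<open>On the circle of radius \<open>3 * R\<close> each quotient \<open>w / b\<close> has norm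
  at least 3, hence each factor has norm at least 2. This gain per zero is what limits the number of
  zeros that can be divided out.\<close>

lemma norm_root_prod_ge:
  assumes "\<And>b. b \<in> set bs \<Longrightarrow> b \<noteq> 0 \<and> norm b \<le> R" and w: "norm w = 3 * R"
  shows "norm (root_prod bs w) \<ge> 2 ^ length bs"
  using assms(1)
proof (induction bs)
  case (Cons b bs)
  have b: "b \<noteq> 0" "norm b \<le> R" using Cons.prems by auto
  have "norm (w / b) \<ge> 3" using b w by (simp add: norm_divide field_simps)
  then have "norm (1 - w / b) \<ge> 2" using norm_triangle_ineq2[of "w / b" 1] by (simp add: norm_minus_commute)
  then have "2 * 2 ^ length bs \<le> norm (1 - w / b) * norm (root_prod bs w)"
    using Cons by (intro mult_mono) auto
  then show ?case by (simp add: norm_mult)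
qed auto

lemma entire_factor_zero:
  assumes hol: "g holomorphic_on UNIV" and a: "g a = 0" "a \<noteq> 0"
  obtains h where "h holomorphic_on UNIV" "\<And>w. g w = (1 - w / a) * h w"
proof -
  define h where "h w = - a * (if w = a then deriv g a else (g w - g a) / (w - a))" for w
  have "h holomorphic_on UNIV"
    unfolding h_def by (intro holomorphic_intros pole_lemma hol) auto
  moreover have "g w = (1 - w / a) * h w" for w
    using a by (auto simp: h_def field_simps)
  ultimately show ?thesis using that by blast
qed

text \<open>The symmetry is clear off the finitely many roots and extends by density. It ensures
  that a nonreal zero of the cofactor comes with its conjugate.\<close>

lemma cnj_symmetric_cofactor:
  assumes H: "H holomorphic_on UNIV" and P: "0 \<notin> set bs" "\<And>w. root_prod bs (cnj w) = cnj (root_prod bs w)"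
    and G: "\<And>w. root_prod bs (cnj w) * H (cnj w) = cnj (root_prod bs w * H w)"
  shows "H (cnj w) = cnj (H w)"
proof -
  have cH: "continuous_on UNIV H" using H by (rule holomorphic_on_imp_continuous_on)
  have "closed {w. H (cnj w) = cnj (H w)}"
    by (intro closed_Collect_eq continuous_intros continuous_on_compose2[OF cH]) auto
  moreover have "- set bs \<subseteq> {w. H (cnj w) = cnj (H w)}"
  proof safe
    fix w assume "w \<notin> set bs"
    then have "root_prod bs w \<noteq> 0" using P(1) root_prod_eq_0_iff by blast
    then show "H (cnj w) = cnj (H w)" using G[of w] P(2)[of w] by simp
  qed
  ultimately have "closure (- set bs) \<subseteq> {w. H (cnj w) = cnj (H w)}" by (rule closure_minimal[rotated])
  then show ?thesis using empty_interior_finite[OF finite_set, of bs] by (auto simp: closure_complement)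
qed

text \<open>By the maximum principle on the circle of radius \<open>3 R\<close>, only boundedly many zeros can be divided
  out of the disc of radius \<open>R\<close>; a maximal choice leaves a cofactor without zeros there.\<close>

lemma real_entire_finite_factorization:
  assumes hol: "G holomorphic_on UNIV" and G0: "G 0 \<noteq> 0" and sym: "\<And>w. G (cnj w) = cnj (G w)"
    and R: "R > 0" and M: "\<And>w. norm w = 3 * R \<Longrightarrow> norm (G w) \<le> M"
  obtains bs H where "\<And>b. b \<in> set bs \<Longrightarrow> b \<noteq> 0 \<and> G b = 0" "\<And>w. root_prod bs (cnj w) = cnj (root_prod bs w)"
    "H holomorphic_on UNIV" "\<And>w. G w = root_prod bs w * H w" "\<And>w. norm w \<le> R \<Longrightarrow> H w \<noteq> 0"
    "\<And>w. norm w \<le> 3 * R \<Longrightarrow> norm (H w) \<le> M"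
proof -
  define Q where "Q bs \<longleftrightarrow> (\<forall>b\<in>set bs. b \<noteq> 0 \<and> norm b \<le> R \<and> G b = 0) \<and> (\<forall>w. root_prod bs (cnj w) = cnj (root_prod bs w))
     \<and> (\<exists>H. H holomorphic_on UNIV \<and> (\<forall>w. G w = root_prod bs w * H w))" for bs
  have Hle: "norm (H w) \<le> M / 2 ^ length bs"
    if "Q bs" "H holomorphic_on UNIV" "\<And>w. G w = root_prod bs w * H w" "norm w \<le> 3 * R" for bs H w
  proof (rule maximum_modulus_frontier[of H "cball 0 (3 * R)"])
    show "H holomorphic_on interior (cball 0 (3 * R))" using that(2) by (rule holomorphic_on_subset) auto
    show "continuous_on (closure (cball 0 (3 * R))) H"
      using that(2) by (intro holomorphic_on_imp_continuous_on) (rule holomorphic_on_subset, auto)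
    fix z :: complex assume "z \<in> frontier (cball 0 (3 * R))"
    then have z: "norm z = 3 * R" using R by (simp add: frontier_cball)
    have ge: "norm (root_prod bs z) \<ge> 2 ^ length bs"
      by (rule norm_root_prod_ge[OF _ z]) (use that(1) Q_def in auto)
    have "norm (root_prod bs z) * norm (H z) \<le> M" using M[OF z] that(3)[of z] by (simp add: norm_mult)
    moreover have "2 ^ length bs * norm (H z) \<le> norm (root_prod bs z) * norm (H z)"
      by (intro mult_right_mono ge) auto
    ultimately show "norm (H z) \<le> M / 2 ^ length bs" by (simp add: field_simps)
  qed (use that in auto)
  obtain N where N: "M / norm (G 0) < 2 ^ N" using real_arch_pow[of 2 "M / norm (G 0)"] by auto
  have len: "length bs < N" if Q: "Q bs" for bs
  proof -
    obtain H where H: "H holomorphic_on UNIV" "\<And>w. G w = root_prod bs w * H w" using Q unfolding Q_def by blast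
    have "norm (G 0) \<le> M / 2 ^ length bs" using Hle[OF Q H, of 0] R H(2)[of 0] by simp
    then have "2 ^ length bs \<le> M / norm (G 0)" using G0 by (simp add: field_simps)
    then have "(2::real) ^ length bs < 2 ^ N" using N by linarith
    then show ?thesis by simp
  qed
  have "Q []" using hol by (auto simp: Q_def)
  then obtain bs where Q: "Q bs" and maxl: "\<And>cs. Q cs \<Longrightarrow> length cs \<le> length bs"
    using ex_has_greatest_nat[of Q "[]" length N] len less_imp_le by blast
  obtain H where H: "H holomorphic_on UNIV" "\<And>w. G w = root_prod bs w * H w" using Q unfolding Q_def by blast
  have bs: "\<And>b. b \<in> set bs \<Longrightarrow> b \<noteq> 0 \<and> norm b \<le> R \<and> G b = 0" and bsym: "\<And>w. root_prod bs (cnj w) = cnj (root_prod bs w)"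
    using Q unfolding Q_def by blast+
  have nz: "H a \<noteq> 0" if a: "norm a \<le> R" for a
  proof
    assume Ha: "H a = 0"
    have a0: "a \<noteq> 0" using Ha H(2)[of 0] G0 by auto
    have Ga: "G a = 0" using H(2)[of a] Ha by simp
    obtain H1 where H1: "H1 holomorphic_on UNIV" "\<And>w. H w = (1 - w / a) * H1 w"
      using entire_factor_zero[OF H(1) Ha a0] by blast
    show False
    \<comment> \<open>A nonreal zero must be divided out together with its conjugate, since
      \<open>Q\<close> demands a product symmetric under conjugation.\<close>
    proof (cases "cnj a = a")
      case True
      have "Q (a # bs)"
        unfolding Q_def using bs bsym a a0 Ga True H1 H(2) by (auto intro!: exI[of _ H1])
      then show False using maxl by force
    next
      case False
      have "H (cnj a) = cnj (H a)"
        by (rule cnj_symmetric_cofactor[OF H(1) _ bsym]) (use bs sym H(2) in metis)+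
      then have "H (cnj a) = 0" using Ha by simp
      moreover have "1 - cnj a / a \<noteq> 0" using False a0 by auto
      ultimately have H1a: "H1 (cnj a) = 0" using H1(2) by (metis mult_eq_0_iff)
      obtain H2 where H2: "H2 holomorphic_on UNIV" "\<And>w. H1 w = (1 - w / cnj a) * H2 w"
        using entire_factor_zero[OF H1(1) H1a] a0 by auto
      have "Q (a # cnj a # bs)"
        unfolding Q_def using bs bsym a a0 Ga sym[of a] H1 H(2) H2
        by (auto intro!: exI[of _ H2] simp: mult_ac)
      then show False using maxl by force
    qed
  qed
  have "norm (H w) \<le> M" if "norm w \<le> 3 * R" for w
  proof -
    have "M \<ge> 0" using order_trans[OF norm_ge_zero M[of "complex_of_real (3*R)"]] R by simp
    then have "M / 2 ^ length bs \<le> M" by (simp add: divide_le_eq mult_le_cancel_left1)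
    then show ?thesis using Hle[OF Q H that] by linarith
  qed
  then show ?thesis using that[of bs H] bs bsym H nz by blast
qed

text \<open>On the disc of radius \<open>R\<close> the cofactor without zeros is
  \<open>G 0 * exp h\<close> with \<open>h 0 = 0\<close>. The real part of \<open>h\<close> is
  bounded by \<open>\<mu> (3 * R)\<close> up to a constant, so by Borel-Caratheodory
  \<open>h\<close> is of size \<open>\<mu> (3 * R) / R\<close> on compact sets and tends to 0: the
  root products alone converge to \<open>G / G 0\<close>.\<close>

theorem real_entire_order_less_1_limit:
  assumes hol: "G holomorphic_on UNIV" and G0: "G 0 \<noteq> 0" and sym: "\<And>w. G (cnj w) = cnj (G w)"
    and growth: "\<And>w. norm (G w) \<le> exp (\<mu> (norm w))" and \<mu>: "((\<lambda>r. \<mu> r / r) \<longlongrightarrow> 0) at_top"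
  obtains bs :: "nat \<Rightarrow> complex list" where "\<And>n b. b \<in> set (bs n) \<Longrightarrow> b \<noteq> 0 \<and> G b = 0"
    "\<And>n w. root_prod (bs n) (cnj w) = cnj (root_prod (bs n) w)"
    "\<And>r. uniform_limit (cball 0 r) (\<lambda>n. root_prod (bs n)) (\<lambda>w. G w / G 0) sequentially"
proof -
  \<comment> \<open>An upper bound for \<open>Re (h z)\<close> on the disc of radius
    \<open>Suc n\<close>, obtained from the growth on the circle of three times that radius; the
    summand 1 makes it strict, as \<open>borel_caratheodory\<close> requires.\<close>
  define A where "A n = \<mu> (3 * real (Suc n)) - ln (norm (G 0)) + 1" for n
  have ex: "\<exists>bs h. (\<forall>b\<in>set bs. b \<noteq> 0 \<and> G b = 0) \<and> (\<forall>w. root_prod bs (cnj w) = cnj (root_prod bs w))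
     \<and> (\<forall>w. norm w \<le> real (Suc n) / 2 \<longrightarrow> norm (h w) \<le> 4 * A n * norm w / real (Suc n) \<and> root_prod bs w = G w / G 0 * exp (- h w))" for n
  proof -
    let ?R = "real (Suc n)"
    have R: "?R > 0" by simp
    have M: "norm (G w) \<le> exp (\<mu> (3 * ?R))" if "norm w = 3 * ?R" for w using growth[of w] unfolding that .
    obtain bs H where bs: "\<And>b. b \<in> set bs \<Longrightarrow> b \<noteq> 0 \<and> G b = 0" "\<And>w. root_prod bs (cnj w) = cnj (root_prod bs w)"
      and H: "H holomorphic_on UNIV" "\<And>w. G w = root_prod bs w * H w" "\<And>w. norm w \<le> ?R \<Longrightarrow> H w \<noteq> 0"
        "\<And>w. norm w \<le> 3 * ?R \<Longrightarrow> norm (H w) \<le> exp (\<mu> (3 * ?R))"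
      using real_entire_finite_factorization[OF hol G0 sym R M] by blast
    obtain g where g: "g holomorphic_on ball 0 ?R" "\<And>z. z \<in> ball 0 ?R \<Longrightarrow> H z = exp (g z)"
      by (rule contractible_imp_holomorphic_log[of H "ball 0 ?R"])
         (use H(3) in \<open>auto intro: holomorphic_on_subset[OF H(1)] convex_imp_contractible simp: less_imp_le\<close>)
    have H0: "H 0 = G 0" using H(2)[of 0] by simp
    define h where "h z = g z - g 0" for z
    have eh: "H z = G 0 * exp (h z)" if "norm z < ?R" for z
      using g(2)[of z] g(2)[of 0] that H0 by (simp add: h_def exp_diff)
    have "norm (h z) \<le> 4 * A n * norm z / ?R" if "norm z \<le> ?R / 2" for z :: complex
    proof (rule borel_caratheodory[OF _ _ _ _ that])
      show "h holomorphic_on ball 0 ?R" unfolding h_def by (intro holomorphic_intros g)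
      fix z :: complex assume z: "norm z < ?R"
      have "norm (G 0) * exp (Re (h z)) \<le> exp (\<mu> (3 * ?R))"
        using H(4)[of z] eh[OF z] z by (simp add: norm_mult)
      then have "ln (norm (G 0) * exp (Re (h z))) \<le> ln (exp (\<mu> (3 * ?R)))" using G0 by (subst ln_le_cancel_iff) auto
      then show "Re (h z) < A n" using G0 by (simp add: A_def ln_mult)
    qed (auto simp: h_def)
    moreover have "root_prod bs w = G w / G 0 * exp (- h w)" if "norm w \<le> ?R / 2" for w
      using H(2)[of w] eh[of w] that G0 by (simp add: exp_minus)
    ultimately show ?thesis using bs by blast
  qed
  from choice[OF allI[OF ex]] obtain bs where "\<forall>n. \<exists>h. (\<forall>b\<in>set (bs n). b \<noteq> 0 \<and> G b = 0) \<and> (\<forall>w. root_prod (bs n) (cnj w) = cnj (root_prod (bs n) w))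
     \<and> (\<forall>w. norm w \<le> real (Suc n) / 2 \<longrightarrow> norm (h w) \<le> 4 * A n * norm w / real (Suc n) \<and> root_prod (bs n) w = G w / G 0 * exp (- h w))" ..
  from choice[OF this] obtain h where bsh: "\<forall>n. (\<forall>b\<in>set (bs n). b \<noteq> 0 \<and> G b = 0) \<and> (\<forall>w. root_prod (bs n) (cnj w) = cnj (root_prod (bs n) w))
     \<and> (\<forall>w. norm w \<le> real (Suc n) / 2 \<longrightarrow> norm (h n w) \<le> 4 * A n * norm w / real (Suc n) \<and> root_prod (bs n) w = G w / G 0 * exp (- h n w))" ..
  have bs: "\<And>n b. b \<in> set (bs n) \<Longrightarrow> b \<noteq> 0 \<and> G b = 0" "\<And>n w. root_prod (bs n) (cnj w) = cnj (root_prod (bs n) w)"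
    and h: "\<And>n w. norm w \<le> real (Suc n) / 2 \<Longrightarrow> norm (h n w) \<le> 4 * A n * norm w / real (Suc n)"
    and eq: "\<And>n w. norm w \<le> real (Suc n) / 2 \<Longrightarrow> root_prod (bs n) w = G w / G 0 * exp (- h n w)"
    using bsh by blast+
  have Alim: "(\<lambda>n. A n / real (Suc n)) \<longlonglongrightarrow> 0"
  proof -
    have "filterlim (\<lambda>n. 3 * real (Suc n)) at_top sequentially" by real_asymp
    from filterlim_compose[OF \<mu> this] have 1: "(\<lambda>n. \<mu> (3 * real (Suc n)) / (3 * real (Suc n))) \<longlonglongrightarrow> 0" .
    have 2: "(\<lambda>n. (1 - ln (norm (G 0))) / real (Suc n)) \<longlonglongrightarrow> 0" by real_asymp
    have "(\<lambda>n. 3 * (\<mu> (3 * real (Suc n)) / (3 * real (Suc n))) + (1 - ln (norm (G 0))) / real (Suc n)) \<longlonglongrightarrow> 3 * 0 + 0"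
      by (intro tendsto_intros 1 2)
    moreover have "3 * (\<mu> (3 * real (Suc n)) / (3 * real (Suc n))) + (1 - ln (norm (G 0))) / real (Suc n) = A n / real (Suc n)" for n
      by (simp add: A_def add_divide_distrib diff_divide_distrib del: of_nat_Suc)
    ultimately show ?thesis by simp
  qed
  have "uniform_limit (cball 0 r) (\<lambda>n. root_prod (bs n)) (\<lambda>w. G w / G 0) sequentially" for r
  proof -
    have hlim: "uniform_limit (cball 0 r) (\<lambda>n w. - h n w) (\<lambda>w. 0) sequentially"
    proof (rule uniform_limitI)
      fix e :: real assume e: "e > 0"
      have "(\<lambda>n. 4 * (A n / real (Suc n)) * \<bar>r\<bar>) \<longlonglongrightarrow> 4 * 0 * \<bar>r\<bar>" by (intro tendsto_intros Alim)
      then have "eventually (\<lambda>n. 4 * (A n / real (Suc n)) * \<bar>r\<bar> < e) sequentially" using e by (auto dest: order_tendstoD(2))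
      moreover have "eventually (\<lambda>n. \<bar>r\<bar> \<le> real (Suc n) / 2) sequentially" by real_asymp
      ultimately show "\<forall>\<^sub>F n in sequentially. \<forall>x\<in>cball 0 r. dist (- h n x) 0 < e"
      proof eventually_elim
        case (elim n)
        show ?case
        proof
          fix x :: complex assume x: "x \<in> cball 0 r"
          have l: "norm (h n x) \<le> 4 * A n * norm x / real (Suc n)" by (rule h) (use x elim in auto)
          have "norm (h n x) < e"
          proof (cases "A n \<ge> 0")
            case True
            have "4 * (A n / real (Suc n)) * norm x \<le> 4 * (A n / real (Suc n)) * \<bar>r\<bar>"
              using x True by (intro mult_left_mono) auto
            then show ?thesis using l elim(1) by (simp del: of_nat_Suc)
          next
            case False
            then have "4 * A n * norm x / real (Suc n) \<le> 0" by (simp add: mult_nonpos_nonneg divide_nonpos_pos)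
            then show ?thesis using l e by linarith
          qed
          then show "dist (- h n x) 0 < e" by simp
        qed
      qed
    qed
    have "uniform_limit (cball 0 r) (\<lambda>n w. exp (- h n w)) (\<lambda>w. exp 0) sequentially"
    proof -
      have "uniform_limit (cball 0 r) (\<lambda>n w. exp (- h n w)) (exp \<circ> (\<lambda>w. 0)) sequentially"
      proof (rule uniform_limit_compose[OF hlim])
        show "uniformly_continuous_on (cball 0 1) (exp :: complex \<Rightarrow> complex)"
          by (intro compact_uniformly_continuous continuous_intros) auto
        show "\<forall>\<^sub>F n in sequentially. (\<lambda>w. - h n w) ` cball 0 r \<subseteq> cball 0 1"
          using uniform_limitD[OF hlim, of 1] by (auto simp: image_subset_iff elim!: eventually_mono intro: less_imp_le)
      qed auto
      then show ?thesis by (simp add: o_def)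
    qed
    moreover have "bounded ((\<lambda>w. G w / G 0) ` cball 0 r)"
      using G0 by (intro compact_imp_bounded compact_continuous_image continuous_intros
          holomorphic_on_imp_continuous_on[OF holomorphic_on_subset[OF hol]]) auto
    ultimately have "uniform_limit (cball 0 r) (\<lambda>n w. G w / G 0 * exp (- h n w)) (\<lambda>w. G w / G 0 * exp 0) sequentially"
      by (intro uniform_lim_mult uniform_limit_const) (auto simp: image_constant_conv)
    then have "uniform_limit (cball 0 r) (\<lambda>n w. G w / G 0 * exp (- h n w)) (\<lambda>w. G w / G 0) sequentially" by simp
    moreover have "eventually (\<lambda>n. \<bar>r\<bar> \<le> real (Suc n) / 2) sequentially" by real_asymp
    then have "\<forall>\<^sub>F n in sequentially. \<forall>w\<in>cball 0 r. G w / G 0 * exp (- h n w) = root_prod (bs n) w"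
      by eventually_elim (use eq in auto)
    ultimately show ?thesis by (rule uniform_limit_cong[THEN iffD1, rotated 2]) auto
  qed
  then show ?thesis using that bs by blast
qed

section \<open>Polynomials with zeros in a strip\<close>

text \<open>The middle clause says that the coefficients are real.\<close>

definition strip_poly :: "real \<Rightarrow> complex poly \<Rightarrow> bool" where
  "strip_poly D p \<longleftrightarrow> p \<noteq> 0 \<and> (\<forall>z. poly p (cnj z) = cnj (poly p z)) \<and> (\<forall>z. poly p z = 0 \<longrightarrow> \<bar>Im z\<bar> \<le> D)"

definition cosh_shift :: "real \<Rightarrow> complex poly \<Rightarrow> complex poly" where
  "cosh_shift m p = smult (1/2) (pcompose p [:\<i> * of_real m, 1:] + pcompose p [:- \<i> * of_real m, 1:])"

lemma poly_cosh_shift: "poly (cosh_shift m p) z = (poly p (z + \<i> * of_real m) + poly p (z - \<i> * of_real m)) / 2"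
  by (simp add: cosh_shift_def poly_pcompose algebra_simps)

text \<open>A conjugate pair of zeros is closer to the point shifted downwards; its Jensen disc shrinks by the shift.\<close>

lemma norm_shift_pair_less:
  fixes z a :: complex and m D :: real
  assumes "\<bar>Im a\<bar> \<le> D" "m > 0" "Im z > 0" "D\<^sup>2 - m\<^sup>2 < (Im z)\<^sup>2"
  shows "norm (z - \<i> * of_real m - a) * norm (z - \<i> * of_real m - cnj a) < norm (z + \<i> * of_real m - a) * norm (z + \<i> * of_real m - cnj a)"
proof -
  obtain x y where z: "z = Complex x y" by (cases z)
  obtain u b where a: "a = Complex u b" by (cases a)
  have "b\<^sup>2 \<le> D\<^sup>2" using assms(1) by (simp add: a abs_le_square_iff[symmetric])
  then have "(x - u)\<^sup>2 + y\<^sup>2 - b\<^sup>2 + m\<^sup>2 > 0" using assms(4) zero_le_power2[of "x - u"] unfolding z complex.sel by linarith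
  then have pos: "16 * m * y * ((x - u)\<^sup>2 + y\<^sup>2 - b\<^sup>2 + m\<^sup>2) / 2 > 0" using assms(2,3) by (simp add: z)
  have n: "(norm (Complex p q))\<^sup>2 = p * p + q * q" for p q unfolding cmod_power2 by (simp add: power2_eq_square)
  have e: "z - \<i> * of_real m - a = Complex (x - u) (y - m - b)" "z - \<i> * of_real m - cnj a = Complex (x - u) (y - m + b)"
     "z + \<i> * of_real m - a = Complex (x - u) (y + m - b)" "z + \<i> * of_real m - cnj a = Complex (x - u) (y + m + b)"
    by (auto simp: z a complex_eq_iff)
  have "(norm (z + \<i> * of_real m - a) * norm (z + \<i> * of_real m - cnj a))\<^sup>2 - (norm (z - \<i> * of_real m - a) * norm (z - \<i> * of_real m - cnj a))\<^sup>2
     = 16 * m * y * ((x - u)\<^sup>2 + y\<^sup>2 - b\<^sup>2 + m\<^sup>2) / 2"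
    unfolding e power_mult_distrib n by (simp add: power2_eq_square algebra_simps)
  then have "(norm (z - \<i> * of_real m - a) * norm (z - \<i> * of_real m - cnj a))\<^sup>2 < (norm (z + \<i> * of_real m - a) * norm (z + \<i> * of_real m - cnj a))\<^sup>2"
    using pos by linarith
  then show ?thesis by (rule power2_less_imp_less) auto
qed

lemma prod_mset_strict_mono:
  fixes f g :: "'a \<Rightarrow> real"
  assumes "A \<noteq> {#}" "\<And>x. x \<in># A \<Longrightarrow> 0 \<le> g x \<and> g x < f x"
  shows "(\<Prod>x\<in>#A. g x) < (\<Prod>x\<in>#A. f x)"
  using assms
proof (induction A)
  case (add x A)
  have nn: "(\<Prod>x\<in>#A. g x) \<ge> 0" 
  proof -
    have "(\<forall>x\<in>#B. 0 \<le> g x) \<longrightarrow> (\<Prod>x\<in>#B. g x) \<ge> 0" for B by (induction B) auto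
    then show ?thesis using add.prems(2) by auto
  qed
  show ?case
  proof (cases "A = {#}")
    case False
    then have "(\<Prod>x\<in>#A. g x) < (\<Prod>x\<in>#A. f x)" using add by auto
    then show ?thesis using add.prems(2)[of x] nn by (auto intro!: mult_strict_mono)
  qed (use add in auto)
qed auto

text \<open>At a zero \<open>z\<close> of the shifted polynomial the values of \<open>p\<close> at
  \<open>z + \<i> * m\<close> and \<open>z - \<i> * m\<close> have equal norm. Above the new strip
  every conjugate pair contributes a strictly smaller factor at the lower point, which is a
  contradiction. The \<open>max 0\<close> covers shifts larger than \<open>D\<close>, after which
  all zeros are real.\<close>

lemma strip_poly_cosh_shift:
  assumes p: "strip_poly D p" and m: "m > 0"
  shows "strip_poly (sqrt (max 0 (D\<^sup>2 - m\<^sup>2))) (cosh_shift m p)"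
proof -
  let ?D = "sqrt (max 0 (D\<^sup>2 - m\<^sup>2))"
  have p0: "p \<noteq> 0" and sym: "\<And>z. poly p (cnj z) = cnj (poly p z)" and roots: "\<And>z. poly p z = 0 \<Longrightarrow> \<bar>Im z\<bar> \<le> D"
    using p by (auto simp: strip_poly_def)
  obtain A where A: "p = smult (lead_coeff p) (\<Prod>x\<in>#A. [:-x, 1:])" using alg_closed_imp_factorization[OF p0] by blast
  define c where "c = lead_coeff p"
  have c0: "c \<noteq> 0" using p0 by (simp add: c_def)
  have pe: "poly p z = c * (\<Prod>x\<in>#A. z - x)" for z
    by (subst A) (simp add: c_def poly_prod_mset image_mset.compositionality o_def)
  have rt: "\<bar>Im x\<bar> \<le> D" if "x \<in># A" for x
    using roots[of x] that by (auto simp: pe prod_mset_zero_iff)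
  have nrm: "norm (\<Prod>x\<in>#A. f x) = (\<Prod>x\<in>#A. norm (f x))" for f :: "complex \<Rightarrow> complex"
    by (induction A) (auto simp: norm_mult)
  \<comment> \<open>The factor at \<open>cnj x\<close> comes from
    \<open>norm (poly p w) = norm (poly p (cnj w))\<close>. Zeros are thus paired with conjugates
    without showing that the multiset \<open>A\<close> is symmetric.\<close>
  have sq: "norm (poly p w) * norm (poly p w) = norm c * norm c * (\<Prod>x\<in>#A. norm (w - x) * norm (w - cnj x))" for w
  proof -
    have "norm (poly p w) = norm (poly p (cnj w))" by (simp add: sym)
    also have "\<dots> = norm c * (\<Prod>x\<in>#A. norm (cnj w - x))" by (simp add: pe norm_mult nrm)
    also have "(\<lambda>x. norm (cnj w - x)) = (\<lambda>x. norm (w - cnj x))"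
    proof
      fix x show "norm (cnj w - x) = norm (w - cnj x)"
        by (metis complex_cnj_cnj complex_cnj_diff complex_mod_cnj)
    qed
    finally have e1: "norm (poly p w) = norm c * (\<Prod>x\<in>#A. norm (w - cnj x))" .
    have e2: "norm (poly p w) = norm c * (\<Prod>x\<in>#A. norm (w - x))" by (simp add: pe norm_mult nrm)
    from arg_cong2[where f="(*)", OF e2 e1] show ?thesis by (simp only: prod_mset.distrib mult_ac)
  qed
  have nz: "poly (cosh_shift m p) z \<noteq> 0" if z: "Im z > ?D" for z
  proof
    assume 0: "poly (cosh_shift m p) z = 0"
    then have sum0: "poly p (z + \<i> * of_real m) + poly p (z - \<i> * of_real m) = 0" by (simp add: poly_cosh_shift)
    then have neq: "norm (poly p (z + \<i> * of_real m)) = norm (poly p (z - \<i> * of_real m))"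
      by (metis add_eq_0_iff norm_minus_cancel)
    show False
    \<comment> \<open>The comparison of products is strict only for a nonempty product; without
      zeros both summands equal \<open>c\<close>.\<close>
    proof (cases "A = {#}")
      case True
      then show False using sum0 c0 by (simp add: pe)
    next
      case False
      have "0 \<le> ?D" by simp
      then have z0: "Im z > 0" using z by linarith
      have "max 0 (D\<^sup>2 - m\<^sup>2) < (Im z)\<^sup>2"
        using power_strict_mono[OF z, of 2] by simp
      then have z2: "D\<^sup>2 - m\<^sup>2 < (Im z)\<^sup>2" by simp
      have "(\<Prod>x\<in>#A. norm (z - \<i> * of_real m - x) * norm (z - \<i> * of_real m - cnj x)) < (\<Prod>x\<in>#A. norm (z + \<i> * of_real m - x) * norm (z + \<i> * of_real m - cnj x))"
        by (rule prod_mset_strict_mono[OF False]) (use norm_shift_pair_less[OF rt m z0 z2] in auto)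
      then have "norm c * norm c * (\<Prod>x\<in>#A. norm (z - \<i> * of_real m - x) * norm (z - \<i> * of_real m - cnj x))
          < norm c * norm c * (\<Prod>x\<in>#A. norm (z + \<i> * of_real m - x) * norm (z + \<i> * of_real m - cnj x))"
        using c0 by (intro mult_strict_left_mono) auto
      then show False using neq unfolding sq[symmetric] by simp
    qed
  qed
  have sym': "poly (cosh_shift m p) (cnj z) = cnj (poly (cosh_shift m p) z)" for z
    using sym[of "z + \<i> * of_real m"] sym[of "z - \<i> * of_real m"] by (simp add: poly_cosh_shift)
  have "\<bar>Im z\<bar> \<le> ?D" if "poly (cosh_shift m p) z = 0" for z
  proof (rule ccontr)
    assume "\<not> \<bar>Im z\<bar> \<le> ?D"
    then have "Im z > ?D \<or> Im (cnj z) > ?D" by (auto simp: abs_if split: if_splits)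
    then show False using nz[of z] nz[of "cnj z"] that by (auto simp: sym')
  qed
  moreover have "cosh_shift m p \<noteq> 0" using nz[of "Complex 0 (?D + 1)"] by fastforce
  ultimately show ?thesis using sym' by (auto simp: strip_poly_def)
qed

text \<open>Hurwitz's theorem concerns nonconstant limits; the witness \<open>z1\<close> settles the
  constant case.\<close>

lemma hurwitz_nonzero:
  assumes S: "open S" "connected S" and hol: "\<And>n::nat. P n holomorphic_on S" "g holomorphic_on S"
    and ul: "\<And>K. compact K \<Longrightarrow> K \<subseteq> S \<Longrightarrow> uniform_limit K P g sequentially"
    and nz: "\<And>n z. z \<in> S \<Longrightarrow> P n z \<noteq> 0" and z1: "z1 \<in> S" "g z1 \<noteq> 0" and z: "z \<in> S"
  shows "g z \<noteq> 0"
proof (cases "g constant_on S")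
  case True
  then show ?thesis using z z1 by (metis constant_on_def)
next
  case False
  then show ?thesis using Hurwitz_no_zeros[OF S hol ul False nz z] by blast
qed

text \<open>For \<open>D = 0\<close> this is the Laguerre-Polya class. The zero function is a
  member, as a limit of constants, so statements about zeros need points where the limit does not
  vanish.\<close>

definition strip_limit :: "real \<Rightarrow> (complex \<Rightarrow> complex) \<Rightarrow> bool" where
  "strip_limit D F \<longleftrightarrow> (\<exists>p. (\<forall>n. strip_poly D (p n)) \<and> (\<forall>r. uniform_limit (cball 0 r) (\<lambda>n. poly (p n)) F sequentially))"

lemma strip_limit_holomorphic:
  assumes "strip_limit D F" shows "F holomorphic_on UNIV"
proof -
  obtain p where p: "\<And>r. uniform_limit (cball 0 r) (\<lambda>n. poly (p n)) F sequentially"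
    using assms by (auto simp: strip_limit_def)
  show ?thesis
  proof (rule holomorphic_uniform_sequence[of _ "\<lambda>n. poly (p n)"])
    fix x :: complex
    show "\<exists>d>0. cball x d \<subseteq> UNIV \<and> uniform_limit (cball x d) (\<lambda>n. poly (p n)) F sequentially"
    proof (intro exI[of _ 1] conjI uniform_limit_on_subset[OF p[of "norm x + 1"]])
      show "cball x 1 \<subseteq> cball 0 (norm x + 1)"
      proof
        fix y assume "y \<in> cball x 1"
        then show "y \<in> cball 0 (norm x + 1)"
          using norm_triangle_sub[of y x] by (simp add: dist_norm norm_minus_commute)
      qed
    qed auto
  qed (auto intro!: holomorphic_intros)
qed

lemma strip_limit_cosh_shift:
  assumes F: "strip_limit D F" and m: "m > 0"
  shows "strip_limit (sqrt (max 0 (D\<^sup>2 - m\<^sup>2))) (\<lambda>z. (F (z + \<i> * of_real m) + F (z - \<i> * of_real m)) / 2)"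
proof -
  obtain p where p: "\<And>n. strip_poly D (p n)" "\<And>r. uniform_limit (cball 0 r) (\<lambda>n. poly (p n)) F sequentially"
    using F by (auto simp: strip_limit_def)
  have "uniform_limit (cball 0 r) (\<lambda>n. poly (cosh_shift m (p n))) (\<lambda>z. (F (z + \<i> * of_real m) + F (z - \<i> * of_real m)) / 2) sequentially" for r
  proof -
    have 1: "uniform_limit (cball 0 r) (\<lambda>n z. poly (p n) (z + \<i> * of_real m)) (\<lambda>z. F (z + \<i> * of_real m)) sequentially"
      by (rule uniform_limit_compose'[OF p(2)[of "r + m"]])
         (use m in \<open>auto simp: norm_mult intro!: order_trans[OF norm_triangle_ineq]\<close>)
    have 2: "uniform_limit (cball 0 r) (\<lambda>n z. poly (p n) (z - \<i> * of_real m)) (\<lambda>z. F (z - \<i> * of_real m)) sequentially"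
      by (rule uniform_limit_compose'[OF p(2)[of "r + m"]])
         (use m in \<open>auto simp: norm_mult intro!: order_trans[OF norm_triangle_ineq4]\<close>)
    have "uniform_limit (cball 0 r) (\<lambda>n z. (1/2) * (poly (p n) (z + \<i> * of_real m) + poly (p n) (z - \<i> * of_real m)))
        (\<lambda>z. (1/2) * (F (z + \<i> * of_real m) + F (z - \<i> * of_real m))) sequentially"
      by (intro uniform_limit_intros 1 2)
    then show ?thesis by (simp add: poly_cosh_shift[abs_def])
  qed
  then show ?thesis unfolding strip_limit_def using strip_poly_cosh_shift[OF p(1) m] by (intro exI[of _ "\<lambda>n. cosh_shift m (p n)"]) auto
qed

lemma strip_limit_cosh_shift_funpow:
  assumes F: "strip_limit D F" and m: "m > 0" and D: "D \<ge> 0"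
  shows "strip_limit (sqrt (max 0 (D\<^sup>2 - real n * m\<^sup>2))) (((\<lambda>F z. (F (z + \<i> * of_real m) + F (z - \<i> * of_real m)) / 2) ^^ n) F)"
proof (induction n)
  case 0
  then show ?case using F D by simp
next
  case (Suc n)
  have "max 0 (max 0 a - b) = max 0 (a - b)" if "b \<ge> 0" for a b :: real using that by (auto simp: max_def)
  from this[of "m\<^sup>2" "D\<^sup>2 - real n * m\<^sup>2"]
  have "max 0 (max 0 (D\<^sup>2 - real n * m\<^sup>2) - m\<^sup>2) = max 0 (D\<^sup>2 - real (Suc n) * m\<^sup>2)"
    by (simp add: algebra_simps)
  then show ?case using strip_limit_cosh_shift[OF Suc m] by simp
qed

text \<open>The approximants vanish only on the real axis. Its complement has two components, so
  Hurwitz's theorem is applied in each half-plane with a witness of its own.\<close>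

lemma strip_limit_real_zeros:
  assumes F: "strip_limit 0 F" and z1: "Im z1 > 0" "F z1 \<noteq> 0" and z2: "Im z2 < 0" "F z2 \<noteq> 0" and z: "F z = 0"
  shows "Im z = 0"
proof (rule ccontr)
  assume "Im z \<noteq> 0"
  obtain p where p: "\<And>n. strip_poly 0 (p n)" "\<And>r. uniform_limit (cball 0 r) (\<lambda>n. poly (p n)) F sequentially"
    using F by (auto simp: strip_limit_def)
  have nz: "poly (p n) z \<noteq> 0" if "Im z \<noteq> 0" for n z using p(1)[of n] that by (auto simp: strip_poly_def)
  have ul: "uniform_limit K (\<lambda>n. poly (p n)) F sequentially" if "compact K" for K
  proof -
    obtain r where "K \<subseteq> cball 0 r" using compact_imp_bounded[OF \<open>compact K\<close>] by (auto simp: bounded_iff subset_iff)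
    then show ?thesis using p(2) uniform_limit_on_subset by blast
  qed
  have hol: "F holomorphic_on S" "poly (p n) holomorphic_on S" for S n
    using strip_limit_holomorphic[OF F] by (auto intro: holomorphic_on_subset holomorphic_intros)
  consider "Im z > 0" | "Im z < 0" using \<open>Im z \<noteq> 0\<close> by linarith
  then show False
  proof cases
    case 1
    have "F z \<noteq> 0"
      by (rule hurwitz_nonzero[of "{z. Im z > 0}" "\<lambda>n. poly (p n)" F z1 z])
         (use 1 z1 nz ul hol in \<open>auto simp: open_halfspace_Im_gt intro!: convex_connected convex_halfspace_Im_gt\<close>)
    then show False using z by simp
  next
    case 2
    have "F z \<noteq> 0"
      by (rule hurwitz_nonzero[of "{z. Im z < 0}" "\<lambda>n. poly (p n)" F z2 z])
         (use 2 z2 nz ul hol in \<open>auto simp: open_halfspace_Im_lt intro!: convex_connected convex_halfspace_Im_lt\<close>)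
    then show False using z by simp
  qed
qed

section \<open>Zeta without zeros to the right of one, and Gamma integrals\<close>

lemma summable_zeta_terms:
  assumes "1 < Re s"
  shows "summable (\<lambda>n. norm (1 / of_nat n powr s))"
proof -
  have "summable (\<lambda>n. real n powr (- Re s))" using assms by (subst summable_real_powr_iff) simp
  moreover have "norm (1 / of_nat n powr s) = real n powr (- Re s)" for n
    by (cases "n = 0") (auto simp: norm_divide norm_powr_real_powr powr_minus field_simps)
  ultimately show ?thesis by simp
qed

text \<open>Sieving by a prime \<open>p\<close> multiplies the sum by \<open>1 - p\<^bsup>-s\<^esup>\<close>, so that a zero would persist; but sieving by
  all primes up to \<open>N\<close> leaves 1 plus a tail of an absolutely convergent series.\<close>

lemma zeta_series_nonzero:
  assumes s: "1 < Re s"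
  shows "zeta_series s \<noteq> 0"
proof
  assume z0: "zeta_series s = 0"
  define f where "f n = 1 / (of_nat n powr s :: complex)" for n :: nat
  have f0: "f 0 = 0" and f1: "f 1 = 1" by (auto simp: f_def)
  have fm: "f (p * m) = f p * f m" for p m
    by (simp add: f_def powr_times_real)
  have sn: "summable (\<lambda>n. norm (f n))" unfolding f_def by (rule summable_zeta_terms[OF s])
  have abs: "(\<lambda>n. norm (f n)) summable_on A" for A
    using sn norm_summable_imp_summable_on[of "\<lambda>n. norm (f n)"] by (auto intro: summable_on_subset_banach)
  then have so: "f summable_on A" for A by (rule abs_summable_summable)
  define A where "A N = {n::nat. n \<ge> 1 \<and> (\<forall>p. prime p \<longrightarrow> p \<le> N \<longrightarrow> \<not> p dvd n)}" for N :: nat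
  have A0: "infsum f (A 0) = 0"
  proof -
    have "zeta_series s = (\<Sum>n. f (Suc n))" by (simp add: zeta_series_def f_def)
    also have "\<dots> = (\<Sum>n. f n)" using suminf_split_head[OF summable_norm_cancel[OF sn]] f0 by simp
    also have "\<dots> = infsum f UNIV"
      using norm_summable_imp_has_sum[OF sn summable_sums[OF summable_norm_cancel[OF sn]]] by (simp add: infsumI)
    also have "\<dots> = infsum f (A 0)"
      by (rule infsum_cong_neutral) (auto simp: A_def f0 not_le)
    finally show ?thesis using z0 by simp
  qed
  have AN: "infsum f (A N) = 0" for N
  proof (induction N)
    case (Suc N)
    show ?case
    proof (cases "prime (Suc N)")
      case False
      then have "A (Suc N) = A N" by (auto simp: A_def le_Suc_eq)
      then show ?thesis using Suc by simp
    next
      case True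
      let ?p = "Suc N"
      \<comment> \<open>The multiples of \<open>?p\<close> in \<open>A N\<close> are
        \<open>?p\<close> times the elements of \<open>A N\<close>, since the factor
        \<open>?p\<close> brings in no prime up to \<open>N\<close>. Summing \<open>f\<close> gives
        S = S' + f(p) S, where S' is the sum over \<open>A ?p\<close>, so a vanishing sum stays
        zero.\<close>
      have split: "A N = A ?p \<union> (*) ?p ` A N"
      proof (intro equalityI subsetI)
        fix n assume n: "n \<in> A N"
        show "n \<in> A ?p \<union> (*) ?p ` A N"
        proof (cases "?p dvd n")
          case True
          then obtain m where m: "n = ?p * m" by (elim dvdE)
          have "n \<noteq> 0" using n by (auto simp: A_def)
          then have "m \<noteq> 0" using m by (cases m) auto
          moreover have "\<not> q dvd m" if "prime q" "q \<le> N" for q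
            using n that dvd_mult[of q m ?p] unfolding m A_def by blast
          ultimately have "m \<in> A N" by (auto simp: A_def)
          then show ?thesis using m by blast
        next
          case False
          then show ?thesis using n by (auto simp: A_def le_Suc_eq)
        qed
      next
        fix n assume "n \<in> A ?p \<union> (*) ?p ` A N"
        then show "n \<in> A N"
        proof
          assume "n \<in> (*) ?p ` A N"
          then obtain m where m: "n = ?p * m" "m \<in> A N" by blast
          have "\<not> q dvd n" if q: "prime q" "q \<le> N" for q
          proof
            assume "q dvd n"
            then have "q dvd ?p \<or> q dvd m" using m q prime_dvd_mult_iff by blast
            moreover have "\<not> q dvd ?p" using primes_dvd_imp_eq[OF q(1) True] q by auto
            ultimately show False using m(2) q by (auto simp: A_def)
          qed
          then show ?thesis using m by (auto simp: A_def)
        qed (auto simp: A_def)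
      qed
      have "\<not> ?p dvd n" if "n \<in> A ?p" for n using True that unfolding A_def by blast
      then have disj: "A ?p \<inter> (*) ?p ` A N = {}" using dvd_triv_left by blast
      have "infsum f (A N) = infsum f (A ?p) + infsum f ((*) ?p ` A N)"
        by (subst split, rule infsum_Un_disjoint[OF so so disj])
      also have "infsum f ((*) ?p ` A N) = infsum (f \<circ> (*) ?p) (A N)"
        by (rule infsum_reindex) (simp add: inj_on_def del: mult_Suc)
      also have "\<dots> = f ?p * infsum f (A N)"
        by (simp add: o_def fm infsum_cmult_right' del: mult_Suc)
      finally show ?thesis using Suc by simp
    qed
  qed (rule A0)
  \<comment> \<open>Every element of \<open>A N\<close> other than 1 has a prime factor above
    \<open>N\<close> and so exceeds \<open>N\<close>. As the sum over \<open>A N\<close> vanishes,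
    the tail beyond \<open>N\<close> has to compensate the term 1.\<close>
  have tail: "1 \<le> (\<Sum>n. norm (f n)) - (\<Sum>n<Suc N. norm (f n))" if N: "N \<ge> 1" for N
  proof -
    have 1: "1 \<in> A N" by (auto simp: A_def)
    have "A N = insert 1 (A N - {1})" using 1 by blast
    then have "infsum f (A N) = f 1 + infsum f (A N - {1})"
      using infsum_Un_disjoint[OF so so, of "{1}" "A N - {1}"] by simp
    then have "infsum f (A N - {1}) = - 1" using AN f1 by (simp add: add_eq_0_iff)
    then have "1 = norm (infsum f (A N - {1}))" by simp
    also have "\<dots> \<le> infsum (\<lambda>n. norm (f n)) (A N - {1})" by (rule norm_infsum_bound[OF abs])
    also have "\<dots> \<le> infsum (\<lambda>n. norm (f n)) {Suc N..}"
    proof (rule infsum_mono_neutral)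
      fix n assume "n \<in> (A N - {1}) - {Suc N..}"
      then have n: "n \<in> A N" "n \<noteq> 1" "n \<le> N" by auto
      then obtain p where "prime p" "p dvd n" using prime_factor_nat by blast
      moreover then have "p \<le> N" using n dvd_imp_le[of p n] by (auto simp: A_def)
      ultimately show "norm (f n) \<le> 0" using n by (auto simp: A_def)
    qed (use abs in auto)
    also have "\<dots> = (\<Sum>n. norm (f n)) - (\<Sum>n<Suc N. norm (f n))"
    proof -
      have "infsum (\<lambda>n. norm (f n)) UNIV = infsum (\<lambda>n. norm (f n)) {..<Suc N} + infsum (\<lambda>n. norm (f n)) {Suc N..}"
        by (subst infsum_Un_disjoint[symmetric]) (use abs in \<open>auto intro!: arg_cong[where f="infsum _"]\<close>)
      moreover have "infsum (\<lambda>n. norm (f n)) UNIV = (\<Sum>n. norm (f n))"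
        using norm_summable_imp_has_sum[of "\<lambda>n. norm (f n)"] sn summable_sums[OF sn] by (simp add: infsumI)
      ultimately show ?thesis by simp
    qed
    finally show ?thesis .
  qed
  have "(\<lambda>N. (\<Sum>n. norm (f n)) - (\<Sum>n<Suc N. norm (f n))) \<longlonglongrightarrow> (\<Sum>n. norm (f n)) - (\<Sum>n. norm (f n))"
    by (intro tendsto_intros LIMSEQ_Suc summable_LIMSEQ sn)
  then have "eventually (\<lambda>N. (\<Sum>n. norm (f n)) - (\<Sum>n<Suc N. norm (f n)) < 1) sequentially"
    by (rule order_tendstoD(2)) simp
  then obtain N where "\<And>M. M \<ge> N \<Longrightarrow> (\<Sum>n. norm (f n)) - (\<Sum>n<Suc M. norm (f n)) < 1" by (auto simp: eventually_sequentially)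
  from this[of "max N 1"] tail[of "max N 1"] show False by simp
qed

text \<open>Serves twice: with \<open>c = 2\<close> for Gamma integrals in the variable of the
  kernel, and with \<open>A = c = 1\<close> for the passage from \<open>x\<close> to
  \<open>ln x\<close> in \<open>F_fun\<close>.\<close>

lemma exp_change_of_variables:
  fixes f :: "real \<Rightarrow> complex" and A c :: real
  assumes [measurable]: "f \<in> borel_measurable borel" and A: "A > 0" and c: "c > 0"
  shows "set_integrable lborel {0<..} f \<longleftrightarrow> integrable lborel (\<lambda>u. complex_of_real (A * c * exp (c * u)) * f (A * exp (c * u)))" (is "?L \<longleftrightarrow> ?R")
    and "(LINT x:{0<..}|lborel. f x) = (LINT u|lborel. complex_of_real (A * c * exp (c * u)) * f (A * exp (c * u)))"
proof -
  let ?g = "\<lambda>u. A * exp (c * u)" and ?h = "\<lambda>u. A * c * exp (c * u)"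
  let ?F = "\<lambda>u. \<bar>?h u\<bar> *\<^sub>R f (?g u)"
  have F: "?F = (\<lambda>u. complex_of_real (A * c * exp (c * u)) * f (A * exp (c * u)))"
    using A c by (auto simp: scaleR_conv_of_real abs_mult)
  have img: "?g ` UNIV = {0<..}"
  proof (intro equalityI subsetI)
    fix x :: real assume "x \<in> {0<..}"
    then have "x = ?g (ln (x / A) / c)" using A c by simp
    then show "x \<in> ?g ` UNIV" by blast
  qed (use A in auto)
  have d: "(?g has_field_derivative ?h u) (at u within UNIV)" for u
    by (auto intro!: derivative_eq_intros)
  have inj: "inj_on ?g UNIV" using A c by (auto simp: inj_on_def)
  note cv = has_absolute_integral_change_of_variables_real[of UNIV ?g ?h f, OF _ d inj, unfolded img]
  have LL: "f absolutely_integrable_on {0<..} \<longleftrightarrow> ?L"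
    unfolding set_integrable_def by (subst integrable_completion) auto
  have RR: "?F absolutely_integrable_on UNIV \<longleftrightarrow> integrable lborel ?F"
    unfolding set_integrable_def by (subst integrable_completion) auto
  show iff: "?L \<longleftrightarrow> ?R"
    using cv[of "integral {0<..} f"] cv[of "integral UNIV ?F"] LL RR unfolding F by auto
  show "(LINT x:{0<..}|lborel. f x) = (LINT u|lborel. complex_of_real (A * c * exp (c * u)) * f (A * exp (c * u)))"
  proof (cases ?L)
    case True
    then have R: "integrable lborel ?F" using iff F by simp
    have "(LINT x:{0<..}|lborel. f x) = integral {0<..} f" using set_borel_integral_eq_integral(2)[OF True] .
    also have "\<dots> = integral UNIV ?F" using cv[of "integral {0<..} f"] True LL by auto
    also have "\<dots> = integral\<^sup>L lborel ?F" by (rule integral_lborel[OF R])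
    finally show ?thesis by (simp only: F)
  next
    \<comment> \<open>Neither side is integrable, so both integrals have the default value
      0.\<close>
    case False
    then show ?thesis using iff by (simp add: set_lebesgue_integral_def set_integrable_def not_integrable_integral_eq)
  qed
qed

text \<open>The substitution \<open>x = A * exp (2 * u)\<close> in Euler's integral for
  \<open>Gamma t\<close>.\<close>

lemma gamma_exp_integral:
  assumes A: "A > 0" and t: "Re t > 0"
  shows "integrable lborel (\<lambda>u. exp (2 * t * complex_of_real u) * complex_of_real (exp (- A * exp (2 * u))))" (is "integrable _ ?k")
    and "(LINT u|lborel. exp (2 * t * complex_of_real u) * complex_of_real (exp (- A * exp (2 * u)))) = of_real A powr (- t) * Gamma t / 2"
proof -
  define f where "f x = complex_of_real x powr (t - 1) / of_real (exp x)" for x :: real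
  have [measurable]: "f \<in> borel_measurable borel" unfolding f_def by measurable
  have fi: "set_integrable lborel {0<..} f"
    using absolutely_integrable_Gamma_integral'[OF t] unfolding f_def[symmetric] set_integrable_def
    by (subst (asm) integrable_completion) auto
  have val: "(LINT x:{0<..}|lborel. f x) = Gamma t"
    unfolding set_borel_integral_eq_integral(2)[OF fi]
    using Gamma_integral_complex'[OF t] unfolding f_def[symmetric] by (rule integral_unique)
  have eq: "complex_of_real (A * 2 * exp (2 * u)) * f (A * exp (2 * u)) = (2 * of_real A powr t) * ?k u" for u
  proof -
    let ?x = "A * exp (2 * u)"
    have x: "?x > 0" using A by simp
    have "of_real ?x powr t = of_real A powr t * exp (2 * t * of_real u)"
      using A by (simp add: powr_def exp_add ln_mult Ln_of_real algebra_simps flip: of_real_mult exp_of_real of_real_exp) (simp add: mult_ac)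
    moreover have "of_real ?x powr (t - 1) = of_real ?x powr t / of_real ?x"
      using x by (subst powr_diff) (auto simp del: of_real_mult)
    ultimately have "of_real ?x * of_real ?x powr (t - 1) = of_real A powr t * exp (2 * t * of_real u)"
      using x by (simp del: of_real_mult)
    then show ?thesis unfolding f_def by (simp add: exp_minus field_simps)
  qed
  have nz: "2 * of_real A powr t \<noteq> 0" using A by simp
  have "integrable lborel (\<lambda>u. (2 * of_real A powr t) * ?k u)"
    using exp_change_of_variables(1)[of f A 2] A fi unfolding eq by simp
  then have "integrable lborel (\<lambda>u. inverse (2 * of_real A powr t) * ((2 * of_real A powr t) * ?k u))"
    by (rule integrable_mult_right)
  moreover have "inverse (2 * of_real A powr t) * ((2 * of_real A powr t) * y) = y" for y using nz by simp
  ultimately show "integrable lborel ?k" by (simp only:)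
  have "Gamma t = (2 * of_real A powr t) * (LINT u|lborel. ?k u)"
    using exp_change_of_variables(2)[of f A 2] A val unfolding eq by (simp only: integral_mult_right_zero) simp
  then show "(LINT u|lborel. ?k u) = of_real A powr (- t) * Gamma t / 2"
    using nz by (simp add: powr_minus field_simps)
qed

section \<open>The theorem of de Bruijn\<close>

text \<open>The product \<open>cosh y * exp (- y^2 / 2)\<close> decreases for
  \<open>y \<ge> 0\<close> because \<open>sinh y \<le> y * cosh y\<close>. With
  \<open>m^2 = 2 * l / n\<close> it follows that \<open>cosh (m * u) ^ n\<close> is at most
  \<open>exp (l * u^2)\<close>, the domination needed for the limit in \<open>n\<close>.\<close>

lemma cosh_le_exp_half_square: "cosh x \<le> exp (x\<^sup>2 / 2)" for x :: real
proof -
  have pos: "cosh x \<le> exp (x\<^sup>2 / 2)" if x: "x \<ge> 0" for x :: real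
  proof -
    have s: "sinh y \<le> y * cosh y" if "y \<ge> 0" for y :: real
    proof -
      have "(\<lambda>y. y * cosh y - sinh y) 0 \<le> (\<lambda>y. y * cosh y - sinh y) y"
      proof (rule DERIV_nonneg_imp_nondecreasing[OF that])
        fix t :: real assume "0 \<le> t" "t \<le> y"
        moreover have "((\<lambda>y. y * cosh y - sinh y) has_real_derivative t * sinh t) (at t)"
          by (auto intro!: derivative_eq_intros)
        ultimately show "\<exists>d. ((\<lambda>y. y * cosh y - sinh y) has_real_derivative d) (at t) \<and> 0 \<le> d"
          by (intro exI[of _ "t * sinh t"]) auto
      qed
      then show ?thesis by simp
    qed
    have "(\<lambda>y. cosh y * exp (- (y\<^sup>2 / 2))) x \<le> (\<lambda>y. cosh y * exp (- (y\<^sup>2 / 2))) 0"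
    proof (rule DERIV_nonpos_imp_nonincreasing[OF x])
      fix t :: real assume t: "0 \<le> t" "t \<le> x"
      have "((\<lambda>y. cosh y * exp (- (y\<^sup>2 / 2))) has_real_derivative (sinh t - t * cosh t) * exp (- (t\<^sup>2 / 2))) (at t)"
        by (auto intro!: derivative_eq_intros simp: algebra_simps)
      moreover have "(sinh t - t * cosh t) * exp (- (t\<^sup>2 / 2)) \<le> 0"
        using s[OF t(1)] by (intro mult_nonpos_nonneg) auto
      ultimately show "\<exists>d. ((\<lambda>y. cosh y * exp (- (y\<^sup>2 / 2))) has_real_derivative d) (at t) \<and> d \<le> 0" by blast
    qed
    then show ?thesis by (simp add: exp_minus field_simps)
  qed
  show ?thesis using pos[of x] pos[of "- x"] by (cases "x \<ge> 0") auto
qed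

lemma cosh_power_tendsto_exp:
  fixes l u :: real
  assumes l: "l > 0"
  shows "(\<lambda>n. cosh (sqrt (2 * l / real (Suc n)) * u) ^ Suc n) \<longlonglongrightarrow> exp (l * u\<^sup>2)"
proof (cases "u = 0")
  case False
  let ?x = "\<lambda>n. sqrt (2 * l / real (Suc n)) * u"
  \<comment> \<open>This limit fixes the size of the shift: \<open>n * ln (cosh x)\<close> tends to
    \<open>l * u^2\<close> when \<open>x^2 = 2 * l * u^2 / n\<close>.\<close>
  have "((\<lambda>x::real. ln (cosh x) / x\<^sup>2) \<longlongrightarrow> 1/2) (at 0)" by real_asymp
  moreover have "filterlim ?x (at 0) sequentially"
  proof (rule filterlim_atI)
    have "(\<lambda>n. 2 * l / real (Suc n)) \<longlonglongrightarrow> 0" by real_asymp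
    then have "(\<lambda>n. sqrt (2 * l / real (Suc n)) * u) \<longlonglongrightarrow> sqrt 0 * u" by (intro tendsto_intros)
    then show "?x \<longlonglongrightarrow> 0" by simp
  qed (use l False in auto)
  ultimately have L: "(\<lambda>n. ln (cosh (?x n)) / (?x n)\<^sup>2) \<longlonglongrightarrow> 1/2" by (rule filterlim_compose)
  have "(\<lambda>n. exp (ln (cosh (?x n)) / (?x n)\<^sup>2 * (2 * l * u\<^sup>2))) \<longlonglongrightarrow> exp (1/2 * (2 * l * u\<^sup>2))"
    by (rule tendsto_exp[OF tendsto_mult[OF L tendsto_const]])
  moreover have "exp (ln (cosh (?x n)) / (?x n)\<^sup>2 * (2 * l * u\<^sup>2)) = cosh (?x n) ^ Suc n" for n
  proof -
    have "(?x n)\<^sup>2 = 2 * l * u\<^sup>2 / real (Suc n)" using l by (simp add: power_mult_distrib)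
    then have "ln (cosh (?x n)) / (?x n)\<^sup>2 * (2 * l * u\<^sup>2) = real (Suc n) * ln (cosh (?x n))"
      using l False by (simp add: field_simps del: of_nat_Suc)
    then show ?thesis by (simp only: exp_of_nat_mult exp_ln[OF cosh_real_pos])
  qed
  ultimately show ?thesis by simp
qed simp

text \<open>Decay beyond every Gaussian. The class is stable under factors such as
  \<open>exp (l * u^2)\<close> and \<open>cosh (m * u)\<close>, and its transforms are
  entire.\<close>

definition gauss_weight :: "(real \<Rightarrow> real) \<Rightarrow> bool" where
  "gauss_weight w \<longleftrightarrow> w \<in> borel_measurable borel \<and> (\<forall>M. integrable lborel (\<lambda>u. w u * exp (M * u\<^sup>2)))"

lemma gauss_weight_measurable: "gauss_weight w \<Longrightarrow> w \<in> borel_measurable borel"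
  by (simp add: gauss_weight_def)

lemma exp_abs_le_exp_square: "exp (M * \<bar>u\<bar>) \<le> exp (M\<^sup>2) * exp (u\<^sup>2)" for M u :: real
proof -
  have "0 \<le> (M - \<bar>u\<bar>)\<^sup>2" "0 \<le> M\<^sup>2" "0 \<le> u\<^sup>2" by simp_all
  then have "M * \<bar>u\<bar> \<le> M\<^sup>2 + u\<^sup>2" unfolding power2_diff power2_abs by linarith
  then show ?thesis by (simp flip: exp_add)
qed

lemma gauss_weight_integrable_mult:
  fixes E :: "real \<Rightarrow> 'b :: {banach, second_countable_topology, real_normed_algebra_1}"
  assumes w: "gauss_weight w" and [measurable]: "E \<in> borel_measurable borel" and le: "\<And>u. norm (E u) \<le> C * exp (M * u\<^sup>2)"
  shows "integrable lborel (\<lambda>u. of_real (w u) * E u)"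
proof -
  have [measurable]: "w \<in> borel_measurable borel" by (rule gauss_weight_measurable[OF w])
  have "integrable lborel (\<lambda>u. C * norm (w u * exp (M * u\<^sup>2)))" using w by (auto simp: gauss_weight_def)
  then show ?thesis
  proof (rule Bochner_Integration.integrable_bound)
    show "AE u in lborel. norm (of_real (w u) * E u) \<le> norm (C * norm (w u * exp (M * u\<^sup>2)))"
    proof (intro AE_I2)
      fix u
      have "norm (of_real (w u) * E u) \<le> \<bar>w u\<bar> * norm (E u)" using norm_mult_ineq[of "of_real (w u)" "E u"] by simp
      also have "\<dots> \<le> \<bar>w u\<bar> * (C * exp (M * u\<^sup>2))" by (intro mult_left_mono le) auto
      also have "\<dots> = C * (\<bar>w u\<bar> * exp (M * u\<^sup>2))" by (simp add: mult_ac)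
      also have "\<dots> \<le> \<bar>C\<bar> * (\<bar>w u\<bar> * exp (M * u\<^sup>2))" by (intro mult_right_mono) auto
      also have "\<dots> = norm (C * norm (w u * exp (M * u\<^sup>2)))" by (simp add: abs_mult)
      finally show "norm (of_real (w u) * E u) \<le> norm (C * norm (w u * exp (M * u\<^sup>2)))" .
    qed
  qed measurable
qed

lemma gauss_weight_mult:
  assumes w: "gauss_weight w" and [measurable]: "g \<in> borel_measurable borel" and le: "\<And>u. \<bar>g u\<bar> \<le> exp (K * u\<^sup>2)"
  shows "gauss_weight (\<lambda>u. w u * g u)"
proof -
  have [measurable]: "w \<in> borel_measurable borel" by (rule gauss_weight_measurable[OF w])
  have "integrable lborel (\<lambda>u. of_real (w u) * (g u * exp (M * u\<^sup>2)))" for M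
  proof (rule gauss_weight_integrable_mult[OF w, where C=1 and M="K + M"])
    fix u show "norm (g u * exp (M * u\<^sup>2)) \<le> 1 * exp ((K + M) * u\<^sup>2)"
      using mult_right_mono[OF le[of u], of "exp (M * u\<^sup>2)"] by (simp add: abs_mult distrib_right exp_add)
  qed measurable
  then show ?thesis by (simp add: gauss_weight_def mult.assoc)
qed

lemma gauss_weight_fourier_integrable:
  assumes w: "gauss_weight w"
  shows "integrable lborel (\<lambda>u. complex_of_real (w u) * exp (\<i> * z * complex_of_real u))"
  by (rule gauss_weight_integrable_mult[OF w, where C="exp ((norm z)\<^sup>2)" and M=1])
     (auto intro: order_trans[OF norm_exp_i_le exp_abs_le_exp_square] simp del: norm_exp_eq_Re)

lemma gauss_weight_entire:
  assumes w: "gauss_weight w"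
  shows "fourier_laplace (\<lambda>u. complex_of_real (w u)) holomorphic_on UNIV"
proof (rule fourier_laplace_entire)
  have [measurable]: "w \<in> borel_measurable borel" by (rule gauss_weight_measurable[OF w])
  show "(\<lambda>u. complex_of_real (w u)) \<in> borel_measurable borel" by measurable
  fix M
  have "integrable lborel (\<lambda>u. of_real (w u) * exp (M * \<bar>u\<bar>))"
    by (rule gauss_weight_integrable_mult[OF w, where C="exp (M\<^sup>2)" and M=1]) (use exp_abs_le_exp_square in auto)
  from integrable_norm[OF this] show "integrable lborel (\<lambda>u. norm (complex_of_real (w u)) * exp (M * \<bar>u\<bar>))"
    by (simp add: abs_mult)
qed

lemma integral_lborel_pos:
  fixes f :: "real \<Rightarrow> real"
  assumes int: "integrable lborel f" and pos: "\<And>u. f u > 0"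
  shows "integral\<^sup>L lborel f > 0"
proof -
  have "integral\<^sup>L lborel f \<noteq> 0"
  proof
    assume "integral\<^sup>L lborel f = 0"
    then have "AE u in lborel. f u = 0"
      using integral_nonneg_eq_0_iff_AE[OF int] pos by (auto intro: less_imp_le)
    then have "AE u in (lborel :: real measure). False" by eventually_elim (use pos in \<open>metis less_irrefl\<close>)
    then show False by (simp add: eventually_False ae_filter_eq_bot_iff)
  qed
  then show ?thesis using integral_nonneg_AE[of f lborel] pos by (auto simp: less_le intro: less_imp_le)
qed

text \<open>On the imaginary axis the integrand is real and positive. This supplies, in each
  half-plane, the nonzero value that Hurwitz's theorem asks for.\<close>

lemma fourier_laplace_imaginary_nonzero:
  assumes w: "gauss_weight w" and pos: "\<And>u. w u > 0"
  shows "fourier_laplace (\<lambda>u. complex_of_real (w u)) (\<i> * of_real y) \<noteq> 0"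
proof -
  have e: "complex_of_real (w u) * exp (\<i> * (\<i> * of_real y) * complex_of_real u) = complex_of_real (w u * exp (- y * u))" for u
  proof -
    have "\<i> * (\<i> * of_real y) * complex_of_real u = complex_of_real (- y * u)" by (simp add: mult.assoc[symmetric])
    then have "exp (\<i> * (\<i> * of_real y) * complex_of_real u) = complex_of_real (exp (- y * u))" by (simp only: exp_of_real)
    then show ?thesis by (simp only: of_real_mult)
  qed
  have int: "integrable lborel (\<lambda>u. w u * exp (- y * u))"
    using gauss_weight_fourier_integrable[OF w, of "\<i> * of_real y"] unfolding e by (simp only: complex_of_real_integrable_eq)
  have "(LINT u|lborel. w u * exp (- y * u)) > 0" by (rule integral_lborel_pos[OF int]) (use pos in auto)
  then show ?thesis unfolding fourier_laplace_def e integral_complex_of_real by simp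
qed

lemma gauss_weight_cosh:
  assumes w: "gauss_weight w"
  shows "gauss_weight (\<lambda>u. w u * cosh (m * u))"
  by (rule gauss_weight_mult[OF w, where K="m\<^sup>2 / 2"])
     (use cosh_le_exp_half_square[of "m * _"] in \<open>auto simp: power_mult_distrib intro!: borel_measurable_continuous_onI continuous_intros\<close>)

lemma fourier_laplace_cosh:
  assumes w: "gauss_weight w"
  shows "fourier_laplace (\<lambda>u. complex_of_real (w u * cosh (m * u))) z =
    (fourier_laplace (\<lambda>u. complex_of_real (w u)) (z + \<i> * of_real m) + fourier_laplace (\<lambda>u. complex_of_real (w u)) (z - \<i> * of_real m)) / 2"
proof -
  have e: "complex_of_real (w u * cosh (m * u)) * exp (\<i> * z * complex_of_real u) =
     (complex_of_real (w u) * exp (\<i> * (z + \<i> * of_real m) * complex_of_real u) + complex_of_real (w u) * exp (\<i> * (z - \<i> * of_real m) * complex_of_real u)) / 2" for u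
  proof -
    have 1: "exp (\<i> * (z + \<i> * of_real m) * complex_of_real u) = exp (\<i> * z * complex_of_real u) * complex_of_real (exp (- (m * u)))"
      unfolding of_real_exp exp_add[symmetric] by (rule arg_cong[where f=exp]) (simp add: algebra_simps)
    have 2: "exp (\<i> * (z - \<i> * of_real m) * complex_of_real u) = exp (\<i> * z * complex_of_real u) * complex_of_real (exp (m * u))"
      unfolding of_real_exp exp_add[symmetric] by (rule arg_cong[where f=exp]) (simp add: algebra_simps)
    show ?thesis unfolding 1 2 cosh_field_def by (simp add: algebra_simps add_divide_distrib)
  qed
  show ?thesis unfolding fourier_laplace_def e
    using gauss_weight_fourier_integrable[OF w] by simp
qed

lemma fourier_laplace_cosh_power:
  assumes w: "gauss_weight w"
  shows "gauss_weight (\<lambda>u. w u * cosh (m * u) ^ n) \<and> fourier_laplace (\<lambda>u. complex_of_real (w u * cosh (m * u) ^ n)) =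
    ((\<lambda>F z. (F (z + \<i> * of_real m) + F (z - \<i> * of_real m)) / 2) ^^ n) (fourier_laplace (\<lambda>u. complex_of_real (w u)))"
proof (induction n)
  case (Suc n)
  have eq: "w u * cosh (m * u) ^ Suc n = w u * cosh (m * u) ^ n * cosh (m * u)" for u by simp
  show ?case unfolding eq
    using gauss_weight_cosh[of "\<lambda>u. w u * cosh (m * u) ^ n" m] fourier_laplace_cosh[of "\<lambda>u. w u * cosh (m * u) ^ n" m] Suc
    by (auto simp: fun_eq_iff)
qed (use w in simp)

text \<open>Hurwitz's theorem acts twice: inside \<open>strip_limit_real_zeros\<close>, from
  polynomials to the transforms \<open>?P n\<close>, and here from these to \<open>?F\<close>.
  Positivity of the weights provides nonzero values on the imaginary axis for both.\<close>

theorem de_bruijn: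
  fixes w :: "real \<Rightarrow> real"
  assumes w: "gauss_weight w" and pos: "\<And>u. w u > 0"
    and lim: "strip_limit D (fourier_laplace (\<lambda>u. complex_of_real (w u)))" and D: "D \<ge> 0"
    and l: "l > 0" "D\<^sup>2 \<le> 2 * l"
    and zero: "fourier_laplace (\<lambda>u. complex_of_real (w u * exp (l * u\<^sup>2))) z = 0"
  shows "Im z = 0"
proof (rule ccontr)
  assume Imz: "Im z \<noteq> 0"
  have [measurable]: "w \<in> borel_measurable borel" by (rule gauss_weight_measurable[OF w])
  let ?m = "\<lambda>n. sqrt (2 * l / real (Suc n))"
  let ?W = "\<lambda>n u. w u * cosh (?m n * u) ^ Suc n"
  let ?P = "\<lambda>n. fourier_laplace (\<lambda>u. complex_of_real (?W n u))"
  let ?w = "\<lambda>u. w u * exp (l * u\<^sup>2)"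
  let ?F = "fourier_laplace (\<lambda>u. complex_of_real (?w u))"
  have gW: "gauss_weight (?W n)" for n using fourier_laplace_cosh_power[OF w] by blast
  have gw: "gauss_weight ?w" by (rule gauss_weight_mult[OF w, where K=l]) auto
  have Wpos: "?W n u > 0" "?w u > 0" for n u using pos[of u] by (auto simp: zero_less_mult_iff)
  have nzP: "?P n (\<i> * of_real y) \<noteq> 0" for n y by (rule fourier_laplace_imaginary_nonzero[OF gW Wpos(1)])
  have nz: "?P n z \<noteq> 0" if "Im z \<noteq> 0" for n z
  proof
    assume 0: "?P n z = 0"
    have m: "?m n > 0" using l by simp
    \<comment> \<open>The \<open>Suc n\<close> shifts remove \<open>2 * l\<close> from the squared
      half-width in total, and \<open>D^2 \<le> 2 * l\<close> leaves half-width 0.\<close>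
    have "real (Suc n) * (?m n)\<^sup>2 = 2 * l" using l by (simp del: of_nat_Suc)
    then have "strip_limit 0 (?P n)"
      using strip_limit_cosh_shift_funpow[OF lim m D, of "Suc n"] fourier_laplace_cosh_power[OF w, of "?m n" "Suc n"] l by (simp del: of_nat_Suc funpow.simps power_Suc)
    then have "Im z = 0"
      by (rule strip_limit_real_zeros[of "?P n" "\<i> * of_real 1" "\<i> * of_real (-1)" z, OF _ _ nzP _ nzP 0]) simp_all
    then show False using that by simp
  qed
  have ul: "uniform_limit K ?P ?F sequentially" if K: "compact K" for K
  proof -
    obtain r where r: "\<And>z. z \<in> K \<Longrightarrow> norm z \<le> r" using compact_imp_bounded[OF K] by (auto simp: bounded_iff)
    \<comment> \<open>The integral of \<open>?d n\<close> bounds \<open>?P n - ?F\<close> at all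
      points of \<open>K\<close> at once; the integrand is nonnegative because the power of cosh
      stays below the exponential.\<close>
    let ?d = "\<lambda>n u. w u * (exp (l * u\<^sup>2) - cosh (?m n * u) ^ Suc n) * exp (r * \<bar>u\<bar>)"
    have cle: "cosh (?m n * u) ^ Suc n \<le> exp (l * u\<^sup>2)" for n u
    proof -
      have "cosh (?m n * u) ^ Suc n \<le> exp ((?m n * u)\<^sup>2 / 2) ^ Suc n"
        by (intro power_mono cosh_le_exp_half_square) auto
      also have "\<dots> = exp (real (Suc n) * ((?m n * u)\<^sup>2 / 2))" by (simp only: exp_of_nat_mult)
      also have "real (Suc n) * ((?m n * u)\<^sup>2 / 2) = l * u\<^sup>2"
        using l by (simp add: power_mult_distrib del: of_nat_Suc)
      finally show ?thesis .
    qed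
    have dm: "integrable lborel (\<lambda>u. of_real (w u) * (exp (l * u\<^sup>2) * exp (r * \<bar>u\<bar>)))"
    proof (rule gauss_weight_integrable_mult[OF w, where C="exp (r\<^sup>2)" and M="l + 1"])
      fix u show "norm (exp (l * u\<^sup>2) * exp (r * \<bar>u\<bar>)) \<le> exp (r\<^sup>2) * exp ((l + 1) * u\<^sup>2)"
        using mult_left_mono[OF exp_abs_le_exp_square[of r u], of "exp (l * u\<^sup>2)"] by (simp add: distrib_right exp_add mult_ac)
    qed measurable
    have dle: "\<bar>?d n u\<bar> \<le> w u * (exp (l * u\<^sup>2) * exp (r * \<bar>u\<bar>))" for n u
    proof -
      have "0 \<le> cosh (?m n * u) ^ Suc n" by simp
      then have "\<bar>exp (l * u\<^sup>2) - cosh (?m n * u) ^ Suc n\<bar> \<le> exp (l * u\<^sup>2)" using cle[of n u] by linarith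
      then show ?thesis using pos[of u] by (simp add: abs_mult mult.assoc mult_right_mono del: power_Suc)
    qed
    have [measurable]: "(\<lambda>u. cosh (c * u)) \<in> borel_measurable borel" for c :: real
      by (intro borel_measurable_continuous_onI continuous_intros)
    have dint: "integrable lborel (?d n)" for n
      by (rule Bochner_Integration.integrable_bound[OF dm]) (use dle in \<open>auto intro!: AE_I2 intro: order_trans[OF _ abs_ge_self]\<close>)
    have "(\<lambda>n. LINT u|lborel. ?d n u) \<longlonglongrightarrow> (LINT u|(lborel :: real measure). (0::real))"
    proof (rule integral_dominated_convergence[where w="\<lambda>u. of_real (w u) * (exp (l * u\<^sup>2) * exp (r * \<bar>u\<bar>))"])
      show "AE u in lborel. (\<lambda>n. ?d n u) \<longlonglongrightarrow> 0"
      proof (intro AE_I2)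
        fix u
        have "(\<lambda>n. ?d n u) \<longlonglongrightarrow> w u * (exp (l * u\<^sup>2) - exp (l * u\<^sup>2)) * exp (r * \<bar>u\<bar>)"
          by (intro tendsto_intros cosh_power_tendsto_exp l)
        then show "(\<lambda>n. ?d n u) \<longlonglongrightarrow> 0" by simp
      qed
    qed (use dm dle in auto)
    then have lim0: "(\<lambda>n. LINT u|lborel. ?d n u) \<longlonglongrightarrow> 0" by simp
    have le: "norm (?P n z - ?F z) \<le> (LINT u|lborel. ?d n u)" if z: "z \<in> K" for n z
    proof -
      let ?e = "\<lambda>u. exp (\<i> * z * complex_of_real u)"
      have eq: "?P n z - ?F z = (LINT u|lborel. complex_of_real (?W n u) * ?e u - complex_of_real (?w u) * ?e u)"
        unfolding fourier_laplace_def using gauss_weight_fourier_integrable[OF gW] gauss_weight_fourier_integrable[OF gw]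
        by (subst Bochner_Integration.integral_diff) auto
      have "norm (LINT u|lborel. complex_of_real (?W n u) * ?e u - complex_of_real (?w u) * ?e u) \<le> (LINT u|lborel. ?d n u)"
      proof (rule order_trans[OF integral_norm_bound], rule integral_mono)
        show "integrable lborel (\<lambda>u. norm (complex_of_real (?W n u) * ?e u - complex_of_real (?w u) * ?e u))"
          by (intro integrable_norm Bochner_Integration.integrable_diff gauss_weight_fourier_integrable gW gw)
        show "integrable lborel (?d n)" by (rule dint)
        fix u
        have "norm (complex_of_real (?W n u) * ?e u - complex_of_real (?w u) * ?e u) = \<bar>?W n u - ?w u\<bar> * norm (?e u)"
          by (simp only: left_diff_distrib[symmetric] of_real_diff[symmetric] norm_mult norm_of_real)
        also have "\<bar>?W n u - ?w u\<bar> = w u * (exp (l * u\<^sup>2) - cosh (?m n * u) ^ Suc n)"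
          using pos[of u] mult_left_mono[OF cle[of n u], of "w u"] by (simp add: right_diff_distrib del: power_Suc)
        also have "w u * (exp (l * u\<^sup>2) - cosh (?m n * u) ^ Suc n) * norm (?e u) \<le> ?d n u"
        proof (rule mult_left_mono)
          have "norm z * \<bar>u\<bar> \<le> r * \<bar>u\<bar>" using r[OF z] by (intro mult_right_mono) auto
          then show "norm (?e u) \<le> exp (r * \<bar>u\<bar>)" by (intro order_trans[OF norm_exp_i_le]) simp
          show "0 \<le> w u * (exp (l * u\<^sup>2) - cosh (?m n * u) ^ Suc n)" using pos[of u] cle[of n u] by simp
        qed
        finally show "norm (complex_of_real (?W n u) * ?e u - complex_of_real (?w u) * ?e u) \<le> ?d n u" .
      qed
      then show ?thesis unfolding eq .
    qed
    show ?thesis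
    proof (rule uniform_limitI)
      fix e :: real assume "e > 0"
      then have "eventually (\<lambda>n. (LINT u|lborel. ?d n u) < e) sequentially" using lim0 by (auto dest: order_tendstoD(2))
      then show "\<forall>\<^sub>F n in sequentially. \<forall>x\<in>K. dist (?P n x) (?F x) < e"
        by eventually_elim (use le in \<open>auto simp: dist_norm intro: le_less_trans\<close>)
    qed
  qed
  have hol: "?P n holomorphic_on S" "?F holomorphic_on S" for n S
    using gauss_weight_entire[OF gW] gauss_weight_entire[OF gw] holomorphic_on_subset by blast+
  have nzF: "?F (\<i> * of_real y) \<noteq> 0" for y by (rule fourier_laplace_imaginary_nonzero[OF gw Wpos(2)])
  consider "Im z > 0" | "Im z < 0" using Imz by linarith
  then show False
  proof cases
    case 1
    have "?F z \<noteq> 0"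
      by (rule hurwitz_nonzero[of "{z. Im z > 0}" ?P ?F "\<i> * of_real 1" z, OF _ _ hol ul nz _ nzF])
         (use 1 in \<open>auto simp: open_halfspace_Im_gt intro!: convex_connected convex_halfspace_Im_gt\<close>)
    then show False using zero by simp
  next
    case 2
    have "?F z \<noteq> 0"
      by (rule hurwitz_nonzero[of "{z. Im z < 0}" ?P ?F "\<i> * of_real (-1)" z, OF _ _ hol ul nz _ nzF])
         (use 2 in \<open>auto simp: open_halfspace_Im_lt intro!: convex_connected convex_halfspace_Im_lt\<close>)
    then show False using zero by simp
  qed
qed

section \<open>Convolution powers\<close>

lemma integrable_convolution_kernel:
  fixes a b :: "real \<Rightarrow> real"
  assumes a: "integrable lborel a" and b: "integrable lborel b"
  shows "integrable (lborel \<Otimes>\<^sub>M lborel) (\<lambda>(v, u). b v * a (u - v))"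
proof (rule lborel_pair.Fubini_integrable)
  have [measurable]: "a \<in> borel_measurable borel" "b \<in> borel_measurable borel" using a b by auto
  show "(\<lambda>(v, u). b v * a (u - v)) \<in> borel_measurable (lborel \<Otimes>\<^sub>M lborel)" by measurable
  have shift: "integrable lborel (\<lambda>u. a (u - v))" "(LINT u|lborel. \<bar>a (u - v)\<bar>) = (LINT u|lborel. \<bar>a u\<bar>)" for v
    using lborel_integrable_real_affine[OF a, of 1 "- v"] lborel_integral_real_affine[of 1 "\<lambda>u. \<bar>a u\<bar>" "- v"]
    by (simp_all add: algebra_simps)
  have "(LINT u|lborel. norm (case (v, u) of (v, u) \<Rightarrow> b v * a (u - v))) = \<bar>b v\<bar> * (LINT u|lborel. \<bar>a u\<bar>)" for v
    by (simp add: abs_mult shift)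
  then show "integrable lborel (\<lambda>v. LINT u|lborel. norm (case (v, u) of (v, u) \<Rightarrow> b v * a (u - v)))"
    using b by simp
  show "AE v in lborel. integrable lborel (\<lambda>u. case (v, u) of (v, u) \<Rightarrow> b v * a (u - v))"
    using shift by auto
qed

definition convolve :: "(real \<Rightarrow> real) \<Rightarrow> (real \<Rightarrow> real) \<Rightarrow> real \<Rightarrow> real" where
  "convolve f g u = (LINT v|lborel. g v * f (u - v))"

text \<open>Positivity and \<open>gauss_weight\<close> serve \<open>de_bruijn\<close>, continuity
  and boundedness serve \<open>fourier_inversion\<close>, and the conjunction is stable under
  convolution.\<close>

definition nice_weight :: "(real \<Rightarrow> real) \<Rightarrow> bool" where
  "nice_weight w \<longleftrightarrow> gauss_weight w \<and> (\<forall>u. w u > 0) \<and> continuous_on UNIV w \<and> (\<exists>B. \<forall>u. w u \<le> B)"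

lemma gauss_weight_integrable: "gauss_weight w \<Longrightarrow> integrable lborel w"
  unfolding gauss_weight_def by (auto dest: spec[of _ 0])

lemma nice_weight_convolve:
  assumes f: "nice_weight f" and g: "nice_weight g"
  shows "nice_weight (convolve f g)"
    and "fourier_laplace (\<lambda>u. complex_of_real (convolve f g u)) z = fourier_laplace (\<lambda>u. complex_of_real (f u)) z * fourier_laplace (\<lambda>u. complex_of_real (g u)) z"
proof -
  have gf: "gauss_weight f" and gg: "gauss_weight g" and fpos: "\<And>u. f u > 0" and gpos: "\<And>u. g u > 0"
    and fc: "continuous_on UNIV f" using f g by (auto simp: nice_weight_def)
  obtain B where B: "\<And>u. f u \<le> B" using f by (auto simp: nice_weight_def)
  have B0: "B > 0" using B[of 0] fpos[of 0] by linarith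
  have [measurable]: "f \<in> borel_measurable borel" "g \<in> borel_measurable borel" using gf gg gauss_weight_measurable by auto
  have gi: "integrable lborel g" by (rule gauss_weight_integrable[OF gg])
  have ki: "integrable lborel (\<lambda>v. g v * f (u - v))" for u
    by (rule Bochner_Integration.integrable_bound[of _ "\<lambda>v. B * g v"])
       (use gi B fpos gpos B0 in \<open>auto intro!: AE_I2 simp: abs_mult less_imp_le mult.commute mult_right_mono\<close>)
  have hpos: "convolve f g u > 0" for u
    unfolding convolve_def by (rule integral_lborel_pos[OF ki]) (use fpos gpos in auto)
  have hle: "convolve f g u \<le> (LINT v|lborel. g v * B)" for u
    unfolding convolve_def by (rule integral_mono[OF ki]) (use gi B gpos in \<open>auto intro!: mult_left_mono simp: less_imp_le\<close>)
  have hc: "continuous_on UNIV (convolve f g)"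
  proof (rule continuous_on_sequentiallyI)
    fix x :: "nat \<Rightarrow> real" and u assume x: "x \<longlonglongrightarrow> u"
    show "(\<lambda>n. convolve f g (x n)) \<longlonglongrightarrow> convolve f g u"
      unfolding convolve_def
    proof (rule integral_dominated_convergence[where w="\<lambda>v. B * g v"])
      have "isCont f y" for y using fc by (simp add: continuous_on_eq_continuous_at)
      then show "AE v in lborel. (\<lambda>n. g v * f (x n - v)) \<longlonglongrightarrow> g v * f (u - v)"
        by (intro AE_I2 tendsto_intros isCont_tendsto_compose[of _ f] x)
      show "AE v in lborel. norm (g v * f (x n - v)) \<le> B * g v" for n
        using B fpos gpos by (intro AE_I2) (simp add: abs_mult less_imp_le mult.commute mult_right_mono)
    qed (use gi in auto)
  qed
  then have [measurable]: "convolve f g \<in> borel_measurable borel" by (rule borel_measurable_continuous_onI)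
  \<comment> \<open>One statement for both Gaussian growth and the Fourier factor:
    \<open>u^2 \<le> 2 * v^2 + 2 * (u - v)^2\<close> distributes the growth
    \<open>exp (M * u^2)\<close> over \<open>g v\<close> and \<open>f (u - v)\<close>.\<close>
  have kern: "integrable (lborel \<Otimes>\<^sub>M lborel) (\<lambda>(v, u). of_real (g v * f (u - v)) * E u)"
    if [measurable]: "E \<in> borel_measurable borel" and E: "\<And>u. norm (E u) \<le> C * exp (M * u\<^sup>2)" and M: "M \<ge> 0" for E :: "real \<Rightarrow> complex" and C M
  proof (rule Bochner_Integration.integrable_bound)
    show "integrable (lborel \<Otimes>\<^sub>M lborel) (\<lambda>p. C * (case p of (v, u) \<Rightarrow> (g v * exp (2 * M * v\<^sup>2)) * (f (u - v) * exp (2 * M * (u - v)\<^sup>2))))"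
      using gf gg unfolding gauss_weight_def
      by (intro integrable_mult_right integrable_convolution_kernel[where a="\<lambda>u. f u * exp (2 * M * u\<^sup>2)"]) auto
    show "AE p in lborel \<Otimes>\<^sub>M lborel. norm (case p of (v, u) \<Rightarrow> of_real (g v * f (u - v)) * E u)
        \<le> norm (C * (case p of (v, u) \<Rightarrow> (g v * exp (2 * M * v\<^sup>2)) * (f (u - v) * exp (2 * M * (u - v)\<^sup>2))))"
    proof (intro AE_I2, clarify)
      fix v u :: real
      have C: "C \<ge> 0" using order_trans[OF norm_ge_zero E[of 0]] by simp
      have "u\<^sup>2 \<le> 2 * v\<^sup>2 + 2 * (u - v)\<^sup>2" using zero_le_power2[of "2 * v - u"] by (simp add: power2_eq_square algebra_simps)
      then have "M * u\<^sup>2 \<le> M * (2 * v\<^sup>2 + 2 * (u - v)\<^sup>2)" using M by (rule mult_left_mono)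
      also have "\<dots> = 2 * M * v\<^sup>2 + 2 * M * (u - v)\<^sup>2" by (simp add: algebra_simps)
      finally have "exp (M * u\<^sup>2) \<le> exp (2 * M * v\<^sup>2) * exp (2 * M * (u - v)\<^sup>2)" by (simp flip: exp_add)
      then have "norm (E u) \<le> C * (exp (2 * M * v\<^sup>2) * exp (2 * M * (u - v)\<^sup>2))"
        using E[of u] mult_left_mono[OF _ C] by (meson order_trans)
      then have "g v * f (u - v) * norm (E u) \<le> g v * f (u - v) * (C * (exp (2 * M * v\<^sup>2) * exp (2 * M * (u - v)\<^sup>2)))"
        using fpos[of "u - v"] gpos[of v] by (intro mult_left_mono) (auto simp: less_imp_le)
      then show "norm (of_real (g v * f (u - v)) * E u) \<le> norm (C * ((g v * exp (2 * M * v\<^sup>2)) * (f (u - v) * exp (2 * M * (u - v)\<^sup>2))))"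
        using fpos[of "u - v"] gpos[of v] C by (simp add: norm_mult abs_mult mult_ac)
    qed
  qed measurable
  have hE: "(LINT v|lborel. of_real (g v * f (u - v)) * E u) = of_real (convolve f g u) * E u" for u and E :: "real \<Rightarrow> complex"
    unfolding convolve_def by (simp add: integral_complex_of_real del: of_real_mult)
  have ih: "integrable lborel (\<lambda>u. of_real (convolve f g u) * E u)"
    if "E \<in> borel_measurable borel" "\<And>u. norm (E u) \<le> C * exp (M * u\<^sup>2)" "M \<ge> 0" for E :: "real \<Rightarrow> complex" and C M
    using lborel_pair.integrable_snd[OF kern[OF that]] by (simp only: hE[where E=E])
  have gh: "gauss_weight (convolve f g)"
    unfolding gauss_weight_def
  proof (intro conjI allI)
    fix M
    have "integrable lborel (\<lambda>u. complex_of_real (convolve f g u) * complex_of_real (exp (M * u\<^sup>2)))"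
      by (rule ih[where C=1 and M="\<bar>M\<bar>"]) (auto intro!: mult_right_mono)
    then show "integrable lborel (\<lambda>u. convolve f g u * exp (M * u\<^sup>2))"
      by (simp only: of_real_mult[symmetric] complex_of_real_integrable_eq)
  qed measurable
  show "nice_weight (convolve f g)" unfolding nice_weight_def using gh hpos hc hle by blast
  let ?E = "\<lambda>u. exp (\<i> * z * complex_of_real u)"
  have K: "integrable (lborel \<Otimes>\<^sub>M lborel) (\<lambda>(v, u). of_real (g v * f (u - v)) * ?E u)"
    by (rule kern[where C="exp ((norm z)\<^sup>2)" and M=1])
       (auto intro: order_trans[OF norm_exp_i_le exp_abs_le_exp_square] simp del: norm_exp_eq_Re)
  have "fourier_laplace (\<lambda>u. complex_of_real (convolve f g u)) z = (LINT u|lborel. (LINT v|lborel. of_real (g v * f (u - v)) * ?E u))"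
    unfolding fourier_laplace_def by (simp only: hE[where E="?E"])
  also have "\<dots> = (LINT v|lborel. (LINT u|lborel. of_real (g v * f (u - v)) * ?E u))"
    by (rule lborel_pair.Fubini_integral[OF K])
  also have "\<dots> = (LINT v|lborel. fourier_laplace (\<lambda>u. complex_of_real (f u)) z * (complex_of_real (g v) * ?E v))"
  proof (intro Bochner_Integration.integral_cong refl)
    fix v
    have "(LINT u|lborel. of_real (g v * f (u - v)) * ?E u) = (LINT u|lborel. of_real (g v * f (v + 1 * u - v)) * ?E (v + 1 * u))"
      by (subst lborel_integral_real_affine[of 1 _ v]) auto
    also have "\<dots> = (LINT u|lborel. (complex_of_real (g v) * ?E v) * (complex_of_real (f u) * ?E u))"
      by (intro Bochner_Integration.integral_cong refl) (simp add: distrib_left exp_add mult_ac)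
    also have "\<dots> = (complex_of_real (g v) * ?E v) * fourier_laplace (\<lambda>u. complex_of_real (f u)) z"
      unfolding fourier_laplace_def by (rule integral_mult_right_zero)
    finally show "(LINT u|lborel. of_real (g v * f (u - v)) * ?E u) = fourier_laplace (\<lambda>u. complex_of_real (f u)) z * (complex_of_real (g v) * ?E v)"
      by (simp only: mult.commute)
  qed
  also have "\<dots> = fourier_laplace (\<lambda>u. complex_of_real (f u)) z * fourier_laplace (\<lambda>u. complex_of_real (g u)) z"
    by (simp only: fourier_laplace_def integral_mult_right_zero)
  finally show "fourier_laplace (\<lambda>u. complex_of_real (convolve f g u)) z = fourier_laplace (\<lambda>u. complex_of_real (f u)) z * fourier_laplace (\<lambda>u. complex_of_real (g u)) z" .
qed

text \<open>Note the shift: \<open>convolution_power w n\<close> has \<open>n + 1\<close> factors.\<close>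

primrec convolution_power :: "(real \<Rightarrow> real) \<Rightarrow> nat \<Rightarrow> real \<Rightarrow> real" where
  "convolution_power w 0 = w"
| "convolution_power w (Suc n) = convolve (convolution_power w n) w"

lemma nice_weight_convolution_power:
  assumes "nice_weight w"
  shows "nice_weight (convolution_power w n) \<and>
    fourier_laplace (\<lambda>u. complex_of_real (convolution_power w n u)) z = fourier_laplace (\<lambda>u. complex_of_real (w u)) z ^ Suc n"
proof (induction n)
  case (Suc n)
  then have "nice_weight (convolution_power w n)" by blast
  from nice_weight_convolve[OF this assms] Suc show ?case by simp
qed (use assms in simp)

text \<open>Double exponential decay beats any such exponent and still leaves an integrable
  Gaussian. The cubic term is a reserve for the growth estimate of \<open>Xi\<close>.\<close>

lemma double_exp_gauss_bound:
  fixes \<kappa> M :: real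
  assumes "\<kappa> > 0"
  obtains B where "B > 0" "\<And>u. exp (M * u\<^sup>2 + \<bar>u\<bar> ^ 3) * exp (- \<kappa> * exp \<bar>u\<bar>) \<le> B * exp (- u\<^sup>2 / 2)"
proof -
  have "filterlim (\<lambda>u. (M + 1/2) * u\<^sup>2 + u ^ 3 - \<kappa> * exp u) at_bot at_top" using assms by real_asymp
  then have "eventually (\<lambda>u. (M + 1/2) * u\<^sup>2 + u ^ 3 - \<kappa> * exp u \<le> 0) at_top" unfolding filterlim_at_bot by blast
  then obtain R where R: "\<And>u. u \<ge> R \<Longrightarrow> (M + 1/2) * u\<^sup>2 + u ^ 3 - \<kappa> * exp u \<le> 0" by (auto simp: eventually_at_top_linorder)
  define b where "b = \<bar>M + 1/2\<bar> * R\<^sup>2 + \<bar>R\<bar> ^ 3"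
  have le: "(M + 1/2) * u\<^sup>2 + \<bar>u\<bar> ^ 3 - \<kappa> * exp \<bar>u\<bar> \<le> b" for u
  proof (cases "\<bar>u\<bar> \<ge> R")
    case True
    then have "(M + 1/2) * u\<^sup>2 + \<bar>u\<bar> ^ 3 - \<kappa> * exp \<bar>u\<bar> \<le> 0" using R[of "\<bar>u\<bar>"] by simp
    moreover have "b \<ge> 0" by (simp add: b_def)
    ultimately show ?thesis by linarith
  next
    case False
    then have "u\<^sup>2 \<le> R\<^sup>2" "\<bar>u\<bar> ^ 3 \<le> \<bar>R\<bar> ^ 3" using power_mono[of "\<bar>u\<bar>" R 2] power_mono[of "\<bar>u\<bar>" "\<bar>R\<bar>" 3] by auto
    then have "\<bar>M + 1/2\<bar> * u\<^sup>2 + \<bar>u\<bar> ^ 3 \<le> b" unfolding b_def by (intro add_mono mult_left_mono) auto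
    moreover have "(M + 1/2) * u\<^sup>2 \<le> \<bar>M + 1/2\<bar> * u\<^sup>2" by (intro mult_right_mono) auto
    moreover have "\<kappa> * exp \<bar>u\<bar> \<ge> 0" using assms by simp
    ultimately show ?thesis by linarith
  qed
  show ?thesis
  proof (rule that[of "exp b"])
    fix u
    have "M * u\<^sup>2 + \<bar>u\<bar> ^ 3 + - \<kappa> * exp \<bar>u\<bar> \<le> b + - u\<^sup>2 / 2" using le[of u] by (simp add: algebra_simps)
    then show "exp (M * u\<^sup>2 + \<bar>u\<bar> ^ 3) * exp (- \<kappa> * exp \<bar>u\<bar>) \<le> exp b * exp (- u\<^sup>2 / 2)" by (simp only: exp_add[symmetric] exp_le_cancel_iff)
  qed simp
qed

section \<open>The function Xi\<close>

text \<open>By evenness \<open>f (csqrt w)\<close> does not depend on the choice of the root. The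
  principal root is holomorphic off the nonpositive axis, the root \<open>\<i> * csqrt (- w)\<close>
  off the nonnegative one, and the origin is removable by continuity.\<close>

lemma even_entire_square:
  assumes hol: "f holomorphic_on UNIV" and even: "\<And>z. f (- z) = f z"
  obtains G where "G holomorphic_on UNIV" "\<And>z. G (z\<^sup>2) = f z"
proof -
  define G where "G w = f (csqrt w)" for w
  have Gsq: "G (z\<^sup>2) = f z" for z
  proof -
    have "(csqrt (z\<^sup>2))\<^sup>2 = z\<^sup>2" by simp
    then have "csqrt (z\<^sup>2) = z \<or> csqrt (z\<^sup>2) = - z" by (simp only: power2_eq_iff)
    then show ?thesis using even by (auto simp: G_def)
  qed
  have G2: "G w = f (\<i> * csqrt (- w))" for w
    using Gsq[of "\<i> * csqrt (- w)"] by (simp add: power_mult_distrib)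
  have c: "continuous_on UNIV f" using hol by (rule holomorphic_on_imp_continuous_on)
  have "G holomorphic_on (- \<real>\<^sub>\<le>\<^sub>0)"
    unfolding G_def by (rule holomorphic_on_compose_gen[OF _ hol, unfolded o_def]) (auto intro!: holomorphic_intros)
  moreover have "G holomorphic_on {w. - w \<notin> \<real>\<^sub>\<le>\<^sub>0}"
    unfolding G2[abs_def] by (rule holomorphic_on_compose_gen[OF _ hol, unfolded o_def]) (auto intro!: holomorphic_intros)
  moreover have o: "open (- \<real>\<^sub>\<le>\<^sub>0 :: complex set)" by (simp add: closed_nonpos_Reals_complex open_Compl)
  moreover have "open {w::complex. - w \<notin> \<real>\<^sub>\<le>\<^sub>0}"
  proof -
    have "{w::complex. - w \<notin> \<real>\<^sub>\<le>\<^sub>0} = - \<real>\<^sub>\<ge>\<^sub>0" by auto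
    then show ?thesis by (simp only: open_Compl closed_nonneg_Reals_complex)
  qed
  ultimately have "G holomorphic_on (- \<real>\<^sub>\<le>\<^sub>0) \<union> {w. - w \<notin> \<real>\<^sub>\<le>\<^sub>0}" by (intro holomorphic_on_Un)
  moreover have "(- \<real>\<^sub>\<le>\<^sub>0) \<union> {w::complex. - w \<notin> \<real>\<^sub>\<le>\<^sub>0} = UNIV - {0}"
    by (auto simp: complex_nonpos_Reals_iff complex_eq_iff)
  ultimately have hol0: "G holomorphic_on UNIV - {0}" by simp
  have "isCont G w" for w
  proof (cases "w = 0")
    case False
    then show ?thesis using holomorphic_on_imp_continuous_on[OF hol0]
      by (simp add: continuous_on_eq_continuous_at open_delete)
  next
    case True
    have "((\<lambda>w::complex. sqrt (norm w)) \<longlongrightarrow> sqrt (norm (0::complex))) (at 0)" by (intro tendsto_intros)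
    then have "((\<lambda>w. norm (csqrt w)) \<longlongrightarrow> 0) (at 0)" by simp
    then have "(csqrt \<longlongrightarrow> 0) (at 0)" by (rule tendsto_norm_zero_cancel)
    moreover have "isCont f 0" using c by (simp add: continuous_on_eq_continuous_at)
    ultimately have "((\<lambda>w. f (csqrt w)) \<longlongrightarrow> f 0) (at 0)" by (rule isCont_tendsto_compose[rotated])
    then show ?thesis using True by (simp add: isCont_def G_def[abs_def])
  qed
  then have "continuous_on UNIV G" by (simp add: continuous_at_imp_continuous_on)
  then have "G holomorphic_on UNIV" by (rule no_isolated_singularity[OF _ hol0]) auto
  then show ?thesis using Gsq that by blast
qed

lemma strip_limit_mult:
  assumes F: "strip_limit D F" and H: "strip_limit D H"
  shows "strip_limit D (\<lambda>z. F z * H z)"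
proof -
  obtain p q where p: "\<And>n. strip_poly D (p n)" "\<And>r. uniform_limit (cball 0 r) (\<lambda>n. poly (p n)) F sequentially"
    and q: "\<And>n. strip_poly D (q n)" "\<And>r. uniform_limit (cball 0 r) (\<lambda>n. poly (q n)) H sequentially"
    using F H by (auto simp: strip_limit_def)
  have b: "bounded (F ` cball 0 r)" if "strip_limit D F" for F r
    using strip_limit_holomorphic[OF that]
    by (intro compact_imp_bounded compact_continuous_image holomorphic_on_imp_continuous_on) (auto intro: holomorphic_on_subset)
  have "strip_poly D (p n * q n)" for n using p(1)[of n] q(1)[of n] by (auto simp: strip_poly_def)
  moreover have "uniform_limit (cball 0 r) (\<lambda>n. poly (p n * q n)) (\<lambda>z. F z * H z) sequentially" for r
    unfolding poly_mult by (intro uniform_lim_mult p q b F H)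
  ultimately show ?thesis unfolding strip_limit_def by (intro exI[of _ "\<lambda>n. p n * q n"]) auto
qed

lemma strip_limit_power: "strip_limit D F \<Longrightarrow> strip_limit D (\<lambda>z. F z ^ Suc n)"
  by (induction n) (auto intro: strip_limit_mult)

text \<open>Passing to \<open>G\<close> with \<open>G (z^2) = f z\<close> halves the exponent 3/2 to
  3/4, below the critical order 1. A factor \<open>1 - w / b\<close> becomes
  \<open>1 - z^2 / b\<close>, whose zeros are zeros of \<open>f\<close>, so the approximants inherit
  the strip.\<close>

theorem strip_limit_of_growth:
  assumes hol: "f holomorphic_on UNIV" and even: "\<And>z. f (- z) = f z" and sym: "\<And>z. f (cnj z) = cnj (f z)"
    and f0: "f 0 \<noteq> 0" and C: "C > 0" and growth: "\<And>z. norm (f z) \<le> C * exp (norm z powr (3/2))"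
    and zeros: "\<And>z. f z = 0 \<Longrightarrow> \<bar>Im z\<bar> \<le> D"
  shows "strip_limit D f"
proof -
  obtain G where G: "G holomorphic_on UNIV" and Gsq: "\<And>z. G (z\<^sup>2) = f z" using even_entire_square[OF hol even] by blast
  have Gc: "G w = f (csqrt w)" for w using Gsq[of "csqrt w"] by simp
  have Gsym: "G (cnj w) = cnj (G w)" for w
    using Gsq[of "cnj (csqrt w)"] Gsq[of "csqrt w"] sym[of "csqrt w"] by (simp flip: complex_cnj_power)
  define \<mu> where "\<mu> r = ln C + r powr (3/4)" for r :: real
  have Gg: "norm (G w) \<le> exp (\<mu> (norm w))" for w
  proof -
    have "sqrt (norm w) powr (3/2) = norm w powr (3/4)" by (simp add: powr_half_sqrt[symmetric] powr_powr)
    then show ?thesis using growth[of "csqrt w"] C by (simp add: Gc \<mu>_def exp_add)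
  qed
  have lim: "((\<lambda>r. \<mu> r / r) \<longlongrightarrow> 0) at_top" unfolding \<mu>_def by real_asymp
  have G0: "G 0 = f 0" using Gsq[of 0] by simp
  then have "G 0 \<noteq> 0" using f0 by simp
  from real_entire_order_less_1_limit[OF G this Gsym Gg lim]
  obtain bs where bs: "\<And>n b. b \<in> set (bs n) \<Longrightarrow> b \<noteq> 0 \<and> G b = 0"
    "\<And>n w. root_prod (bs n) (cnj w) = cnj (root_prod (bs n) w)"
    "\<And>r. uniform_limit (cball 0 r) (\<lambda>n. root_prod (bs n)) (\<lambda>w. G w / G 0) sequentially"
    by blast
  define P where "P cs = (\<Prod>b\<leftarrow>cs. [:1, 0, - 1 / b:])" for cs :: "complex list"
  have polyP: "poly (P cs) z = root_prod cs (z\<^sup>2)" for cs z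
    by (induction cs) (auto simp: P_def power2_eq_square algebra_simps)
  define p where "p n = smult (f 0) (P (bs n))" for n
  have pp: "poly (p n) z = f 0 * root_prod (bs n) (z\<^sup>2)" for n z by (simp add: p_def polyP)
  have f0r: "cnj (f 0) = f 0" using sym[of 0] by simp
  have "strip_poly D (p n)" for n
    unfolding strip_poly_def
  proof (intro conjI allI impI)
    have "poly (p n) 0 \<noteq> 0" using f0 by (simp add: pp)
    then show "p n \<noteq> 0" by auto
    show "poly (p n) (cnj z) = cnj (poly (p n) z)" for z
      using bs(2)[of n "z\<^sup>2"] f0r by (simp add: pp)
    fix z assume "poly (p n) z = 0"
    then have "root_prod (bs n) (z\<^sup>2) = 0" using f0 by (simp add: pp)
    then have "z\<^sup>2 \<in> set (bs n)" using bs(1)[of _ n] root_prod_eq_0_iff by blast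
    then have "G (z\<^sup>2) = 0" using bs(1) by blast
    then show "\<bar>Im z\<bar> \<le> D" by (intro zeros) (simp add: Gsq)
  qed
  moreover have "uniform_limit (cball 0 r) (\<lambda>n. poly (p n)) f sequentially" for r
  proof -
    have "uniform_limit (cball 0 r) (\<lambda>n z. root_prod (bs n) (z\<^sup>2)) (\<lambda>z. G (z\<^sup>2) / G 0) sequentially"
      by (rule uniform_limit_compose'[OF bs(3)[of "r\<^sup>2"]]) (auto simp: norm_power intro!: power_mono)
    from bounded_linear.uniform_limit[OF bounded_linear_mult_right this, of "f 0"]
    have "uniform_limit (cball 0 r) (\<lambda>n z. f 0 * root_prod (bs n) (z\<^sup>2)) (\<lambda>z. f 0 * (G (z\<^sup>2) / G 0)) sequentially" .
    then show ?thesis using f0 by (simp add: pp[abs_def] Gsq G0)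
  qed
  ultimately show ?thesis unfolding strip_limit_def by blast
qed

lemma xi_kernel_shift_bound:
  assumes "0 \<le> \<alpha>" "\<alpha> < pi / 4"
  obtains B where "B > 0" "\<And>z. \<bar>Im z\<bar> \<le> \<alpha> \<Longrightarrow> norm (xi_kernel z) * exp (M * (Re z)\<^sup>2 + \<bar>Re z\<bar> ^ 3) \<le> B * exp (- (Re z)\<^sup>2 / 2)"
proof -
  obtain C \<kappa> where C: "\<kappa> > 0" "C > 0" "\<And>z. \<bar>Im z\<bar> \<le> \<alpha> \<Longrightarrow> norm (xi_kernel z) \<le> C * exp (- \<kappa> * exp \<bar>Re z\<bar>)"
    using xi_kernel_bound[OF assms] by blast
  obtain B where B: "B > 0" "\<And>u. exp (M * u\<^sup>2 + \<bar>u\<bar> ^ 3) * exp (- \<kappa> * exp \<bar>u\<bar>) \<le> B * exp (- u\<^sup>2 / 2)"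
    using double_exp_gauss_bound[OF C(1), of M] by blast
  show ?thesis
  proof (rule that[of "C * B"])
    fix z :: complex assume z: "\<bar>Im z\<bar> \<le> \<alpha>"
    have "norm (xi_kernel z) * exp (M * (Re z)\<^sup>2 + \<bar>Re z\<bar> ^ 3) \<le> C * exp (- \<kappa> * exp \<bar>Re z\<bar>) * exp (M * (Re z)\<^sup>2 + \<bar>Re z\<bar> ^ 3)"
      by (intro mult_right_mono C z) auto
    also have "\<dots> = C * (exp (M * (Re z)\<^sup>2 + \<bar>Re z\<bar> ^ 3) * exp (- \<kappa> * exp \<bar>Re z\<bar>))" by (simp only: mult_ac)
    also have "\<dots> \<le> C * (B * exp (- (Re z)\<^sup>2 / 2))" using C(2) by (intro mult_left_mono B) auto
    finally show "norm (xi_kernel z) * exp (M * (Re z)\<^sup>2 + \<bar>Re z\<bar> ^ 3) \<le> C * B * exp (- (Re z)\<^sup>2 / 2)" by (simp only: mult.assoc)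
  qed (use C B in auto)
qed

lemma xi_density_continuous: "continuous_on UNIV xi_density"
proof -
  have "continuous_on UNIV (\<lambda>u. xi_kernel (complex_of_real u))"
    by (rule continuous_on_compose2[OF holomorphic_on_imp_continuous_on[OF xi_kernel_holomorphic]]) (auto intro!: continuous_intros)
  then show ?thesis unfolding xi_density_def[abs_def] by (intro continuous_intros)
qed

lemma xi_density_measurable [measurable]: "xi_density \<in> borel_measurable borel"
  using xi_density_continuous by (rule borel_measurable_continuous_onI)

lemma xi_density_bound:
  obtains B where "B > 0" "\<And>u. xi_density u * exp (M * u\<^sup>2 + \<bar>u\<bar> ^ 3) \<le> B * exp (- u\<^sup>2 / 2)"
proof -
  obtain B where B: "B > 0" "\<And>z. \<bar>Im z\<bar> \<le> 0 \<Longrightarrow> norm (xi_kernel z) * exp (M * (Re z)\<^sup>2 + \<bar>Re z\<bar> ^ 3) \<le> B * exp (- (Re z)\<^sup>2 / 2)"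
    by (rule xi_kernel_shift_bound[of 0 M]) auto
  have "xi_density u * exp (M * u\<^sup>2 + \<bar>u\<bar> ^ 3) \<le> B * exp (- u\<^sup>2 / 2)" for u
    using B(2)[of "complex_of_real u"] xi_density_pos[of u] by (simp add: xi_kernel_of_real)
  then show ?thesis using that B(1) by blast
qed

lemma xi_density_cubic_integrable: "integrable lborel (\<lambda>u. xi_density u * exp (M * u\<^sup>2 + \<bar>u\<bar> ^ 3))"
proof -
  obtain B where B: "B > 0" "\<And>u. xi_density u * exp (M * u\<^sup>2 + \<bar>u\<bar> ^ 3) \<le> B * exp (- u\<^sup>2 / 2)"
    using xi_density_bound by blast
  have "integrable lborel (\<lambda>u. B * exp (- u\<^sup>2 / 2))" by (intro integrable_mult_right integrable_exp_minus_half_square)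
  then show ?thesis
    by (rule Bochner_Integration.integrable_bound)
       (use B xi_density_pos in \<open>auto intro!: AE_I2 simp: abs_mult less_imp_le\<close>)
qed

lemma nice_weight_xi_density: "nice_weight xi_density"
  unfolding nice_weight_def gauss_weight_def
proof (intro conjI allI)
  fix M
  show "integrable lborel (\<lambda>u. xi_density u * exp (M * u\<^sup>2))"
    by (rule Bochner_Integration.integrable_bound[OF xi_density_cubic_integrable[of M]])
       (use xi_density_pos in \<open>auto intro!: AE_I2 simp: abs_mult less_imp_le\<close>)
next
  obtain B where B: "B > 0" "\<And>u. xi_density u * exp (0 * u\<^sup>2 + \<bar>u\<bar> ^ 3) \<le> B * exp (- u\<^sup>2 / 2)"
    using xi_density_bound by blast
  have "xi_density u \<le> B" for u
  proof -
    have "xi_density u * 1 \<le> xi_density u * exp (0 * u\<^sup>2 + \<bar>u\<bar> ^ 3)"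
      using xi_density_pos[of u] by (intro mult_left_mono) auto
    also have "\<dots> \<le> B * exp (- u\<^sup>2 / 2)" by (rule B)
    also have "\<dots> \<le> B * 1" using B(1) by (intro mult_left_mono) auto
    finally show ?thesis by simp
  qed
  then show "\<exists>B. \<forall>u. xi_density u \<le> B" by blast
qed (use xi_density_pos xi_density_continuous in auto)

section \<open>Symmetry and growth of Xi\<close>

definition Xi :: "complex \<Rightarrow> complex" where
  "Xi = fourier_laplace (\<lambda>u. complex_of_real (xi_density u))"

lemma gauss_weight_xi_density: "gauss_weight xi_density"
  using nice_weight_xi_density by (simp add: nice_weight_def)

lemma Xi_entire: "Xi holomorphic_on UNIV"
  unfolding Xi_def by (rule gauss_weight_entire[OF gauss_weight_xi_density])

lemma Xi_even: "Xi (- z) = Xi z"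
  unfolding Xi_def fourier_laplace_def
  by (subst lborel_integral_real_affine[of "-1" _ 0]) (auto simp: xi_density_even)

lemma Xi_cnj: "Xi (cnj z) = cnj (Xi z)"
proof -
  have "cnj (Xi z) = (LINT u|lborel. cnj (complex_of_real (xi_density u) * exp (\<i> * z * complex_of_real u)))"
    unfolding Xi_def fourier_laplace_def by (rule integral_bounded_linear[OF bounded_linear_cnj gauss_weight_fourier_integrable[OF gauss_weight_xi_density], symmetric])
  also have "\<dots> = Xi (- cnj z)" unfolding Xi_def fourier_laplace_def by (simp add: exp_cnj)
  finally show ?thesis by (simp add: Xi_even)
qed

lemma Xi_0: "Xi 0 \<noteq> 0"
  using fourier_laplace_imaginary_nonzero[OF gauss_weight_xi_density xi_density_pos, of 0] by (simp add: Xi_def)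

text \<open>A case split at \<open>u = sqrt y\<close>; 3/2 is the conjugate exponent of 3. It trades
  the cubic reserve of the kernel bound for growth of order 3/2.\<close>

lemma young_three_halves:
  fixes y u :: real
  assumes "y \<ge> 0" "u \<ge> 0"
  shows "y * u \<le> y powr (3/2) + u ^ 3"
proof (cases "u \<le> sqrt y")
  case True
  have "y * u \<le> y * sqrt y" using True assms by (intro mult_left_mono)
  also have "y * sqrt y = y powr (3/2)"
  proof (cases "y = 0")
    case False
    then have "y powr 1 * y powr (1/2) = y powr (3/2)" by (simp only: powr_add[symmetric]) simp
    then show ?thesis using assms False by (simp add: powr_half_sqrt)
  qed simp
  finally show ?thesis using assms by (simp add: add_increasing2)
next
  case False
  then have "sqrt y ^ 2 \<le> u ^ 2" using assms by (intro power_mono) auto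
  then have "y \<le> u ^ 2" using assms by simp
  then have "y * u \<le> u ^ 2 * u" using assms by (intro mult_right_mono)
  then show ?thesis by (simp add: power3_eq_cube power2_eq_square add_increasing)
qed

lemma Xi_growth:
  obtains C where "C > 0" "\<And>z. norm (Xi z) \<le> C * exp (norm z powr (3/2))"
proof -
  define C where "C = (LINT u|lborel. xi_density u * exp (0 * u\<^sup>2 + \<bar>u\<bar> ^ 3))"
  note ci = xi_density_cubic_integrable[of 0]
  have C: "C > 0" unfolding C_def by (rule integral_lborel_pos[OF ci]) (use xi_density_pos in auto)
  have "norm (Xi z) \<le> C * exp (norm z powr (3/2))" for z
  proof -
    have "norm (Xi z) \<le> (LINT u|lborel. xi_density u * exp (0 * u\<^sup>2 + \<bar>u\<bar> ^ 3) * exp (norm z powr (3/2)))"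
      unfolding Xi_def fourier_laplace_def
    proof (rule order_trans[OF integral_norm_bound], rule integral_mono)
      show "integrable lborel (\<lambda>u. norm (complex_of_real (xi_density u) * exp (\<i> * z * complex_of_real u)))"
        by (intro integrable_norm gauss_weight_fourier_integrable gauss_weight_xi_density)
      show "integrable lborel (\<lambda>u. xi_density u * exp (0 * u\<^sup>2 + \<bar>u\<bar> ^ 3) * exp (norm z powr (3/2)))"
        by (intro integrable_mult_left ci)
      fix u
      have "norm (exp (\<i> * z * complex_of_real u)) \<le> exp (norm z * \<bar>u\<bar>)" by (rule norm_exp_i_le)
      also have "\<dots> \<le> exp (0 * u\<^sup>2 + \<bar>u\<bar> ^ 3) * exp (norm z powr (3/2))"
        using young_three_halves[of "norm z" "\<bar>u\<bar>"] by (simp flip: exp_add add: add.commute)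
      finally have "xi_density u * norm (exp (\<i> * z * complex_of_real u)) \<le> xi_density u * (exp (0 * u\<^sup>2 + \<bar>u\<bar> ^ 3) * exp (norm z powr (3/2)))"
        using xi_density_pos[of u] by (intro mult_left_mono) auto
      then show "norm (complex_of_real (xi_density u) * exp (\<i> * z * complex_of_real u)) \<le> xi_density u * exp (0 * u\<^sup>2 + \<bar>u\<bar> ^ 3) * exp (norm z powr (3/2))"
        using xi_density_pos[of u] by (simp add: norm_mult mult.assoc del: norm_exp_eq_Re)
    qed
    also have "\<dots> = C * exp (norm z powr (3/2))" unfolding C_def by (rule integral_mult_left_zero)
    finally show ?thesis .
  qed
  then show ?thesis using C that by blast
qed

text \<open>The norm of the integrand is the same integrand at \<open>Re t\<close>. The value
  controls the interchange of sum and integral in the formula for \<open>Xi\<close>.\<close>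

lemma gamma_exp_integral_norm:
  assumes A: "A > 0" and t: "Re t > 0"
  shows "(LINT u|lborel. norm (exp (2 * t * complex_of_real u) * complex_of_real (exp (- A * exp (2 * u))))) = A powr (- Re t) * (Re (Gamma (of_real (Re t))) / 2)"
proof -
  let ?k = "\<lambda>t u. exp (2 * t * complex_of_real u) * complex_of_real (exp (- A * exp (2 * u)))"
  let ?r = "complex_of_real (Re t)"
  have eq: "?k ?r u = complex_of_real (norm (?k t u))" for u
  proof -
    have "norm (?k t u) = exp (2 * Re t * u) * exp (- A * exp (2 * u))" by (simp add: norm_mult)
    moreover have "exp (2 * ?r * complex_of_real u) = complex_of_real (exp (2 * Re t * u))"
      using exp_of_real[of "2 * Re t * u", where 'a=complex] by simp
    ultimately show ?thesis by (simp only: of_real_mult)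
  qed
  have "complex_of_real (LINT u|lborel. norm (?k t u)) = (LINT u|lborel. ?k ?r u)"
    unfolding eq integral_complex_of_real ..
  also have "\<dots> = of_real A powr (- ?r) * Gamma ?r / 2" using A t by (intro gamma_exp_integral(2)) auto
  also have "of_real A powr (- ?r) = complex_of_real (A powr (- Re t))"
    using A powr_of_real[of A "- Re t"] by simp
  finally have "(LINT u|lborel. norm (?k t u)) = Re (complex_of_real (A powr (- Re t)) * Gamma ?r / 2)"
    by (metis Re_complex_of_real)
  then show ?thesis by simp
qed

text \<open>Integration term by term, where each term combines Gamma integrals at
  \<open>s / 2 + 2\<close> and \<open>s / 2 + 1\<close>. The factor \<open>s * (s - 1)\<close>
  arises from \<open>4 * Gamma (s / 2 + 2) - 6 * Gamma (s / 2 + 1) = s * (s - 1) * Gamma (s /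
  2)\<close>.\<close>

theorem Xi_eq_zeta:
  assumes s: "1 < Re s"
  shows "Xi (- \<i> * (s - 1/2)) = s * (s - 1) * of_real pi powr (- s / 2) * Gamma (s / 2) * zeta_series s"
proof -
  define A where "A n = pi * real (Suc n) ^ 2" for n
  have A: "A n > 0" for n by (simp add: A_def)
  define k where "k t n u = exp (2 * t * complex_of_real u) * complex_of_real (exp (- A n * exp (2 * u)))" for t n u
  define T where "T n u = complex_of_real (exp (u / 2) * ((8 * (A n * exp (2 * u)) ^ 2 - 12 * (A n * exp (2 * u))) * exp (- (A n * exp (2 * u))))) * exp (\<i> * (- \<i> * (s - 1/2)) * complex_of_real u)" for n u
  let ?t1 = "s / 2 + 1" and ?t2 = "s / 2 + 2"
  have t: "Re ?t1 > 0" "Re ?t2 > 0" "Re (s / 2) > 0" using s by auto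
  have Tk: "T n u = 8 * of_real (A n) ^ 2 * k ?t2 n u - 12 * of_real (A n) * k ?t1 n u" for n u
  proof -
    let ?E = "exp (s * complex_of_real u)" and ?x = "complex_of_real (exp (2 * u))" and ?y = "complex_of_real (exp (- (A n * exp (2 * u))))"
    have x: "?x = exp (2 * complex_of_real u)" using exp_of_real[of "2 * u", where 'a=complex] by simp
    have "complex_of_real (exp (u / 2)) * exp (\<i> * (- \<i> * (s - 1/2)) * complex_of_real u) = ?E"
    proof -
      have "complex_of_real (exp (u / 2)) = exp (complex_of_real u / 2)" using exp_of_real[of "u / 2", where 'a=complex] by simp
      then show ?thesis by (simp add: exp_add[symmetric] algebra_simps)
    qed
    then have "T n u = ?E * ((8 * (of_real (A n) * ?x) ^ 2 - 12 * (of_real (A n) * ?x)) * ?y)"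
      unfolding T_def of_real_mult of_real_diff of_real_power by (simp add: mult_ac)
    moreover have "k ?t2 n u = ?E * ?x ^ 2 * ?y" "k ?t1 n u = ?E * ?x * ?y"
      unfolding k_def x exp_of_nat_mult[symmetric] exp_add[symmetric] by (simp_all add: algebra_simps)
    ultimately show ?thesis by (simp add: algebra_simps power2_eq_square)
  qed
  have ik: "integrable lborel (k t n)" if "Re t > 0" for t n
    unfolding k_def by (rule gamma_exp_integral(1)[OF A that])
  have vk: "(LINT u|lborel. k t n u) = of_real (A n) powr (- t) * Gamma t / 2" if "Re t > 0" for t n
    unfolding k_def by (rule gamma_exp_integral(2)[OF A that])
  have nk: "(LINT u|lborel. norm (k t n u)) = A n powr (- Re t) * (Re (Gamma (of_real (Re t))) / 2)" if "Re t > 0" for t n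
    unfolding k_def by (rule gamma_exp_integral_norm[OF A that])
  have iT: "integrable lborel (T n)" for n
    unfolding Tk by (intro Bochner_Integration.integrable_diff integrable_mult_right ik t)
  have vT: "(LINT u|lborel. T n u) = s * (s - 1) * of_real pi powr (- s / 2) * Gamma (s / 2) * (1 / of_nat (Suc n) powr s)" for n
  proof -
    let ?a = "complex_of_real (A n)"
    have a0: "?a \<noteq> 0" using A[of n] by simp
    have g0: "s / 2 \<notin> \<int>\<^sub>\<le>\<^sub>0" "s / 2 + 1 \<notin> \<int>\<^sub>\<le>\<^sub>0" using s by (auto elim!: nonpos_Ints_cases simp: complex_eq_iff)
    have G1: "Gamma ?t1 = s / 2 * Gamma (s / 2)" by (rule Gamma_plus1[OF g0(1)])
    have G2: "Gamma ?t2 = (s / 2 + 1) * (s / 2 * Gamma (s / 2))"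
      using Gamma_plus1[OF g0(2)] G1 by (simp add: add.assoc)
    have p1: "?a * ?a powr (- ?t1) = ?a powr (- (s / 2))"
      using a0 by (simp add: powr_diff diff_conv_add_uminus[symmetric] minus_add_distrib)
    have p2: "?a ^ 2 * ?a powr (- ?t2) = ?a powr (- (s / 2))"
    proof -
      have "- ?t2 = - (s / 2) - 2" by simp
      then have "?a powr (- ?t2) = ?a powr (- (s / 2)) / ?a powr 2" by (simp only: powr_diff)
      moreover have "?a powr 2 = ?a ^ 2" using a0 powr_nat'[of ?a 2] by simp
      ultimately show ?thesis using a0 by simp
    qed
    have "(LINT u|lborel. T n u) = 8 * ?a ^ 2 * (LINT u|lborel. k ?t2 n u) - 12 * ?a * (LINT u|lborel. k ?t1 n u)"
      unfolding Tk using ik t by (subst Bochner_Integration.integral_diff) auto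
    also have "\<dots> = 4 * (?a ^ 2 * ?a powr (- ?t2)) * Gamma ?t2 - 6 * (?a * ?a powr (- ?t1)) * Gamma ?t1"
      unfolding vk[OF t(1)] vk[OF t(2)] by simp
    also have "\<dots> = ?a powr (- (s / 2)) * (s * (s - 1) * Gamma (s / 2))"
      unfolding p1 p2 G1 G2 by (simp add: field_simps)
    also have "?a powr (- (s / 2)) = of_real pi powr (- s / 2) * (1 / of_nat (Suc n) powr s)"
    proof -
      have "?a powr (- (s / 2)) = of_real pi powr (- (s / 2)) * of_real (real (Suc n) ^ 2) powr (- (s / 2))"
        unfolding A_def of_real_mult by (rule powr_times_real) auto
      moreover have "complex_of_real (real (Suc n) ^ 2) powr (- (s / 2)) = 1 / of_nat (Suc n) powr s"
      proof -
        have "complex_of_real (real (Suc n) ^ 2) = of_nat (Suc n) * of_nat (Suc n)" by (simp add: power2_eq_square)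
        then have "complex_of_real (real (Suc n) ^ 2) powr (- (s / 2)) = of_nat (Suc n) powr (- (s / 2)) * of_nat (Suc n) powr (- (s / 2))"
          using powr_times_real[of "of_nat (Suc n)" "of_nat (Suc n)" "- (s / 2)"] by simp
        also have "\<dots> = of_nat (Suc n) powr (- s)" unfolding powr_add[symmetric] by simp
        finally show ?thesis by (simp add: powr_minus field_simps del: of_nat_Suc)
      qed
      ultimately show ?thesis by simp
    qed
    finally show ?thesis by (simp only: mult_ac)
  qed
  have "(\<lambda>n. LINT u|lborel. T n u) sums (LINT u|lborel. (\<Sum>n. T n u))"
  proof (rule sums_integral[OF iT])
    show "AE u in lborel. summable (\<lambda>n. norm (T n u))"
    proof (intro AE_I2)
      fix u
      have "summable (\<lambda>n. \<bar>exp (u / 2) * ((8 * (A n * exp (2 * u)) ^ 2 - 12 * (A n * exp (2 * u))) * exp (- (A n * exp (2 * u))))\<bar> * norm (exp (\<i> * (- \<i> * (s - 1/2)) * complex_of_real u)))"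
        using summable_xi_kernel_terms[of u] unfolding A_def by (rule summable_mult2)
      then show "summable (\<lambda>n. norm (T n u))" unfolding T_def norm_mult[of "complex_of_real _"] norm_of_real .
    qed
    define c1 where "c1 = Re (Gamma (of_real (Re ?t1))) / 2"
    define c2 where "c2 = Re (Gamma (of_real (Re ?t2))) / 2"
    \<comment> \<open>Both contributions scale like \<open>A n powr (- Re s / 2)\<close>, that is
      like \<open>real (Suc n) powr (- Re s)\<close>; hence the restriction to
      \<open>1 < Re s\<close>.\<close>
    show "summable (\<lambda>n. LINT u|lborel. norm (T n u))"
    proof (rule summable_comparison_test')
      have "summable (\<lambda>n. real n powr (- Re s))" using s by (subst summable_real_powr_iff) simp
      then have "summable (\<lambda>n. real (Suc n) powr (- Re s))" by (subst summable_Suc_iff)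
      then show "summable (\<lambda>n. (8 * c2 + 12 * c1) * pi powr (- Re s / 2) * real (Suc n) powr (- Re s))" by (rule summable_mult)
      fix n :: nat assume "0 \<le> n"
      have "(LINT u|lborel. norm (T n u)) \<le> (LINT u|lborel. 8 * A n ^ 2 * norm (k ?t2 n u) + 12 * A n * norm (k ?t1 n u))"
      proof (rule integral_mono)
        show "integrable lborel (\<lambda>u. norm (T n u))" by (intro integrable_norm iT)
        show "integrable lborel (\<lambda>u. 8 * A n ^ 2 * norm (k ?t2 n u) + 12 * A n * norm (k ?t1 n u))"
          by (intro Bochner_Integration.integrable_add integrable_mult_right integrable_norm ik t)
        show "norm (T n u) \<le> 8 * A n ^ 2 * norm (k ?t2 n u) + 12 * A n * norm (k ?t1 n u)" for u
          unfolding Tk by (rule order_trans[OF norm_triangle_ineq4]) (use A[of n] in \<open>simp add: norm_mult norm_power\<close>)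
      qed
      also have "\<dots> = 8 * A n ^ 2 * (LINT u|lborel. norm (k ?t2 n u)) + 12 * A n * (LINT u|lborel. norm (k ?t1 n u))"
        using integrable_norm[OF ik[OF t(1)]] integrable_norm[OF ik[OF t(2)]] by (subst Bochner_Integration.integral_add) auto
      also have "\<dots> = 8 * (A n ^ 2 * A n powr (- Re ?t2)) * c2 + 12 * (A n * A n powr (- Re ?t1)) * c1"
        unfolding nk[OF t(1)] nk[OF t(2)] c1_def c2_def by simp
      also have "A n ^ 2 * A n powr (- Re ?t2) = A n powr (- Re s / 2)"
        using A[of n] powr_realpow[of "A n" 2] powr_add[of "A n" 2 "- Re ?t2"] by simp
      also have "A n * A n powr (- Re ?t1) = A n powr (- Re s / 2)"
        using A[of n] powr_add[of "A n" 1 "- Re ?t1"] by simp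
      also have "8 * A n powr (- Re s / 2) * c2 + 12 * A n powr (- Re s / 2) * c1 = (8 * c2 + 12 * c1) * A n powr (- Re s / 2)" by (simp add: algebra_simps)
      also have "A n powr (- Re s / 2) = pi powr (- Re s / 2) * real (Suc n) powr (- Re s)"
      proof -
        have "(real (Suc n) ^ 2) powr (- Re s / 2) = real (Suc n) powr (- Re s)"
          using powr_realpow[of "real (Suc n)" 2] by (simp add: powr_powr flip: powr_numeral del: of_nat_Suc)
        then show ?thesis unfolding A_def by (subst powr_mult) auto
      qed
      finally have "(LINT u|lborel. norm (T n u)) \<le> (8 * c2 + 12 * c1) * pi powr (- Re s / 2) * real (Suc n) powr (- Re s)" by (simp only: mult.assoc)
      then show "norm (LINT u|lborel. norm (T n u)) \<le> (8 * c2 + 12 * c1) * pi powr (- Re s / 2) * real (Suc n) powr (- Re s)"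
        by (simp only: real_norm_def abs_of_nonneg[OF integral_nonneg_AE[of "\<lambda>u. norm (T n u)" lborel]] eventually_True norm_ge_zero simp_thms)
    qed
  qed
  moreover have "(\<Sum>n. T n u) = complex_of_real (xi_density u) * exp (\<i> * (- \<i> * (s - 1/2)) * complex_of_real u)" for u
  proof -
    have "(\<lambda>n. T n u) sums (complex_of_real (xi_density u) * exp (\<i> * (- \<i> * (s - 1/2)) * complex_of_real u))"
      unfolding T_def A_def by (intro sums_mult2) (simp only: sums_of_real_iff xi_density_sums)
    then show ?thesis by (simp add: sums_iff)
  qed
  ultimately have "(\<lambda>n. LINT u|lborel. T n u) sums Xi (- \<i> * (s - 1/2))"
    by (simp add: Xi_def fourier_laplace_def)
  moreover have "(\<lambda>n. s * (s - 1) * of_real pi powr (- s / 2) * Gamma (s / 2) * (1 / of_nat (Suc n) powr s)) sums (s * (s - 1) * of_real pi powr (- s / 2) * Gamma (s / 2) * zeta_series s)"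
  proof (intro sums_mult)
    have "summable (\<lambda>n. 1 / of_nat n powr s)" using summable_norm_cancel[OF summable_zeta_terms[OF s]] .
    then have "summable (\<lambda>n. 1 / of_nat (Suc n) powr s)" by (subst summable_Suc_iff)
    then show "(\<lambda>n. 1 / of_nat (Suc n) powr s) sums zeta_series s" unfolding zeta_series_def by (rule summable_sums)
  qed
  ultimately show ?thesis unfolding vT by (rule sums_unique2)
qed

text \<open>The transform provides the existence that the definite description presupposes;
  uniqueness is analytic continuation from \<open>Re s > 1\<close>.\<close>

theorem riemann_xi_eq_Xi: "riemann_xi s = Xi (- \<i> * (s - 1/2)) / 2"
proof -
  let ?X = "\<lambda>s. Xi (- \<i> * (s - 1/2)) / 2"
  have hol: "?X holomorphic_on UNIV"
    by (intro holomorphic_intros holomorphic_on_compose_gen[OF _ Xi_entire, unfolded o_def]) auto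
  have "riemann_xi = ?X"
    unfolding riemann_xi_def
  proof (rule the_equality)
    show "?X holomorphic_on UNIV \<and> (\<forall>s. 1 < Re s \<longrightarrow> ?X s = 1/2 * s * (s - 1) * (of_real pi) powr (- s / 2) * Gamma (s / 2) * zeta_series s)"
      using hol Xi_eq_zeta by simp
    fix f assume f: "f holomorphic_on UNIV \<and> (\<forall>s. 1 < Re s \<longrightarrow> f s = 1/2 * s * (s - 1) * (of_real pi) powr (- s / 2) * Gamma (s / 2) * zeta_series s)"
    show "f = ?X"
    proof
      fix s
      show "f s = ?X s"
      proof (rule analytic_continuation_open[of "{s. 1 < Re s}" UNIV f ?X])
        show "f z = ?X z" if "z \<in> {s. 1 < Re s}" for z using f Xi_eq_zeta[of z] that by simp
        show "{s::complex. 1 < Re s} \<noteq> {}" by (auto intro: exI[of _ 2])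
      qed (use f hol in \<open>auto intro: open_halfspace_Re_gt\<close>)
    qed
  qed
  from fun_cong[OF this, of s] show ?thesis .
qed

text \<open>The range \<open>Im z < - 1/2\<close> corresponds to \<open>Re s > 1\<close>, where no
  factor of the zeta formula vanishes; evenness covers \<open>Im z > 1/2\<close>.\<close>

lemma Xi_zeros_strip:
  assumes "Xi z = 0"
  shows "\<bar>Im z\<bar> \<le> 1/2"
proof -
  have nz: "Xi z \<noteq> 0" if z: "Im z < - 1/2" for z
  proof -
    define s where "s = 1/2 + \<i> * z"
    have s: "1 < Re s" using z by (simp add: s_def)
    have "- \<i> * (s - 1/2) = z" by (simp add: s_def mult.assoc[symmetric])
    moreover have "s * (s - 1) * of_real pi powr (- s / 2) * Gamma (s / 2) * zeta_series s \<noteq> 0"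
    proof -
      have "s / 2 \<notin> \<int>\<^sub>\<le>\<^sub>0" using s by (auto elim!: nonpos_Ints_cases simp: complex_eq_iff)
      then have "Gamma (s / 2) \<noteq> 0" by (simp add: Gamma_eq_zero_iff)
      moreover have "s \<noteq> 0" "s \<noteq> 1" using s by auto
      ultimately show ?thesis using zeta_series_nonzero[OF s] by simp
    qed
    ultimately show ?thesis using Xi_eq_zeta[OF s] by simp
  qed
  show ?thesis using nz[of z] nz[of "- z"] assms Xi_even[of z] by (fastforce simp: abs_if)
qed

theorem Xi_strip_limit: "strip_limit (1/2) Xi"
proof -
  obtain C where "C > 0" "\<And>z. norm (Xi z) \<le> C * exp (norm z powr (3/2))" using Xi_growth by blast
  then show ?thesis
    using strip_limit_of_growth[OF Xi_entire Xi_even Xi_cnj Xi_0] Xi_zeros_strip by blast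
qed

text \<open>Cauchy's theorem on long rectangles, phrased with a primitive \<open>P\<close> on the
  convex strip: horizontal integrals are differences of values of \<open>P\<close>, and the vertical
  sides vanish in the limit.\<close>

lemma Xi_shift:
  fixes \<alpha> t :: real
  assumes \<alpha>: "\<bar>\<alpha>\<bar> < pi / 4"
  shows "fourier_laplace (\<lambda>u. xi_kernel (Complex u \<alpha>)) (complex_of_real t) = Xi (complex_of_real t) * complex_of_real (exp (\<alpha> * t))"
    and "integrable lborel (\<lambda>u. xi_kernel (Complex u \<alpha>))"
proof -
  obtain B where B: "B > 0" "\<And>z. \<bar>Im z\<bar> \<le> \<bar>\<alpha>\<bar> \<Longrightarrow> norm (xi_kernel z) * exp (0 * (Re z)\<^sup>2 + \<bar>Re z\<bar> ^ 3) \<le> B * exp (- (Re z)\<^sup>2 / 2)"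
    by (rule xi_kernel_shift_bound[of "\<bar>\<alpha>\<bar>" 0]) (use \<alpha> in auto)
  have bd: "norm (xi_kernel z) \<le> B * exp (- (Re z)\<^sup>2 / 2)" if "\<bar>Im z\<bar> \<le> \<bar>\<alpha>\<bar>" for z
  proof -
    have "norm (xi_kernel z) * 1 \<le> norm (xi_kernel z) * exp (0 * (Re z)\<^sup>2 + \<bar>Re z\<bar> ^ 3)" by (intro mult_left_mono) auto
    then show ?thesis using B(2)[OF that] by simp
  qed
  have strip: "z \<in> theta_strip" if "\<bar>Im z\<bar> \<le> \<bar>\<alpha>\<bar>" for z using that \<alpha> by (simp add: theta_strip_def)
  define H where "H z = xi_kernel z * exp (\<i> * complex_of_real t * z)" for z
  have holH: "H holomorphic_on theta_strip" unfolding H_def by (intro holomorphic_intros xi_kernel_holomorphic)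
  have cont: "continuous_on UNIV (\<lambda>u. f (Complex u \<beta>))" if "f holomorphic_on theta_strip" "\<bar>\<beta>\<bar> \<le> \<bar>\<alpha>\<bar>" for \<beta> f
    by (rule continuous_on_compose2[OF holomorphic_on_imp_continuous_on[OF that(1)]])
       (use that strip in \<open>auto simp: Complex_eq intro!: continuous_intros\<close>)
  obtain P where P: "\<And>z. z \<in> theta_strip \<Longrightarrow> (P has_field_derivative H z) (at z within theta_strip)"
    using holomorphic_convex_primitive'[OF convex_theta_strip open_theta_strip holH] by blast
  have Pd: "(P has_field_derivative H z) (at z)" if "z \<in> theta_strip" for z
    using P[OF that] at_within_open[OF that open_theta_strip] by simp
  define E where "E = exp (\<bar>t\<bar> * \<bar>\<alpha>\<bar>)"
  have Hb: "norm (H z) \<le> B * E * exp (- (Re z)\<^sup>2 / 2)" if z: "\<bar>Im z\<bar> \<le> \<bar>\<alpha>\<bar>" for z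
  proof -
    have "- (t * Im z) \<le> \<bar>t\<bar> * \<bar>Im z\<bar>" by (metis abs_ge_minus_self abs_mult)
    also have "\<dots> \<le> \<bar>t\<bar> * \<bar>\<alpha>\<bar>" using z by (intro mult_left_mono) auto
    finally have "norm (exp (\<i> * complex_of_real t * z)) \<le> E" by (simp add: E_def)
    then have "norm (H z) \<le> (B * exp (- (Re z)\<^sup>2 / 2)) * E"
      unfolding H_def norm_mult using bd[OF z] B(1) by (intro mult_mono) auto
    then show ?thesis by (simp only: mult_ac)
  qed
  have int: "integrable lborel (\<lambda>u. f (Complex u \<beta>))" if "f holomorphic_on theta_strip" "\<bar>\<beta>\<bar> \<le> \<bar>\<alpha>\<bar>" "\<And>z. \<bar>Im z\<bar> \<le> \<bar>\<alpha>\<bar> \<Longrightarrow> norm (f z) \<le> K * exp (- (Re z)\<^sup>2 / 2)" for f \<beta> K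
  proof (rule Bochner_Integration.integrable_bound)
    show "integrable lborel (\<lambda>u::real. K * exp (- u\<^sup>2 / 2))" by (intro integrable_mult_right integrable_exp_minus_half_square)
    show "(\<lambda>u. f (Complex u \<beta>)) \<in> borel_measurable lborel" using cont[OF that(1,2)] by (simp add: borel_measurable_continuous_onI)
    show "AE u in lborel. norm (f (Complex u \<beta>)) \<le> norm (K * exp (- u\<^sup>2 / 2))"
    proof (intro AE_I2)
      fix u
      have "norm (f (Complex u \<beta>)) \<le> K * exp (- u\<^sup>2 / 2)" using that(3)[of "Complex u \<beta>"] that(2) by simp
      then show "norm (f (Complex u \<beta>)) \<le> norm (K * exp (- u\<^sup>2 / 2))"
        unfolding real_norm_def by (rule order_trans[OF _ abs_ge_self])
    qed
  qed
  show "integrable lborel (\<lambda>u. xi_kernel (Complex u \<alpha>))" by (rule int[OF xi_kernel_holomorphic _ bd]) simp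
  have ftc: "integral {-b..b} (\<lambda>u. H (Complex u \<beta>)) = P (Complex b \<beta>) - P (Complex (-b) \<beta>)" if "\<bar>\<beta>\<bar> \<le> \<bar>\<alpha>\<bar>" "b \<ge> 0" for b \<beta>
  proof (rule integral_unique, rule fundamental_theorem_of_calculus)
    fix u :: real assume "u \<in> {-b..b}"
    have "((\<lambda>u. P (Complex u \<beta>)) has_vector_derivative (1 * H (Complex u \<beta>))) (at u)"
    proof (rule field_vector_diff_chain_at[of "\<lambda>u. Complex u \<beta>" 1 u P, unfolded o_def])
      show "((\<lambda>u. Complex u \<beta>) has_vector_derivative 1) (at u)"
        unfolding Complex_eq by (auto intro!: derivative_eq_intros)
      show "(P has_field_derivative H (Complex u \<beta>)) (at (Complex u \<beta>))" by (rule Pd[OF strip]) (use that in simp)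
    qed
    then show "((\<lambda>u. P (Complex u \<beta>)) has_vector_derivative H (Complex u \<beta>)) (at u within {-b..b})"
      by (simp add: has_vector_derivative_at_within)
  qed (use that in simp)
  \<comment> \<open>The vertical side is estimated by the mean value inequality for
    \<open>P\<close>, whose derivative \<open>H\<close> has Gaussian decay in
    \<open>b\<close>.\<close>
  have side: "norm (P (Complex b \<alpha>) - P (Complex b 0)) \<le> B * E * exp (- b\<^sup>2 / 2) * \<bar>\<alpha>\<bar>" for b
  proof -
    let ?S = "{z. Re z = b \<and> \<bar>Im z\<bar> \<le> \<bar>\<alpha>\<bar>}"
    have S: "?S = {z. Re z = b} \<inter> ({z. Im z \<le> \<bar>\<alpha>\<bar>} \<inter> {z. Im z \<ge> - \<bar>\<alpha>\<bar>})" by auto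
    have "norm (P (Complex b \<alpha>) - P (Complex b 0)) \<le> B * E * exp (- b\<^sup>2 / 2) * norm (Complex b \<alpha> - Complex b 0)"
    proof (rule field_differentiable_bound[of ?S P H])
      show "convex ?S" unfolding S by (intro convex_Int convex_halfspace_Im_le convex_halfspace_Im_ge) (auto simp: convex_def simp flip: distrib_right)
      show "(P has_field_derivative H z) (at z within ?S)" if "z \<in> ?S" for z
        using Pd[OF strip, of z] that by (auto intro: has_field_derivative_at_within)
      show "norm (H z) \<le> B * E * exp (- b\<^sup>2 / 2)" if "z \<in> ?S" for z using Hb[of z] that by auto
    qed auto
    also have "norm (Complex b \<alpha> - Complex b 0) = \<bar>\<alpha>\<bar>" by (simp add: cmod_def)
    finally show ?thesis .
  qed
  have LINT_eq: "(LINT u|lborel. H (Complex u \<alpha>)) = (LINT u|lborel. H (Complex u 0))"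
  proof -
    let ?N = "\<lambda>N. real N + 1/2"
    have l1: "(\<lambda>N. integral {-?N N..?N N} (\<lambda>u. H (Complex u \<beta>))) \<longlonglongrightarrow> (LINT u|lborel. H (Complex u \<beta>))" if "\<bar>\<beta>\<bar> \<le> \<bar>\<alpha>\<bar>" for \<beta>
      by (rule integral_symmetric_interval_tendsto[OF int[OF holH that Hb]])
    have "(\<lambda>N. integral {-?N N..?N N} (\<lambda>u. H (Complex u \<alpha>)) - integral {-?N N..?N N} (\<lambda>u. H (Complex u 0))) \<longlonglongrightarrow> 0"
    proof (rule Lim_null_comparison)
      have "(\<lambda>N. 2 * (B * E * \<bar>\<alpha>\<bar>) * exp (- (?N N)\<^sup>2 / 2)) \<longlonglongrightarrow> 2 * (B * E * \<bar>\<alpha>\<bar>) * 0"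
        by (intro tendsto_mult tendsto_const) real_asymp
      then show "(\<lambda>N. 2 * (B * E * \<bar>\<alpha>\<bar>) * exp (- (?N N)\<^sup>2 / 2)) \<longlonglongrightarrow> 0" by simp
      show "\<forall>\<^sub>F N in sequentially. norm (integral {-?N N..?N N} (\<lambda>u. H (Complex u \<alpha>)) - integral {-?N N..?N N} (\<lambda>u. H (Complex u 0))) \<le> 2 * (B * E * \<bar>\<alpha>\<bar>) * exp (- (?N N)\<^sup>2 / 2)"
      proof (intro always_eventually allI)
        fix N
        let ?b = "?N N"
        have "integral {-?b..?b} (\<lambda>u. H (Complex u \<alpha>)) - integral {-?b..?b} (\<lambda>u. H (Complex u 0)) =
           (P (Complex ?b \<alpha>) - P (Complex ?b 0)) - (P (Complex (-?b) \<alpha>) - P (Complex (-?b) 0))"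
          using ftc[of \<alpha> ?b] ftc[of 0 ?b] by simp
        also have "norm \<dots> \<le> B * E * exp (- ?b\<^sup>2 / 2) * \<bar>\<alpha>\<bar> + B * E * exp (- (-?b)\<^sup>2 / 2) * \<bar>\<alpha>\<bar>"
          by (rule order_trans[OF norm_triangle_ineq4 add_mono[OF side side]])
        also have "\<dots> = 2 * (B * E * \<bar>\<alpha>\<bar>) * exp (- ?b\<^sup>2 / 2)" unfolding power2_minus by simp
        finally show "norm (integral {-?b..?b} (\<lambda>u. H (Complex u \<alpha>)) - integral {-?b..?b} (\<lambda>u. H (Complex u 0))) \<le> 2 * (B * E * \<bar>\<alpha>\<bar>) * exp (- ?b\<^sup>2 / 2)" .
      qed
    qed
    moreover have "(\<lambda>N. integral {-?N N..?N N} (\<lambda>u. H (Complex u \<alpha>)) - integral {-?N N..?N N} (\<lambda>u. H (Complex u 0))) \<longlonglongrightarrow> (LINT u|lborel. H (Complex u \<alpha>)) - (LINT u|lborel. H (Complex u 0))"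
      by (intro tendsto_diff l1) auto
    ultimately show ?thesis using LIMSEQ_unique by fastforce
  qed
  have H0: "H (Complex u 0) = complex_of_real (xi_density u) * exp (\<i> * complex_of_real t * complex_of_real u)" for u
    by (simp add: H_def xi_kernel_of_real flip: complex_of_real_def)
  have H\<alpha>: "xi_kernel (Complex u \<alpha>) * exp (\<i> * complex_of_real t * complex_of_real u) = complex_of_real (exp (\<alpha> * t)) * H (Complex u \<alpha>)" for u
  proof -
    have "complex_of_real (exp (\<alpha> * t)) = exp (complex_of_real \<alpha> * complex_of_real t)"
      using exp_of_real[of "\<alpha> * t", where 'a=complex] by simp
    then show ?thesis unfolding H_def Complex_eq by (simp add: exp_add[symmetric] algebra_simps)
  qed
  show "fourier_laplace (\<lambda>u. xi_kernel (Complex u \<alpha>)) (complex_of_real t) = Xi (complex_of_real t) * complex_of_real (exp (\<alpha> * t))"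
    unfolding fourier_laplace_def H\<alpha> integral_mult_right_zero LINT_eq H0 by (simp add: Xi_def fourier_laplace_def)
qed

text \<open>Shifting the line by \<open>a\<close> in the direction given by the sign of
  \<open>t\<close> multiplies the transform by \<open>exp (a * \<bar>t\<bar>)\<close>, while its
  norm stays below an integral that is independent of \<open>t\<close>.\<close>

lemma Xi_decay:
  assumes a: "0 \<le> a" "a < pi / 4"
  obtains K where "K > 0" "\<And>t. norm (Xi (complex_of_real t)) \<le> K * exp (- a * \<bar>t\<bar>)"
proof -
  define I where "I \<alpha> = (LINT u|lborel. norm (xi_kernel (Complex u \<alpha>)))" for \<alpha>
  have I0: "I \<alpha> \<ge> 0" for \<alpha> unfolding I_def by (intro integral_nonneg_AE) auto
  have le: "norm (Xi (complex_of_real t)) * exp (\<alpha> * t) \<le> I \<alpha>" if "\<bar>\<alpha>\<bar> < pi / 4" for \<alpha> t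
  proof -
    have "norm (Xi (complex_of_real t)) * exp (\<alpha> * t) = norm (fourier_laplace (\<lambda>u. xi_kernel (Complex u \<alpha>)) (complex_of_real t))"
      unfolding Xi_shift(1)[OF that] by (simp only: norm_mult norm_of_real abs_exp_cancel)
    also have "\<dots> \<le> (LINT u|lborel. norm (xi_kernel (Complex u \<alpha>) * exp (\<i> * complex_of_real t * complex_of_real u)))"
      unfolding fourier_laplace_def by (rule integral_norm_bound)
    also have "\<dots> = I \<alpha>" unfolding I_def by (simp add: norm_mult)
    finally show ?thesis .
  qed
  show ?thesis
  proof (rule that[of "I a + I (- a) + 1"])
    show "I a + I (- a) + 1 > 0" using I0[of a] I0[of "- a"] by linarith
    fix t :: real
    define \<alpha> where "\<alpha> = (if t \<ge> 0 then a else - a)"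
    have \<alpha>: "\<alpha> = a \<or> \<alpha> = - a" "\<alpha> * t = a * \<bar>t\<bar>" by (auto simp: \<alpha>_def abs_if)
    have "norm (Xi (complex_of_real t)) * exp (a * \<bar>t\<bar>) \<le> I \<alpha>" using le[of \<alpha> t] \<alpha> a by auto
    also have "I \<alpha> \<le> I a + I (- a) + 1" using \<alpha> I0[of a] I0[of "- a"] by auto
    finally show "norm (Xi (complex_of_real t)) \<le> (I a + I (- a) + 1) * exp (- a * \<bar>t\<bar>)"
      by (simp add: exp_minus field_simps)
  qed
qed

section \<open>Integrals of Xi over the real line\<close>

lemma integrable_exp_neg_abs:
  fixes c :: real
  assumes c: "c > 0"
  shows "integrable lborel (\<lambda>t. exp (- c * \<bar>t\<bar>))"
proof (rule Bochner_Integration.integrable_bound)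
  have "integrable lborel (\<lambda>x::real. inverse (1 + x\<^sup>2))"
    using integrable_inverse_1_plus_square by (simp add: set_integrable_def)
  then show "integrable lborel (\<lambda>x::real. (1 + 2 / c\<^sup>2) * inverse (1 + x\<^sup>2))" by (rule integrable_mult_right)
  show "AE t in lborel. norm (exp (- c * \<bar>t\<bar>)) \<le> norm ((1 + 2 / c\<^sup>2) * inverse (1 + t\<^sup>2))"
  proof (intro AE_I2)
    fix t :: real
    define x where "x = c * \<bar>t\<bar>"
    have "1 + x + x\<^sup>2 / 2 \<le> exp x" by (rule exp_lower_Taylor_quadratic) (use c in \<open>simp add: x_def\<close>)
    moreover have "x \<ge> 0" "x\<^sup>2 = c\<^sup>2 * t\<^sup>2" using c by (auto simp: x_def power_mult_distrib)
    ultimately have "1 \<le> exp x" "c\<^sup>2 * t\<^sup>2 \<le> 2 * exp x" using zero_le_power2[of x] by linarith+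
    then have t2: "t\<^sup>2 \<le> 2 / c\<^sup>2 * exp x" using c by (simp add: field_simps)
    have "1 + t\<^sup>2 \<le> (1 + 2 / c\<^sup>2) * exp x"
      using add_mono[OF \<open>1 \<le> exp x\<close> t2] by (simp only: distrib_right mult_1_left)
    moreover have "1 + t\<^sup>2 > 0" by (simp add: add_pos_nonneg)
    ultimately have "exp (- x) \<le> (1 + 2 / c\<^sup>2) * inverse (1 + t\<^sup>2)" by (simp add: exp_minus field_simps)
    then show "norm (exp (- c * \<bar>t\<bar>)) \<le> norm ((1 + 2 / c\<^sup>2) * inverse (1 + t\<^sup>2))"
      by (simp add: x_def abs_mult)
  qed
qed measurable

lemma Xi_real_continuous: "continuous_on A (\<lambda>t. Xi (complex_of_real t))"
  by (rule continuous_on_compose2[OF holomorphic_on_imp_continuous_on[OF Xi_entire]]) (auto intro!: continuous_intros)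

lemma Xi_real_measurable [measurable]: "(\<lambda>t. Xi (complex_of_real t)) \<in> borel_measurable borel"
  using Xi_real_continuous by (rule borel_measurable_continuous_onI)

lemma Xi_exp_integrable:
  assumes "\<bar>\<alpha>\<bar> < pi / 4"
  shows "integrable lborel (\<lambda>t. Xi (complex_of_real t) * complex_of_real (exp (\<alpha> * t)))"
proof -
  \<comment> \<open>A decay rate strictly between \<open>\<bar>\<alpha>\<bar>\<close> and
    \<open>pi / 4\<close>, so that the exponential factor is outweighed.\<close>
  define a where "a = (\<bar>\<alpha>\<bar> + pi / 4) / 2"
  have a: "0 \<le> a" "a < pi / 4" "\<bar>\<alpha>\<bar> < a" using assms by (auto simp: a_def field_simps)
  obtain K where K: "K > 0" "\<And>t. norm (Xi (complex_of_real t)) \<le> K * exp (- a * \<bar>t\<bar>)" using Xi_decay[OF a(1,2)] by blast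
  have "integrable lborel (\<lambda>t. K * exp (- (a - \<bar>\<alpha>\<bar>) * \<bar>t\<bar>))" using a by (intro integrable_mult_right integrable_exp_neg_abs) auto
  then show ?thesis
  proof (rule Bochner_Integration.integrable_bound)
    show "AE t in lborel. norm (Xi (complex_of_real t) * complex_of_real (exp (\<alpha> * t))) \<le> norm (K * exp (- (a - \<bar>\<alpha>\<bar>) * \<bar>t\<bar>))"
    proof (intro AE_I2)
      fix t
      have "\<alpha> * t \<le> \<bar>\<alpha>\<bar> * \<bar>t\<bar>" by (metis abs_ge_self abs_mult)
      then have "norm (Xi (complex_of_real t)) * exp (\<alpha> * t) \<le> (K * exp (- a * \<bar>t\<bar>)) * exp (\<bar>\<alpha>\<bar> * \<bar>t\<bar>)"
        using K by (intro mult_mono) auto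
      also have "\<dots> = K * exp (- (a - \<bar>\<alpha>\<bar>) * \<bar>t\<bar>)" by (simp add: algebra_simps flip: exp_add)
      finally show "norm (Xi (complex_of_real t) * complex_of_real (exp (\<alpha> * t))) \<le> norm (K * exp (- (a - \<bar>\<alpha>\<bar>) * \<bar>t\<bar>))"
        using K(1) by (simp add: norm_mult)
    qed
  qed measurable
qed

lemma Xi_power_integrable: "integrable lborel (\<lambda>t. Xi (complex_of_real t) ^ Suc n)"
proof -
  have h: "0 \<le> (1/2::real)" "1/2 < pi / 4" using pi_gt3 by auto
  obtain K where K: "K > 0" "\<And>t. norm (Xi (complex_of_real t)) \<le> K * exp (- (1/2) * \<bar>t\<bar>)" using Xi_decay[OF h] by blast
  have "integrable lborel (\<lambda>t. K ^ Suc n * exp (- (1/2) * \<bar>t\<bar>))" by (intro integrable_mult_right integrable_exp_neg_abs) auto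
  then show ?thesis
  proof (rule Bochner_Integration.integrable_bound)
    show "AE t in lborel. norm (Xi (complex_of_real t) ^ Suc n) \<le> norm (K ^ Suc n * exp (- (1/2) * \<bar>t\<bar>))"
    proof (intro AE_I2)
      fix t
      have "norm (Xi (complex_of_real t)) ^ Suc n \<le> (K * exp (- (1/2) * \<bar>t\<bar>)) ^ Suc n" by (intro power_mono K) auto
      also have "\<dots> = K ^ Suc n * exp (- (1/2) * \<bar>t\<bar>) ^ Suc n" by (rule power_mult_distrib)
      also have "\<dots> \<le> K ^ Suc n * exp (- (1/2) * \<bar>t\<bar>)"
        using K(1) power_decreasing[of 1 "Suc n" "exp (- (1/2) * \<bar>t\<bar>)"] by (intro mult_left_mono) auto
      finally show "norm (Xi (complex_of_real t) ^ Suc n) \<le> norm (K ^ Suc n * exp (- (1/2) * \<bar>t\<bar>))"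
        using K(1) by (simp add: norm_power abs_mult del: power_Suc)
    qed
  qed measurable
qed

text \<open>Fourier inversion at the origin for the kernel on a shifted line: a real exponential
  weight on one side is an imaginary shift on the other.\<close>

lemma Xi_exp_integral:
  assumes \<alpha>: "\<bar>\<alpha>\<bar> < pi / 4"
  shows "(LINT t|lborel. Xi (complex_of_real t) * complex_of_real (exp (\<alpha> * t))) = 2 * pi * xi_kernel (Complex 0 \<alpha>)"
proof -
  obtain C \<kappa> where C: "\<kappa> > 0" "C > 0" "\<And>z. \<bar>Im z\<bar> \<le> \<bar>\<alpha>\<bar> \<Longrightarrow> norm (xi_kernel z) \<le> C * exp (- \<kappa> * exp \<bar>Re z\<bar>)"
    by (rule xi_kernel_bound[of "\<bar>\<alpha>\<bar>"]) (use \<alpha> in auto)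
  have "(LINT t|lborel. fourier_laplace (\<lambda>u. xi_kernel (Complex u \<alpha>)) (complex_of_real t) * exp (- \<i> * complex_of_real (t * 0))) = 2 * pi * xi_kernel (Complex 0 \<alpha>)"
  proof (rule fourier_inversion)
    show "continuous_on UNIV (\<lambda>u. xi_kernel (Complex u \<alpha>))"
      by (rule continuous_on_compose2[OF holomorphic_on_imp_continuous_on[OF xi_kernel_holomorphic]])
         (use \<alpha> in \<open>auto simp: Complex_eq theta_strip_def intro!: continuous_intros\<close>)
    show "norm (xi_kernel (Complex u \<alpha>)) \<le> C * 1" for u
      by (rule order_trans[OF C(3)]) (use C in \<open>auto intro!: mult_left_mono\<close>)
    show "integrable lborel (\<lambda>u. xi_kernel (Complex u \<alpha>))" by (rule Xi_shift(2)[OF \<alpha>])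
    show "integrable lborel (\<lambda>t. fourier_laplace (\<lambda>u. xi_kernel (Complex u \<alpha>)) (complex_of_real t))"
      unfolding Xi_shift(1)[OF \<alpha>] by (rule Xi_exp_integrable[OF \<alpha>])
  qed
  then show ?thesis unfolding Xi_shift(1)[OF \<alpha>] by simp
qed

text \<open>The index is one less than the number of factors, so this density belongs to
  \<open>v_fun (Suc n)\<close>.\<close>

definition xi_power_density :: "nat \<Rightarrow> real \<Rightarrow> real" where
  "xi_power_density n = convolution_power xi_density n"

lemma nice_weight_xi_power_density: "nice_weight (xi_power_density n)"
  unfolding xi_power_density_def using nice_weight_convolution_power[OF nice_weight_xi_density] by blast

lemma fourier_xi_power_density: "fourier_laplace (\<lambda>u. complex_of_real (xi_power_density n u)) z = Xi z ^ Suc n"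
  unfolding xi_power_density_def Xi_def using nice_weight_convolution_power[OF nice_weight_xi_density] by blast

text \<open>On the line \<open>Re s = 1/2\<close> the integrand is \<open>1 / sqrt x\<close> times
  \<open>Xi y ^ Suc n\<close> times \<open>exp (\<i> * y * ln x)\<close>, so the defining integral
  is Fourier inversion of the convolution power at \<open>ln x\<close>.\<close>

lemma v_fun_eq:
  assumes x: "x > 0"
  shows "v_fun (Suc n) x = complex_of_real (xi_power_density n (ln x) / sqrt x)"
proof -
  let ?\<rho> = "xi_power_density n" and ?u = "ln x"
  have nw: "gauss_weight ?\<rho>" "continuous_on UNIV ?\<rho>" and pos: "\<And>u. ?\<rho> u > 0" using nice_weight_xi_power_density[of n] by (auto simp: nice_weight_def)
  obtain B where B: "\<And>u. ?\<rho> u \<le> B" using nice_weight_xi_power_density[of n] by (auto simp: nice_weight_def)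
  have inv: "(LINT t|lborel. Xi (complex_of_real t) ^ Suc n * exp (- \<i> * complex_of_real (t * ?u))) = 2 * pi * complex_of_real (?\<rho> ?u)"
    unfolding fourier_xi_power_density[symmetric]
  proof (rule fourier_inversion)
    show "continuous_on UNIV (\<lambda>u. complex_of_real (?\<rho> u))" by (intro continuous_intros nw)
    show "norm (complex_of_real (?\<rho> u)) \<le> B" for u using B[of u] pos[of u] by simp
    show "integrable lborel (\<lambda>u. complex_of_real (?\<rho> u))" using gauss_weight_integrable[OF nw(1)] by (simp add: complex_of_real_integrable_eq)
    show "integrable lborel (\<lambda>t. fourier_laplace (\<lambda>u. complex_of_real (?\<rho> u)) (complex_of_real t))"
      unfolding fourier_xi_power_density by (rule Xi_power_integrable)
  qed
  have "2 ^ Suc n * riemann_xi (Complex (1/2) y) ^ Suc n * (complex_of_real x) powr (Complex (1/2) y - 1)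
     = complex_of_real (1 / sqrt x) * (Xi (complex_of_real y) ^ Suc n * exp (\<i> * complex_of_real (y * ?u)))" for y
  proof -
    have "- \<i> * (Complex (1/2) y - 1/2) = complex_of_real y" by (simp add: complex_eq_iff)
    then have r: "riemann_xi (Complex (1/2) y) = Xi (complex_of_real y) / 2" by (simp only: riemann_xi_eq_Xi)
    have 1: "2 ^ Suc n * riemann_xi (Complex (1/2) y) ^ Suc n = Xi (complex_of_real y) ^ Suc n" unfolding r power_divide by simp
    have "(complex_of_real x) powr (Complex (1/2) y - 1) = exp ((Complex (1/2) y - 1) * complex_of_real ?u)"
      using x by (simp add: powr_def Ln_of_real)
    also have "(Complex (1/2) y - 1) * complex_of_real ?u = complex_of_real (- ?u / 2) + \<i> * complex_of_real (y * ?u)"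
      by (simp add: complex_eq_iff field_simps)
    also have "exp \<dots> = complex_of_real (exp (- ?u / 2)) * exp (\<i> * complex_of_real (y * ?u))" by (simp only: exp_add exp_of_real)
    also have "exp (- ?u / 2) = 1 / sqrt x"
    proof -
      have "exp (?u / 2) = sqrt x" using x exp_ln[of "sqrt x"] by (simp only: ln_sqrt real_sqrt_gt_zero)
      then show ?thesis by (simp add: exp_minus inverse_eq_divide)
    qed
    finally show ?thesis using 1 by (simp only: mult_ac)
  qed
  then have "v_fun (Suc n) x = complex_of_real (1 / (2 * pi)) * (complex_of_real (1 / sqrt x) * (LINT y|lborel. Xi (complex_of_real y) ^ Suc n * exp (\<i> * complex_of_real (y * ?u))))"
    unfolding v_fun_def by (simp only: integral_mult_right_zero)
  \<comment> \<open>The inversion formula carries the opposite sign in the exponent; reflection and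
    evenness of \<open>Xi\<close> reconcile the two.\<close>
  also have "(LINT y|lborel. Xi (complex_of_real y) ^ Suc n * exp (\<i> * complex_of_real (y * ?u))) = (LINT t|lborel. Xi (complex_of_real t) ^ Suc n * exp (- \<i> * complex_of_real (t * ?u)))"
    by (subst lborel_integral_real_affine[of "-1" _ 0]) (auto simp: Xi_even)
  also note inv
  finally show ?thesis by (simp add: field_simps)
qed

text \<open>With \<open>x = exp u\<close> the measure \<open>dx / x\<close> becomes
  \<open>du\<close>, and \<open>sqrt x\<close> cancels the \<open>1 / sqrt x\<close> of
  \<open>v_fun\<close>.\<close>

theorem F_fun_eq: "F_fun lam (Suc n) t = fourier_laplace (\<lambda>u. complex_of_real (xi_power_density n u * exp (lam * u\<^sup>2))) t"
proof -
  define \<Psi> where "\<Psi> u = complex_of_real (xi_power_density n u * exp (lam * u\<^sup>2)) * exp (\<i> * t * complex_of_real u)" for u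
  have [measurable]: "xi_power_density n \<in> borel_measurable borel"
    using nice_weight_xi_power_density[of n] gauss_weight_measurable by (auto simp: nice_weight_def)
  have [measurable]: "\<Psi> \<in> borel_measurable borel" unfolding \<Psi>_def by measurable
  have "F_fun lam (Suc n) t = (LINT x:{0<..}|lborel. \<Psi> (ln x) / complex_of_real x)"
    unfolding F_fun_def
  proof (rule set_lebesgue_integral_cong, simp, intro allI impI)
    fix x :: real assume "x \<in> {0<..}"
    then have x: "x > 0" by simp
    have "exp (complex_of_real (lam * (ln x)^2) + \<i> * t * complex_of_real (ln x)) = complex_of_real (exp (lam * (ln x)\<^sup>2)) * exp (\<i> * t * complex_of_real (ln x))"
      by (simp only: exp_add exp_of_real)
    then show "exp (complex_of_real (lam * (ln x)^2) + \<i> * t * complex_of_real (ln x)) * complex_of_real (sqrt x) * v_fun (Suc n) x / complex_of_real x = \<Psi> (ln x) / complex_of_real x"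
      using x by (simp add: v_fun_eq \<Psi>_def)
  qed
  also have "\<dots> = (LINT u|lborel. complex_of_real (1 * 1 * exp (1 * u)) * (\<Psi> (ln (1 * exp (1 * u))) / complex_of_real (1 * exp (1 * u))))"
    by (rule exp_change_of_variables(2)) auto
  also have "\<dots> = (LINT u|lborel. \<Psi> u)" by simp
  finally show ?thesis by (simp add: \<Psi>_def fourier_laplace_def)
qed

text \<open>Powers of \<open>Xi\<close> keep the strip of half-width 1/2, and
  \<open>(1/2)^2 \<le> 2 * lam\<close> is the condition \<open>lam \<ge> 1/8\<close>.\<close>

theorem F_fun_real_zeros:
  assumes "lam \<ge> 1/8" "F_fun lam (Suc n) t = 0"
  shows "Im t = 0"
proof (rule de_bruijn[where w="xi_power_density n" and D="1/2" and l=lam])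
  show "strip_limit (1/2) (fourier_laplace (\<lambda>u. complex_of_real (xi_power_density n u)))"
    unfolding fourier_xi_power_density[abs_def] by (rule strip_limit_power[OF Xi_strip_limit])
  show "fourier_laplace (\<lambda>u. complex_of_real (xi_power_density n u * exp (lam * u\<^sup>2))) t = 0"
    using assms(2) by (simp only: F_fun_eq)
qed (use assms(1) nice_weight_xi_power_density[of n] in \<open>auto simp: nice_weight_def power_divide\<close>)

lemma F_fun_0: "F_fun 0 (Suc n) t = Xi t ^ Suc n"
  unfolding F_fun_eq by (simp add: fourier_xi_power_density del: power_Suc)

section \<open>Infinitely many real zeros\<close>

text \<open>At \<open>\<i> + \<delta>\<close> the term with index \<open>n\<close> acquires the sign
  \<open>(-1) ^ n\<close>, since \<open>n^2\<close> and \<open>n\<close> have the same parity. The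
  alternating sum is twice the sum over even indices minus the full sum, and the even indices give
  theta at \<open>4 * \<delta>\<close>.\<close>

lemma theta_near_i:
  assumes \<delta>: "Re \<delta> > 0"
  shows "jacobi_theta (\<i> + \<delta>) = 2 * jacobi_theta (4 * \<delta>) - jacobi_theta \<delta>"
proof -
  define q where "q m = exp (- of_real pi * of_nat m ^ 2 * \<delta>)" for m :: nat
  have tt: "theta_term 0 n \<delta> = q (Suc n)" for n by (simp add: theta_term_def q_def)
  have t4: "theta_term 0 n (4 * \<delta>) = q (2 * Suc n)" for n
    unfolding theta_term_def q_def by (simp add: power_mult_distrib mult_ac del: of_nat_Suc mult_Suc mult_Suc_right)
  have ti: "theta_term 0 n (\<i> + \<delta>) = (-1) ^ Suc n * q (Suc n)" for n
  proof -
    have "exp (- of_real (pi * real (Suc n) ^ 2) * \<i>) = (-1 :: complex) ^ Suc n"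
    proof -
      have "exp (- of_real (pi * real (Suc n) ^ 2) * \<i>) = exp (of_nat (Suc n * Suc n) * (- (of_real pi * \<i>)))"
        by (simp add: power2_eq_square algebra_simps)
      also have "\<dots> = exp (- (of_real pi * \<i>)) ^ (Suc n * Suc n)" by (rule exp_of_nat_mult)
      also have "exp (- (of_real pi * \<i>)) = (-1 :: complex)" by (simp add: exp_minus)
      also have "(-1 :: complex) ^ (Suc n * Suc n) = (-1) ^ Suc n" by (cases "even n") (auto simp: power_mult)
      finally show ?thesis .
    qed
    moreover have "theta_term 0 n (\<i> + \<delta>) = exp (- of_real (pi * real (Suc n) ^ 2) * \<i>) * exp (- of_real (pi * real (Suc n) ^ 2) * \<delta>)"
      unfolding theta_term_def exp_add[symmetric] distrib_left by simp
    ultimately show ?thesis by (simp add: q_def)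
  qed
  have s1: "(\<lambda>n. q (Suc n)) sums theta_deriv 0 \<delta>" using theta_term_sums[OF \<delta>, of 0] by (simp only: tt)
  have "(\<lambda>n. q (2 * Suc n)) sums theta_deriv 0 (4 * \<delta>)" using theta_term_sums[of "4 * \<delta>" 0] \<delta> unfolding t4 by simp
  then have s4: "(\<lambda>n. 2 * q (2 * Suc n)) sums (2 * theta_deriv 0 (4 * \<delta>))" by (rule sums_mult)
  have "(\<lambda>n. (-1) ^ Suc n * q (Suc n) + q (Suc n)) sums (2 * theta_deriv 0 (4 * \<delta>))"
  proof -
    note reindex = sums_mono_reindex[of "\<lambda>n. 2 * n + 1" "\<lambda>n. (-1) ^ Suc n * q (Suc n) + q (Suc n)", THEN iffD1]
    show ?thesis
    proof (rule reindex)
      show "strict_mono (\<lambda>n::nat. 2 * n + 1)" by (simp add: strict_mono_def)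
      show "(-1) ^ Suc n * q (Suc n) + q (Suc n) = 0" if n: "n \<notin> range (\<lambda>n. 2 * n + 1)" for n
      proof -
        have "even n"
        proof (rule ccontr)
          assume "odd n"
          then obtain m where "n = 2 * m + 1" by (elim oddE)
          then show False using n by blast
        qed
        then show ?thesis by simp
      qed
      show "(\<lambda>n. (-1) ^ Suc (2 * n + 1) * q (Suc (2 * n + 1)) + q (Suc (2 * n + 1))) sums (2 * theta_deriv 0 (4 * \<delta>))"
        using s4 by (simp add: mult_2[symmetric])
    qed
  qed
  from sums_diff[OF this s1] have "(\<lambda>n. theta_term 0 n (\<i> + \<delta>)) sums (2 * theta_deriv 0 (4 * \<delta>) - theta_deriv 0 \<delta>)"
    by (simp add: ti)
  then have "theta_deriv 0 (\<i> + \<delta>) = 2 * theta_deriv 0 (4 * \<delta>) - theta_deriv 0 \<delta>"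
    using theta_term_sums[of "\<i> + \<delta>" 0] \<delta> by (simp add: sums_unique2)
  then show ?thesis by (simp add: jacobi_theta_eq)
qed

lemma csqrt_4_mult: "csqrt (4 * z) = 2 * csqrt z"
  by (rule csqrt_unique) (use csqrt_principal[of z] in \<open>auto simp: power_mult_distrib\<close>)

text \<open>Inversion moves both theta values of \<open>theta_near_i\<close> to points with large
  real part. Since \<open>csqrt (4 * \<delta>) = 2 * csqrt \<delta>\<close>, the constant terms 1
  cancel and only exponentially small tails remain.\<close>

lemma norm_theta_near_i_le:
  assumes \<eta>: "\<eta> > 0" "\<eta> \<le> 1/36" and \<delta>: "Re \<delta> \<ge> \<eta> / 2" "norm \<delta> \<le> 4 * \<eta>"
  shows "norm (jacobi_theta (\<i> + \<delta>)) \<le> 8 / (1 - exp (- pi / 8)) / \<eta> * exp (- pi / (256 * \<eta>))"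
proof -
  have d0: "Re \<delta> > 0" using \<eta> \<delta> by simp
  then have dn: "\<delta> \<noteq> 0" by auto
  have nd: "norm \<delta> > 0" using dn by simp
  have th: "jacobi_theta y = jacobi_theta (1 / y) / csqrt y" if "Re y > 0" for y
    using jacobi_theta_inversion[OF that] that by (auto simp: field_simps)
  have "jacobi_theta (\<i> + \<delta>) = 2 * (jacobi_theta (1 / (4 * \<delta>)) / csqrt (4 * \<delta>)) - jacobi_theta (1 / \<delta>) / csqrt \<delta>"
    unfolding theta_near_i[OF d0] using th[of "4 * \<delta>"] th[of \<delta>] d0 by simp
  also have "\<dots> = (jacobi_theta (1 / (4 * \<delta>)) - jacobi_theta (1 / \<delta>)) / csqrt \<delta>"
    unfolding csqrt_4_mult by (simp add: diff_divide_distrib)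
  also have "\<dots> = 2 * (theta_deriv 0 (1 / (4 * \<delta>)) - theta_deriv 0 (1 / \<delta>)) / csqrt \<delta>"
    by (simp add: jacobi_theta_eq)
  finally have eq: "jacobi_theta (\<i> + \<delta>) = \<dots>" .
  have Re1: "Re (1 / \<delta>) \<ge> 1 / (32 * \<eta>)"
  proof -
    have "Re (1 / \<delta>) = Re \<delta> / (norm \<delta>)\<^sup>2" by (simp add: Re_divide cmod_power2)
    moreover have "(norm \<delta>)\<^sup>2 \<le> (4 * \<eta>)\<^sup>2" using \<delta> by (intro power_mono) auto
    moreover have "\<eta> / 2 / (4 * \<eta>)\<^sup>2 = 1 / (32 * \<eta>)" using \<eta> by (simp add: power2_eq_square)
    moreover have "\<eta> / 2 / (4 * \<eta>)\<^sup>2 \<le> Re \<delta> / (norm \<delta>)\<^sup>2"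
      using calculation(2) \<delta> \<eta> nd d0 by (intro frac_le) auto
    ultimately show ?thesis by simp
  qed
  have "Re (1 / (4 * \<delta>)) = Re (1 / \<delta>) / 4" 
  proof -
    have "1 / (4 * \<delta>) = complex_of_real (1/4) * (1 / \<delta>)" by simp
    then have "Re (1 / (4 * \<delta>)) = Re (complex_of_real (1/4) * (1 / \<delta>))" by (rule arg_cong)
    also have "\<dots> = Re (1 / \<delta>) / 4" unfolding times_complex.sel Re_complex_of_real Im_complex_of_real by simp
    finally show ?thesis .
  qed
  then have Re4: "Re (1 / (4 * \<delta>)) \<ge> 1 / (128 * \<eta>)" using Re1 by simp
  \<comment> \<open>Real parts above 1/4 allow the fixed denominator
    \<open>1 - exp (- pi / 8)\<close> in \<open>norm_theta_deriv_le\<close>.\<close>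
  have c: "1 / (128 * \<eta>) \<ge> 1/4" using \<eta> by (simp add: field_simps)
  have tb: "norm (theta_deriv 0 y) \<le> exp (- pi / (256 * \<eta>)) / (1 - exp (- pi / 8))" if y: "Re y \<ge> 1 / (128 * \<eta>)" for y
  proof -
    have "norm (theta_deriv 0 y) \<le> exp (- pi * Re y / 2) / (1 - exp (- pi / 8))"
      using norm_theta_deriv_le[of "1/4" y 0] y c by simp
    also have "\<dots> \<le> exp (- pi / (256 * \<eta>)) / (1 - exp (- pi / 8))"
    proof (intro divide_right_mono)
      have "pi * (1 / (128 * \<eta>)) \<le> pi * Re y" using y by (intro mult_left_mono) auto
      then show "exp (- pi * Re y / 2) \<le> exp (- pi / (256 * \<eta>))" by simp
    qed simp
    finally show ?thesis .
  qed
  have "1 / (128 * \<eta>) \<le> 1 / (32 * \<eta>)" using \<eta> by (simp add: field_simps)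
  then have "norm (theta_deriv 0 (1 / \<delta>)) \<le> exp (- pi / (256 * \<eta>)) / (1 - exp (- pi / 8))"
    using Re1 by (intro tb) linarith
  then have "norm (theta_deriv 0 (1 / (4 * \<delta>)) - theta_deriv 0 (1 / \<delta>)) \<le> 2 * (exp (- pi / (256 * \<eta>)) / (1 - exp (- pi / 8)))"
    using norm_triangle_ineq4[of "theta_deriv 0 (1 / (4 * \<delta>))" "theta_deriv 0 (1 / \<delta>)"] tb[OF Re4] by linarith
  then have "norm (2 * (theta_deriv 0 (1 / (4 * \<delta>)) - theta_deriv 0 (1 / \<delta>))) \<le> 2 * (2 * (exp (- pi / (256 * \<eta>)) / (1 - exp (- pi / 8))))"
    unfolding norm_mult[of 2] norm_numeral by (rule mult_left_mono) simp
  moreover have "\<eta> / 2 \<le> norm (csqrt \<delta>)"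
  proof -
    have "(\<eta> / 2)\<^sup>2 \<le> \<eta> / 2" using \<eta> by (simp add: power2_eq_square field_simps)
    also have "\<dots> \<le> norm \<delta>" using \<delta>(1) complex_Re_le_cmod[of \<delta>] by linarith
    finally have "sqrt ((\<eta> / 2)\<^sup>2) \<le> sqrt (norm \<delta>)" by (rule real_sqrt_le_mono)
    then show ?thesis using \<eta> by simp
  qed
  ultimately have "norm (jacobi_theta (\<i> + \<delta>)) \<le> 2 * (2 * (exp (- pi / (256 * \<eta>)) / (1 - exp (- pi / 8)))) / (\<eta> / 2)"
    unfolding eq norm_divide using \<eta> by (intro frac_le) auto
  then show ?thesis by (simp add: mult_ac)
qed

text \<open>The theta function is flat at the cusp \<open>\<i>\<close>, which is the point \<open>\<i> pi / 4\<close> in the logarithmic variable;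
  a Cauchy estimate transfers the decay to the kernel.\<close>

lemma xi_kernel_near_cusp:
  obtains K c where "K > 0" "c > 0" "\<And>\<eta>. 0 < \<eta> \<Longrightarrow> \<eta> \<le> 1/36 \<Longrightarrow> norm (xi_kernel (Complex 0 (pi / 4 - \<eta>))) \<le> K / \<eta> ^ 3 * exp (- c / \<eta>)"
proof -
  define K0 where "K0 = exp 1 * (8 / (1 - exp (- pi / 8)))"
  have K0: "K0 > 0" by (simp add: K0_def)
  have main: "norm (xi_kernel (Complex 0 (pi / 4 - \<eta>))) \<le> 9 * K0 / \<eta> ^ 3 * exp (- (pi / 256) / \<eta>)" if \<eta>: "0 < \<eta>" "\<eta> \<le> 1/36" for \<eta>
  proof -
    define z0 where "z0 = Complex 0 (pi / 4 - \<eta>)"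
    define b where "b = K0 / \<eta> * exp (- (pi / 256) / \<eta>)"
    have inS: "z \<in> theta_strip" if "norm (z0 - z) \<le> \<eta> / 2" for z
    proof -
      have "\<bar>Im (z0 - z)\<bar> \<le> \<eta> / 2" using abs_Im_le_cmod[of "z0 - z"] that by linarith
      then show ?thesis using \<eta> pi_gt3 by (auto simp: theta_strip_def z0_def abs_if split: if_splits)
    qed
    have bound: "norm (theta_log z) \<le> b" if z: "norm (z0 - z) \<le> \<eta> / 2" for z
    proof -
      \<comment> \<open>Chosen so that \<open>exp (2 * z) = \<i> * exp v\<close>. At
        \<open>z0\<close> itself \<open>v\<close> is \<open>- 2 * \<i> * \<eta>\<close>; on the
        whole Cauchy disc \<open>Im v \<le> - \<eta>\<close>, which keeps the real part of
        \<open>\<i> * (exp v - 1)\<close> at least \<open>\<eta> / 2\<close>.\<close>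
      define v where "v = 2 * (z - z0) - 2 * \<i> * of_real \<eta>"
      have n: "norm (2 * (z - z0)) \<le> \<eta>" unfolding norm_mult using z by (simp add: norm_minus_commute)
      have nv: "norm v \<le> 3 * \<eta>"
        using norm_triangle_ineq4[of "2 * (z - z0)" "2 * \<i> * of_real \<eta>"] n \<eta> by (simp add: v_def norm_mult)
      have Iv: "Im v \<le> - \<eta>" using abs_Im_le_cmod[of "2 * (z - z0)"] n by (simp add: v_def abs_if split: if_splits)
      have "2 * z = \<i> * of_real (pi / 2) + v" by (simp add: v_def z0_def complex_eq_iff)
      moreover have "exp (\<i> * of_real (pi / 2)) = \<i>" using cis_conv_exp[of "pi / 2"] by simp
      ultimately have e2: "exp (2 * z) = \<i> * exp v" by (simp only: exp_add)
      define \<delta> where "\<delta> = \<i> * (exp v - 1)"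
      have ed: "exp (2 * z) = \<i> + \<delta>" unfolding e2 \<delta>_def by (simp add: algebra_simps)
      define r where "r = exp v - 1 - v"
      have nr: "norm r \<le> 18 * \<eta>\<^sup>2"
      proof -
        have "norm r \<le> exp \<bar>Re v\<bar> * norm v ^ 2"
          using Taylor_exp[of v 1] by (simp add: r_def diff_diff_eq numeral_2_eq_2)
        also have "\<dots> \<le> 2 * (3 * \<eta>) ^ 2"
        proof (intro mult_mono power_mono nv)
          have "\<bar>Re v\<bar> \<le> 1/2" using abs_Re_le_cmod[of v] nv \<eta> by linarith
          then have "exp \<bar>Re v\<bar> \<le> exp (1/2)" by simp
          also have "exp (1/2 :: real) \<le> 2" using exp_bound_half[of "1/2 :: real"] by simp
          finally show "exp \<bar>Re v\<bar> \<le> 2" .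
        qed auto
        finally show ?thesis by (simp add: power_mult_distrib)
      qed
      \<comment> \<open>Absorbing the quadratic Taylor remainder into \<open>\<eta> / 2\<close> is
        what fixes the bound 1/36.\<close>
      have "18 * \<eta>\<^sup>2 \<le> \<eta> / 2" using \<eta> by (simp add: power2_eq_square field_simps)
      then have nr': "norm r \<le> \<eta> / 2" using nr by linarith
      have dr: "\<delta> = \<i> * (v + r)" by (simp add: \<delta>_def r_def)
      have Red: "Re \<delta> \<ge> \<eta> / 2" using Iv abs_Im_le_cmod[of r] nr' by (simp add: dr abs_if split: if_splits)
      have nd: "norm \<delta> \<le> 4 * \<eta>" using norm_triangle_ineq[of v r] nv nr' \<eta> by (simp add: dr norm_mult)
      have "norm (exp (z / 2)) \<le> exp 1"
      proof -
        have "\<bar>Re (z0 - z)\<bar> \<le> \<eta> / 2" using abs_Re_le_cmod[of "z0 - z"] z by linarith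
        then have "Re z \<le> 1" using \<eta> by (simp add: z0_def)
        then show ?thesis by simp
      qed
      then have "norm (theta_log z) \<le> exp 1 * (8 / (1 - exp (- pi / 8)) / \<eta> * exp (- pi / (256 * \<eta>)))"
        unfolding theta_log_def ed norm_mult by (intro mult_mono norm_theta_near_i_le \<eta> Red nd) auto
      then show ?thesis by (simp add: b_def K0_def mult_ac)
    qed
    have holw: "theta_log holomorphic_on theta_strip"
      unfolding holomorphic_on_open[OF open_theta_strip] using theta_log_derivative by blast
    have z0S: "z0 \<in> theta_strip" using inS[of z0] \<eta> by simp
    have sub: "cball z0 (\<eta> / 2) \<subseteq> theta_strip" using inS by (auto simp: dist_norm)
    have "norm ((deriv ^^ 2) theta_log z0) \<le> fact 2 * b / (\<eta> / 2) ^ 2"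
      by (rule Cauchy_inequality)
         (use \<eta> bound sub in \<open>auto intro!: holomorphic_on_subset[OF holw] holomorphic_on_imp_continuous_on\<close>)
    moreover have "(deriv ^^ 2) theta_log z0 = xi_kernel z0 + theta_log z0 / 4"
    proof -
      have "(deriv theta_log has_field_derivative (xi_kernel z0 + theta_log z0 / 4)) (at z0)"
        by (rule has_field_derivative_transform_within_open[OF theta_log'_derivative[OF z0S] open_theta_strip z0S])
           (rule sym, rule DERIV_imp_deriv, rule theta_log_derivative)
      then show ?thesis by (simp add: numeral_2_eq_2 DERIV_imp_deriv)
    qed
    ultimately have "norm (xi_kernel z0 + theta_log z0 / 4) \<le> 8 * b / \<eta>\<^sup>2" by (simp add: power_divide)
    moreover have "norm (theta_log z0 / 4) \<le> b" 
    proof -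
      have "norm (theta_log z0) \<le> b" using bound[of z0] \<eta> by simp
      then show ?thesis unfolding norm_divide norm_numeral using norm_ge_zero[of "theta_log z0"] by linarith
    qed
    moreover have "norm (xi_kernel z0) \<le> norm (xi_kernel z0 + theta_log z0 / 4) + norm (theta_log z0 / 4)"
      using norm_triangle_ineq4[of "xi_kernel z0 + theta_log z0 / 4" "theta_log z0 / 4"] by simp
    ultimately have le: "norm (xi_kernel z0) \<le> 8 * b / \<eta>\<^sup>2 + b" by linarith
    have "b \<le> b / \<eta>\<^sup>2"
    proof -
      have "\<eta>\<^sup>2 \<le> 1" using \<eta> by (simp add: power_le_one)
      moreover have "b \<ge> 0" using K0 \<eta> by (simp add: b_def)
      ultimately show ?thesis using \<eta> by (simp add: le_divide_eq mult_left_le)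
    qed
    with le have "norm (xi_kernel z0) \<le> 8 * b / \<eta>\<^sup>2 + b / \<eta>\<^sup>2" by linarith
    also have "8 * b / \<eta>\<^sup>2 + b / \<eta>\<^sup>2 = 9 * K0 / \<eta> ^ 3 * exp (- (pi / 256) / \<eta>)"
      using \<eta> by (simp add: b_def power2_eq_square power3_eq_cube field_simps)
    finally show ?thesis by (simp add: z0_def)
  qed
  show ?thesis by (rule that[of "9 * K0" "pi / 256"]) (use K0 main in auto)
qed

text \<open>Multiplication by \<open>exp (h * t) + exp (- h * t) - 2\<close> is a second difference
  in \<open>\<beta>\<close> with step \<open>h\<close>. Its coefficients 1, 1, -2 give the factor 4,
  and each difference uses up \<open>h\<close> of the admissible range.\<close>

lemma second_difference_bound:
  fixes g :: "real \<Rightarrow> real" and a r h S :: real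
  assumes base: "\<And>\<beta>. \<bar>\<beta> - a\<bar> \<le> r \<Longrightarrow> integrable lborel (\<lambda>t. g t * exp (\<beta> * t)) \<and> \<bar>LINT t|lborel. g t * exp (\<beta> * t)\<bar> \<le> S"
    and h: "h \<ge> 0"
  shows "\<bar>\<beta> - a\<bar> + real m * h \<le> r \<Longrightarrow> integrable lborel (\<lambda>t. g t * exp (\<beta> * t) * (exp (h * t) + exp (- h * t) - 2) ^ m)
     \<and> \<bar>LINT t|lborel. g t * exp (\<beta> * t) * (exp (h * t) + exp (- h * t) - 2) ^ m\<bar> \<le> 4 ^ m * S"
proof (induction m arbitrary: \<beta>)
  case 0
  then show ?case using base[of \<beta>] by simp
next
  case (Suc m)
  let ?W = "\<lambda>\<beta> t. g t * exp (\<beta> * t) * (exp (h * t) + exp (- h * t) - 2) ^ m"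
  have rng: "\<bar>\<beta> + h - a\<bar> + real m * h \<le> r" "\<bar>\<beta> - h - a\<bar> + real m * h \<le> r" "\<bar>\<beta> - a\<bar> + real m * h \<le> r"
    using Suc.prems h by (auto simp: abs_if algebra_simps split: if_splits)
  note I = Suc.IH[OF rng(1)] Suc.IH[OF rng(2)] Suc.IH[OF rng(3)]
  have eq: "g t * exp (\<beta> * t) * (exp (h * t) + exp (- h * t) - 2) ^ Suc m = ?W (\<beta> + h) t + ?W (\<beta> - h) t - 2 * ?W \<beta> t" for t
  proof -
    have e: "exp ((\<beta> + h) * t) = exp (\<beta> * t) * exp (h * t)" "exp ((\<beta> - h) * t) = exp (\<beta> * t) * exp (- h * t)"
      by (simp_all add: algebra_simps flip: exp_add)
    show ?thesis unfolding e power_Suc by (simp only: algebra_simps)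
  qed
  have int: "integrable lborel (\<lambda>t. ?W (\<beta> + h) t + ?W (\<beta> - h) t - 2 * ?W \<beta> t)"
    using I by (intro Bochner_Integration.integrable_add Bochner_Integration.integrable_diff integrable_mult_right) blast+
  have "(LINT t|lborel. ?W (\<beta> + h) t + ?W (\<beta> - h) t - 2 * ?W \<beta> t) = (LINT t|lborel. ?W (\<beta> + h) t) + (LINT t|lborel. ?W (\<beta> - h) t) - 2 * (LINT t|lborel. ?W \<beta> t)"
    using I by simp
  then have "\<bar>LINT t|lborel. ?W (\<beta> + h) t + ?W (\<beta> - h) t - 2 * ?W \<beta> t\<bar> \<le> 4 * (4 ^ m * S)"
    using I by linarith
  then show ?case unfolding eq using int by simp
qed

lemma Xi_of_real: "Xi (complex_of_real t) = complex_of_real (Re (Xi (complex_of_real t)))"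
  using Xi_cnj[of "complex_of_real t"] by (simp add: complex_eq_iff)

text \<open>The step of the differences is \<open>\<eta> / m\<close>, so that all \<open>m\<close>
  of them stay in a window of half-width \<open>\<eta>\<close>. The lower bound is then a constant
  times \<open>\<eta> ^ (2 * m)\<close> with \<open>m\<close> fixed, which cannot stay below the
  exponentially small kernel values as \<open>\<eta>\<close> tends to 0.\<close>

theorem Xi_infinitely_many_real_zeros: "infinite {t::real. Xi (complex_of_real t) = 0}"
proof
  assume fin: "finite {t::real. Xi (complex_of_real t) = 0}"
  obtain T0 where T0: "\<And>t. Xi (complex_of_real t) = 0 \<Longrightarrow> \<bar>t\<bar> \<le> T0"
    using finite_imp_bounded[OF fin] by (auto simp: bounded_iff)
  define T where "T = max 1 (T0 + 1)"
  have nz: "Xi (complex_of_real t) \<noteq> 0" if "\<bar>t\<bar> \<ge> T" for t using T0[of t] that by (auto simp: T_def)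
  have T: "T \<ge> 1" by (simp add: T_def)
  define X where "X t = Re (Xi (complex_of_real t))" for t
  have XX: "Xi (complex_of_real t) = complex_of_real (X t)" for t unfolding X_def by (rule Xi_of_real)
  have cX: "continuous_on A X" for A unfolding X_def by (intro continuous_intros Xi_real_continuous)
  have Xnz: "X t \<noteq> 0" if "\<bar>t\<bar> \<ge> T" for t using nz[OF that] XX[of t] by auto
  have Xeven: "X (- t) = X t" for t unfolding X_def by (simp add: Xi_even)
  \<comment> \<open>The sign at \<open>T\<close> is the sign on both outer ranges: beyond
    \<open>T\<close> by the intermediate value theorem, and below \<open>- T\<close> by
    evenness.\<close>
  define \<sigma> where "\<sigma> = sgn (X T)"
  have \<sigma>: "\<bar>\<sigma>\<bar> = 1" using Xnz[of T] T by (simp add: \<sigma>_def sgn_if)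
  define g where "g t = \<sigma> * X t" for t
  have cg: "continuous_on A g" for A unfolding g_def by (intro continuous_intros cX)
  have gT: "g T > 0" using Xnz[of T] T by (simp add: g_def \<sigma>_def sgn_if)
  have gpos1: "g t > 0" if t: "t \<ge> T" for t
  proof (rule ccontr)
    assume "\<not> g t > 0"
    then obtain x where "T \<le> x" "x \<le> t" "g x = 0" using IVT2'[of g t 0 T] gT t cg by auto
    then show False using Xnz[of x] \<sigma> T by (auto simp: g_def)
  qed
  have gpos: "g t > 0" if "\<bar>t\<bar> \<ge> T" for t
    using gpos1[of t] gpos1[of "- t"] that Xeven[of t] by (auto simp: g_def abs_if split: if_splits)
  obtain M where M: "\<And>t. t \<in> {-T..T} \<Longrightarrow> \<bar>g t\<bar> \<le> M"
    using compact_imp_bounded[OF compact_continuous_image[OF cg compact_Icc]] unfolding bounded_iff real_norm_def by blast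
  have M0: "M \<ge> 0" using M[of 0] T by auto
  have base: "integrable lborel (\<lambda>t. g t * exp (\<beta> * t)) \<and> \<bar>LINT t|lborel. g t * exp (\<beta> * t)\<bar> \<le> 2 * pi * norm (xi_kernel (Complex 0 \<beta>))"
    if \<beta>: "\<bar>\<beta>\<bar> < pi / 4" for \<beta>
  proof -
    have e: "Xi (complex_of_real t) * complex_of_real (exp (\<beta> * t)) = complex_of_real (X t * exp (\<beta> * t))" for t
      unfolding XX by (simp only: of_real_mult)
    have i: "integrable lborel (\<lambda>t. X t * exp (\<beta> * t))"
      using Xi_exp_integrable[OF \<beta>] unfolding e complex_of_real_integrable_eq .
    have "complex_of_real (LINT t|lborel. X t * exp (\<beta> * t)) = 2 * pi * xi_kernel (Complex 0 \<beta>)"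
      using Xi_exp_integral[OF \<beta>] unfolding e integral_complex_of_real .
    from arg_cong[OF this, of norm] have "\<bar>LINT t|lborel. X t * exp (\<beta> * t)\<bar> = 2 * pi * norm (xi_kernel (Complex 0 \<beta>))"
      unfolding norm_of_real norm_mult by simp
    moreover have "(LINT t|lborel. g t * exp (\<beta> * t)) = \<sigma> * (LINT t|lborel. X t * exp (\<beta> * t))"
      unfolding g_def mult.assoc by (rule integral_mult_right_zero)
    ultimately show ?thesis using i \<sigma> unfolding g_def mult.assoc by (auto simp: abs_mult)
  qed
  have gi: "integrable lborel (\<lambda>t. g t * indicator {2*T..2*T+1} t)"
  proof -
    have "integrable lborel (\<lambda>t. indicator {2*T..2*T+1} t *\<^sub>R g t)"
      using borel_integrable_compact[of "{2*T..2*T+1}" g] cg by simp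
    then show ?thesis by (simp add: mult.commute)
  qed
  define d where "d = (LINT t|lborel. g t * indicator {2*T..2*T+1} t)"
  have d: "d > 0"
  proof -
    obtain x where x: "x \<in> {2*T..2*T+1}" "\<And>y. y \<in> {2*T..2*T+1} \<Longrightarrow> g x \<le> g y"
      using continuous_attains_inf[of "{2*T..2*T+1}" g] cg by auto
    have "(LINT t|lborel. g x * indicator {2*T..2*T+1} t) \<le> d"
      unfolding d_def
    proof (rule integral_mono[OF _ gi])
      show "integrable lborel (\<lambda>t. g x * indicator {2*T..2*T+1} t)" by simp
      show "g x * indicator {2*T..2*T+1} t \<le> g t * indicator {2*T..2*T+1} t" for t
        using x(2)[of t] by (cases "t \<in> {2*T..2*T+1}") auto
    qed
    moreover have "g x > 0" using gpos[of x] x T by auto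
    ultimately show ?thesis by simp
  qed
  \<comment> \<open>Up to a common factor, the range \<open>[-T, T]\<close> costs at most
    \<open>M * exp T * (2 * T)\<close>, while the mass \<open>d\<close> on
    \<open>[2 * T, 2 * T + 1]\<close> gains \<open>4 ^ m\<close>. The choice does not involve
    \<open>\<eta>\<close>; the later \<open>Suc\<close> makes \<open>m\<close> positive for the
    division \<open>\<eta> / m\<close>.\<close>
  obtain m0 :: nat where m0: "(M * exp T * (2 * T) + 1) / d < 4 ^ m0" using real_arch_pow[of 4] by auto
  define m where "m = Suc m0"
  have m1: "real m \<ge> 1" by (simp add: m_def)
  have m: "M * exp T * (2 * T) + 1 \<le> 4 ^ m * d"
  proof -
    have "(M * exp T * (2 * T) + 1) < 4 ^ m0 * d" using m0 d by (simp add: field_simps)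
    moreover have "(4::real) ^ m0 * d \<le> 4 ^ m * d" using d by (simp add: m_def)
    ultimately show ?thesis by linarith
  qed
  obtain K c where K: "K > 0" "c > 0" "\<And>\<eta>. 0 < \<eta> \<Longrightarrow> \<eta> \<le> 1/36 \<Longrightarrow> norm (xi_kernel (Complex 0 (pi / 4 - \<eta>))) \<le> K / \<eta> ^ 3 * exp (- c / \<eta>)"
    using xi_kernel_near_cusp by blast
  have ineq: "((\<eta> / m * T)\<^sup>2 / 2) ^ m \<le> 4 ^ m * (2 * pi * (K / \<eta> ^ 3 * exp (- c / (3 * \<eta>))))" if \<eta>: "0 < \<eta>" "\<eta> \<le> 1/108" for \<eta>
  proof -
    define h where "h = \<eta> / m"
    have h: "h > 0" "real m * h = \<eta>" using \<eta> m1 by (auto simp: h_def)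
    \<comment> \<open>Exponents within \<open>\<eta>\<close> of this centre have distance between
      \<open>\<eta>\<close> and \<open>3 * \<eta>\<close> from \<open>pi / 4\<close>; the bound
      1/108 keeps \<open>3 * \<eta>\<close> within the 1/36 of the cusp estimate.\<close>
    define \<alpha> where "\<alpha> = pi / 4 - 2 * \<eta>"
    have \<alpha>: "0 \<le> \<alpha>" "\<alpha> \<le> 1" using \<eta> pi_gt3 pi_less_4 by (auto simp: \<alpha>_def)
    define S where "S = 2 * pi * (K / \<eta> ^ 3 * exp (- c / (3 * \<eta>)))"
    have baseS: "integrable lborel (\<lambda>t. g t * exp (\<beta> * t)) \<and> \<bar>LINT t|lborel. g t * exp (\<beta> * t)\<bar> \<le> S" if \<beta>: "\<bar>\<beta> - \<alpha>\<bar> \<le> \<eta>" for \<beta>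
    proof -
      define \<eta>' where "\<eta>' = pi / 4 - \<beta>"
      have \<eta>': "\<eta> \<le> \<eta>'" "\<eta>' \<le> 3 * \<eta>" using \<beta> by (auto simp: \<eta>'_def \<alpha>_def abs_if split: if_splits)
      have b4: "\<bar>\<beta>\<bar> < pi / 4" using \<eta>' \<eta> pi_gt3 by (auto simp: \<eta>'_def abs_if)
      have "norm (xi_kernel (Complex 0 \<beta>)) \<le> K / \<eta>' ^ 3 * exp (- c / \<eta>')"
        using K(3)[of \<eta>'] \<eta>' \<eta> by (simp add: \<eta>'_def)
      also have "\<dots> \<le> K / \<eta> ^ 3 * exp (- c / (3 * \<eta>))"
      proof (intro mult_mono)
        show "K / \<eta>' ^ 3 \<le> K / \<eta> ^ 3" using K(1) \<eta> \<eta>' by (intro divide_left_mono power_mono mult_pos_pos) auto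
        have "c / (3 * \<eta>) \<le> c / \<eta>'" using K(2) \<eta> \<eta>' by (intro divide_left_mono mult_pos_pos) auto
        then show "exp (- c / \<eta>') \<le> exp (- c / (3 * \<eta>))" by simp
      qed (use K(1) \<eta> in auto)
      finally have "2 * pi * norm (xi_kernel (Complex 0 \<beta>)) \<le> S" unfolding S_def by (intro mult_left_mono) auto
      then show ?thesis using base[OF b4] by linarith
    qed
    define C where "C t = exp (h * t) + exp (- h * t) - 2" for t
    have Cc: "C t = 2 * cosh (h * t) - 2" for t by (simp add: C_def cosh_field_def)
    have C0: "C t \<ge> 0" for t using cosh_real_ge_1[of "h * t"] by (simp add: Cc)
    have Cmono: "C s \<le> C t" if "\<bar>s\<bar> \<le> \<bar>t\<bar>" for s t
    proof -
      have ab: "cosh (h * t) = cosh (h * \<bar>t\<bar>)" for t by (cases "t \<ge> 0") auto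
      have "cosh (h * \<bar>s\<bar>) \<le> cosh (h * \<bar>t\<bar>)" using that h by (subst cosh_real_nonneg_le_iff) auto
      then show ?thesis unfolding Cc ab[of s] ab[of t] by simp
    qed
    \<comment> \<open>The difference of the two sides is
      \<open>4 * (cosh (h * T) - 1)^2\<close>.\<close>
    have C2: "C (2 * T) \<ge> 4 * C T"
    proof -
      let ?y = "cosh (h * T)"
      have "cosh (h * (2 * T)) = 2 * ?y\<^sup>2 - 1" using cosh_double_cosh[of "h * T"] by (simp add: mult.left_commute)
      moreover have "0 \<le> (?y - 1) * (?y - 1)" by simp
      ultimately show ?thesis unfolding Cc by (simp add: power2_eq_square algebra_simps)
    qed
    have CT: "C T \<ge> (h * T)\<^sup>2 / 2"
    proof -
      have "1 + h * T + (h * T)\<^sup>2 / 2 \<le> exp (h * T)" using h T by (intro exp_lower_Taylor_quadratic) auto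
      moreover have "1 + - (h * T) \<le> exp (- (h * T))" by (rule exp_ge_add_one_self)
      ultimately show ?thesis by (simp add: C_def)
    qed
    have CTpos: "C T > 0" using CT h T by (intro less_le_trans[OF _ CT]) auto
    \<comment> \<open>After multiplication by \<open>C T ^ m\<close> this lies below the integrand:
      the gain \<open>4 ^ m\<close> is kept on one unit interval past \<open>2 * T\<close>, the
      worst case is assumed on \<open>[-T, T]\<close>, and everything else is nonnegative. By the
      choice of \<open>m\<close> its integral is at least 1.\<close>
    define L where "L t = 4 ^ m * (g t * indicator {2*T..2*T+1} t) - M * exp T * indicator {-T..T} t" for t
    have iL: "integrable lborel L" "(LINT t|lborel. L t) = 4 ^ m * d - M * exp T * (2 * T)"
    proof -
      have i2: "integrable lborel (\<lambda>t. M * exp T * indicator {-T..T} t)" using T by simp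
      show "integrable lborel L" unfolding L_def by (intro Bochner_Integration.integrable_diff integrable_mult_right gi i2)
      show "(LINT t|lborel. L t) = 4 ^ m * d - M * exp T * (2 * T)"
        unfolding L_def using gi i2 T by (subst Bochner_Integration.integral_diff) (auto simp: d_def)
    qed
    have "\<bar>\<alpha> - \<alpha>\<bar> + real m * h \<le> \<eta>" using h by simp
    from second_difference_bound[OF baseS less_imp_le[OF h(1)] this]
    have W: "integrable lborel (\<lambda>t. g t * exp (\<alpha> * t) * C t ^ m)" "\<bar>LINT t|lborel. g t * exp (\<alpha> * t) * C t ^ m\<bar> \<le> 4 ^ m * S"
      unfolding C_def by blast+
    have pw: "C T ^ m * L t \<le> g t * exp (\<alpha> * t) * C t ^ m" for t
    proof -
      consider "\<bar>t\<bar> \<le> T" | "2 * T \<le> t" "t \<le> 2 * T + 1" | "\<bar>t\<bar> > T" "\<not> (2 * T \<le> t \<and> t \<le> 2 * T + 1)" by linarith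
      then show ?thesis
      proof cases
        case 1
        then have Lt: "L t = - (M * exp T)" using T by (auto simp: L_def indicator_def)
        have "\<alpha> * t \<le> T"
        proof -
          have "\<alpha> * t \<le> \<alpha> * \<bar>t\<bar>" using \<alpha> by (intro mult_left_mono) auto
          also have "\<dots> \<le> 1 * T" using \<alpha> 1 T by (intro mult_mono) auto
          finally show ?thesis by simp
        qed
        moreover have "\<bar>g t\<bar> \<le> M" by (rule M) (use 1 in auto)
        ultimately have e1: "\<bar>g t\<bar> * exp (\<alpha> * t) \<le> M * exp T" using M0 by (intro mult_mono) auto
        have e2: "C t ^ m \<le> C T ^ m" using Cmono[of t T] 1 T C0 by (intro power_mono) auto
        have "\<bar>g t\<bar> * exp (\<alpha> * t) * C t ^ m \<le> M * exp T * C T ^ m" by (rule mult_mono[OF e1 e2]) (use M0 C0 in auto)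
        moreover have "- (\<bar>g t\<bar> * exp (\<alpha> * t) * C t ^ m) \<le> g t * exp (\<alpha> * t) * C t ^ m"
        proof -
          have "- \<bar>g t\<bar> * (exp (\<alpha> * t) * C t ^ m) \<le> g t * (exp (\<alpha> * t) * C t ^ m)" using C0[of t] by (intro mult_right_mono) auto
          then show ?thesis by (simp add: mult.assoc)
        qed
        ultimately show ?thesis unfolding Lt by (simp add: mult_ac)
      next
        case 2
        have Lt: "L t = 4 ^ m * g t" using 2 T by (auto simp: L_def indicator_def)
        have gt: "g t > 0" using gpos[of t] 2 T by auto
        have "C T ^ m * 4 ^ m = (4 * C T) ^ m" by (simp add: power_mult_distrib)
        also have "\<dots> \<le> C t ^ m" using C2 Cmono[of "2 * T" t] 2 T CTpos by (intro power_mono) auto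
        finally have "C T ^ m * 4 ^ m \<le> C t ^ m" .
        moreover have "1 \<le> exp (\<alpha> * t)" using \<alpha> 2 T by auto
        ultimately have "1 * (C T ^ m * 4 ^ m) \<le> exp (\<alpha> * t) * C t ^ m" using CTpos by (intro mult_mono) auto
        then have "g t * (1 * (C T ^ m * 4 ^ m)) \<le> g t * (exp (\<alpha> * t) * C t ^ m)" using gt by (intro mult_left_mono) auto
        then show ?thesis unfolding Lt by (simp add: mult_ac)
      next
        case 3
        then have "L t = 0" by (auto simp: L_def indicator_def)
        moreover have "g t > 0" using gpos[of t] 3 by simp
        ultimately show ?thesis using C0[of t] by simp
      qed
    qed
    have "C T ^ m * 1 \<le> C T ^ m * (LINT t|lborel. L t)"
      using m CTpos unfolding iL(2) by (intro mult_left_mono) auto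
    also have "\<dots> = (LINT t|lborel. C T ^ m * L t)" by simp
    also have "\<dots> \<le> (LINT t|lborel. g t * exp (\<alpha> * t) * C t ^ m)"
      by (rule integral_mono[OF _ W(1) pw]) (use iL(1) in simp)
    also have "\<dots> \<le> 4 ^ m * S" using W(2) by linarith
    finally have "C T ^ m \<le> 4 ^ m * S" by simp
    moreover have "((h * T)\<^sup>2 / 2) ^ m \<le> C T ^ m" using CT by (intro power_mono) auto
    ultimately show ?thesis unfolding S_def h_def by linarith
  qed
  \<comment> \<open>The exponent collects \<open>\<eta> ^ (2 * m)\<close> from the lower bound and
    \<open>\<eta> ^ 3\<close> from the kernel estimate. In the variable
    \<open>x = c / (3 * \<eta>)\<close> the comparison becomes one with
    \<open>x ^ N / exp x\<close>.\<close>
  define N where "N = 2 * m + 3"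
  define A where "A = ((T / m)\<^sup>2 / 2) ^ m"
  define B where "B = 4 ^ m * (2 * pi * K) * (3 / c) ^ N"
  have A: "A > 0" using T m1 by (simp add: A_def)
  have B: "B > 0" using K by (simp add: B_def)
  have lim: "((\<lambda>x. B * (x ^ N / exp x)) \<longlongrightarrow> B * 0) at_top" by (intro tendsto_mult tendsto_const tendsto_power_div_exp_0)
  then have "eventually (\<lambda>x. B * (x ^ N / exp x) < A) at_top" using A by (intro order_tendstoD(2)[OF lim]) simp
  then have "eventually (\<lambda>x. B * (x ^ N / exp x) < A \<and> x \<ge> 36 * c) at_top"
    using eventually_ge_at_top[of "36 * c"] by eventually_elim auto
  then obtain x where x: "B * (x ^ N / exp x) < A" "x \<ge> 36 * c" by (auto dest: eventually_happens)
  define \<eta> where "\<eta> = c / (3 * x)"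
  have x0: "x > 0" using x(2) K(2) by (auto intro: less_le_trans[of 0 "36 * c"])
  have \<eta>: "0 < \<eta>" "\<eta> \<le> 1/108" using x x0 K(2) by (auto simp: \<eta>_def field_simps)
  have "A * \<eta> ^ (2 * m) \<le> 4 ^ m * (2 * pi * (K / \<eta> ^ 3 * exp (- c / (3 * \<eta>))))"
  proof -
    have "(\<eta> / m * T)\<^sup>2 / 2 = (T / m)\<^sup>2 / 2 * \<eta>\<^sup>2" by (simp add: power2_eq_square)
    then have "((\<eta> / m * T)\<^sup>2 / 2) ^ m = A * \<eta> ^ (2 * m)" by (simp only: A_def power_mult_distrib power_mult)
    then show ?thesis using ineq[OF \<eta>] by (simp only:)
  qed
  also have "c / (3 * \<eta>) = x" using x0 K(2) by (simp add: \<eta>_def)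
  then have "exp (- c / (3 * \<eta>)) = inverse (exp x)" by (simp add: exp_minus)
  finally have "A * \<eta> ^ (2 * m) * \<eta> ^ 3 \<le> 4 ^ m * (2 * pi * (K / \<eta> ^ 3 * inverse (exp x))) * \<eta> ^ 3"
    using \<eta> by (intro mult_right_mono) auto
  then have 1: "A * \<eta> ^ N \<le> 4 ^ m * (2 * pi * K) / exp x"
    using \<eta> by (simp add: N_def power_add field_simps)
  have "A = A * \<eta> ^ N * (1 / \<eta>) ^ N" using \<eta> by (simp add: power_divide)
  also have "\<dots> \<le> 4 ^ m * (2 * pi * K) / exp x * (1 / \<eta>) ^ N" using 1 \<eta> by (intro mult_right_mono) auto
  also have "1 / \<eta> = 3 / c * x" using x0 K(2) by (simp add: \<eta>_def)
  also have "4 ^ m * (2 * pi * K) / exp x * (3 / c * x) ^ N = B * (x ^ N / exp x)" unfolding B_def power_mult_distrib by simp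
  finally show False using x(1) by linarith
qed

theorem theorem3p1:
  fixes k :: nat
  assumes "1 \<le> k"
  shows "(\<forall>lam::real. lam \<ge> 1/8 \<longrightarrow> (\<forall>t::complex. F_fun lam k t = 0 \<longrightarrow> Im t = 0))
       \<and> infinite {t::real. F_fun 0 k (complex_of_real t) = 0}"
proof -
  obtain n where k: "k = Suc n" using assms by (cases k) auto
  show ?thesis unfolding k using F_fun_real_zeros Xi_infinitely_many_real_zeros by (simp add: F_fun_0)
qed

end
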